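(* Let $m\ge1$ be an integer, $\alpha\in(0,1)$, and let $H,S\in C^{m,\alpha}(\partial\Delta,\mathbb C^{n\times n})$ be such that $H(\zeta)$ is Hermitian, $S(\zeta)$ is symmetric, and $v^tH(\zeta)\bar v>|v^tS(\zeta)v|$ for all $\zeta\in\partial\Delta$ and $v\in\mathbb C^n\setminus\{0\}$. Then for every $f\in C^{m,\alpha}(\partial\Delta,\mathbb C^n)$ and every $(\zeta_0,z_0,v_0)\in\overline\Delta\times\mathbb C^n\times\mathbb C^n$ there exists a unique $g\in\mathcal O^{m,\alpha}(\partial\Delta,\mathbb C^n)$ such that $g(\zeta_0)=z_0$, $g'(\zeta_0)=v_0$, and $$H\,\overline{(g/\mathrm{Id}_{\partial\Delta})}+S\,g/\mathrm{Id}_{\partial\Delta}+f\in\mathcal O^{m,\alpha}(\partial\Delta,\mathbb C^n).$$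
   Context: $\Delta$ is the open unit disc in $\mathbb C$, $\mathrm{Id}_{\partial\Delta}$ is the function $\zeta\mapsto\zeta$ on $\partial\Delta$, and $C^{m,\alpha}(\partial\Delta,\cdot)$ denotes Hölder spaces on the circle. $\mathcal O^{m,\alpha}(\partial\Delta,\mathbb C^n)$ is the subspace of $C^{m,\alpha}(\partial\Delta,\mathbb C^n)$ consisting of maps that extend holomorphically to $\Delta$ (continuously up to the boundary); such a map is identified with its holomorphic extension, so that $g(\zeta_0)$ and $g'(\zeta_0)$ make sense for $\zeta_0\in\overline\Delta$. *)

theory Defs
  imports "HOL-Analysis.Analysis"
begin

definition holder_circle :: "nat \<Rightarrow> real \<Rightarrow> (complex \<Rightarrow> 'a::real_normed_vector) \<Rightarrow> bool" where
  "holder_circle m \<alpha> F \<longleftrightarrow>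
     (\<exists>D :: nat \<Rightarrow> real \<Rightarrow> 'a.
        (\<forall>\<theta>. D 0 \<theta> = F (cis \<theta>)) \<and>
        (\<forall>k<m. \<forall>\<theta>. (D k has_vector_derivative D (Suc k) \<theta>) (at \<theta>)) \<and>
        (\<exists>C. \<forall>s t. norm (D m s - D m t) \<le> C * \<bar>s - t\<bar> powr \<alpha>))"

text \<open>A map g : C -> C^n, viewed on the closed disc, that is holomorphic
  (componentwise) on the open disc, continuous on the closed disc, and whose
  boundary values lie in C^{m,alpha}: g is the holomorphic extension of an
  element of O^{m,alpha}(boundary Delta, C^n).\<close>
definition hol_disc :: "nat \<Rightarrow> real \<Rightarrow> (complex \<Rightarrow> complex ^ 'n) \<Rightarrow> bool" where
  "hol_disc m \<alpha> g \<longleftrightarrow>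
     holder_circle m \<alpha> g \<and>
     (\<forall>i. (\<lambda>z. g z $ i) holomorphic_on ball 0 1 \<and>
          continuous_on (cball 0 1) (\<lambda>z. g z $ i))"

definition in_O :: "nat \<Rightarrow> real \<Rightarrow> (complex \<Rightarrow> complex ^ 'n) \<Rightarrow> bool" where
  "in_O m \<alpha> F \<longleftrightarrow> (\<exists>G. hol_disc m \<alpha> G \<and> (\<forall>\<zeta>\<in>sphere 0 1. G \<zeta> = F \<zeta>))"

definition disc_deriv_at :: "(complex \<Rightarrow> complex ^ 'n) \<Rightarrow> complex \<Rightarrow> complex ^ 'n \<Rightarrow> bool" where
  "disc_deriv_at g \<zeta>0 v \<longleftrightarrow>
     (\<forall>i. ((\<lambda>z. g z $ i) has_field_derivative (v $ i)) (at \<zeta>0 within cball 0 1))"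

end

theory Submission
  imports Defs "HOL-Complex_Analysis.Complex_Analysis"
begin

text \<open>
  On the circle, conjugation turns the problem into a real-linear one: with \<open>A\<close> the symbol
  \<open>v \<mapsto> H cnj v + S v\<close> and \<open>g = z + v \<zeta> + u \<zeta>\<close>, one looks for \<open>u\<close>, \<open>F\<close> in the disc algebra with \<open>u(0) = 0\<close>
  and \<open>F = A u + f\<close> on the circle. The positivity hypothesis says that \<open>A\<close> is coercive, and the bilinear product
  of \<open>u\<close> and \<open>F\<close> is holomorphic, so its mean against a suitable weight vanishes.

  Existence: Galerkin approximation by polynomials, compactness coming from the energy identity for \<open>u\<close> and for
  its tangential derivative.

  Regularity: testing the equation against the Poisson kernel of a point \<open>a\<close> and against its square yields
  \<open>|u'(a)| \<le> C (1 - |a|) powr (\<alpha> - 1)\<close>, which is Hoelder continuity by Hardy and Littlewood; no singular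
  integrals occur. Difference quotients along the circle give the higher derivatives.

  General \<open>\<zeta>0\<close>: the solution space of the homogeneous problem has real dimension \<open>4n\<close>, so it suffices that a
  homogeneous solution with a double zero at \<open>\<zeta>0\<close> vanishes. For interior \<open>\<zeta>0\<close> this is the energy identity with
  weight \<open>|\<zeta> - \<zeta>0| powr (-4)\<close>; on the circle, one divides by \<open>\<zeta> - \<zeta>0\<close> and compares the Hoelder decay of the
  quotient with Harnack's inequality.
\<close>

section \<open>Circle means and the disc algebra\<close>

text \<open>The varying symbol is the obstacle to regularity. Freezing \<open>A\<close> at the
  radial projection \<open>\<sigma>\<close> of \<open>a\<close> leaves an error proportional to
  \<open>u a\<close>, so each interior estimate contains the unknown size of \<open>u a\<close>; as
  the derivative bound has only the integrable singularity
  \<open>(1 - cmod a) powr (\<alpha> - 1)\<close>, Gronwall along radii removes it. The Poisson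
  kernel alone bounds \<open>u - u a\<close> in mean square by
  \<open>\<delta> powr \<alpha>\<close>, \<open>\<delta> = 1 - (cmod a)\<^sup>2\<close>, half the
  exponent wanted. But it locates \<open>F a\<close> within order
  \<open>\<delta> powr \<alpha>\<close> of its frozen boundary value, which makes the squared kernel
  usable. Constants depend only on the symbol, \<open>\<alpha>\<close> and the dimension, hence
  apply uniformly to difference quotients. At a boundary point the weight of order \<open>-4\<close>
  is out of reach, because \<open>g\<close> may be no better than once Hoelder differentiable. Only
  one factor \<open>\<zeta> - \<zeta>0\<close> is divided out; it absorbs the
  \<open>cnj \<zeta>\<close> in front of \<open>g\<close>, and the zero left over suffices for the
  comparison of decay rates.\<close>

definition cmean :: "(complex \<Rightarrow> 'a::euclidean_space) \<Rightarrow> 'a" where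
  "cmean \<phi> = integral {0..2*pi} (\<lambda>t. \<phi> (cis t)) /\<^sub>R (2*pi)"

lemma continuous_on_circle_cis:
  "continuous_on (sphere 0 1) \<phi> \<Longrightarrow> continuous_on S (\<lambda>t. \<phi> (cis t))"
  by (rule continuous_on_compose2[of "sphere 0 1" \<phi>]) (auto intro!: continuous_intros)

lemma integrable_circle_cis:
  fixes \<phi> :: "complex \<Rightarrow> 'a::euclidean_space"
  shows "continuous_on (sphere 0 1) \<phi> \<Longrightarrow> (\<lambda>t. \<phi> (cis t)) integrable_on {a..b}"
  by (intro integrable_continuous_interval continuous_on_circle_cis)

lemma circle_cisE:
  assumes "\<zeta> \<in> sphere 0 1"
  obtains t where "t \<in> {0..2*pi}" "\<zeta> = cis t"
proof -
  have "cmod \<zeta> = 1" using assms by simp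
  hence "\<zeta> = cis (Arg2pi \<zeta>)"
    by (metis Arg2pi_eq cis_conv_exp mult_1 of_real_1)
  moreover have "Arg2pi \<zeta> \<in> {0..2*pi}"
    using Arg2pi_ge_0[of \<zeta>] Arg2pi_lt_2pi[of \<zeta>] by auto
  ultimately show ?thesis using that by blast
qed

lemma cmean_cong: "(\<And>\<zeta>. \<zeta> \<in> sphere 0 1 \<Longrightarrow> \<phi> \<zeta> = \<psi> \<zeta>) \<Longrightarrow> cmean \<phi> = cmean \<psi>"
  unfolding cmean_def by simp

lemma cmean_const [simp]: "cmean (\<lambda>_. c) = c"
  unfolding cmean_def by simp

lemma cmean_linear:
  assumes "bounded_linear h" "continuous_on (sphere 0 1) \<phi>"
  shows "cmean (\<lambda>\<zeta>. h (\<phi> \<zeta>)) = h (cmean \<phi>)"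
proof -
  interpret bounded_linear h by fact
  have "integral {0..2*pi} (\<lambda>t. h (\<phi> (cis t))) = h (integral {0..2*pi} (\<lambda>t. \<phi> (cis t)))"
    using integral_linear[OF integrable_circle_cis[OF assms(2)] assms(1)] by (simp add: o_def)
  thus ?thesis by (simp add: cmean_def scaleR)
qed

lemma cmean_add:
  "continuous_on (sphere 0 1) \<phi> \<Longrightarrow> continuous_on (sphere 0 1) \<psi> \<Longrightarrow>
    cmean (\<lambda>\<zeta>. \<phi> \<zeta> + \<psi> \<zeta>) = cmean \<phi> + cmean \<psi>"
  unfolding cmean_def by (simp add: integral_add integrable_circle_cis scaleR_add_right)

lemma cmean_diff:
  "continuous_on (sphere 0 1) \<phi> \<Longrightarrow> continuous_on (sphere 0 1) \<psi> \<Longrightarrow>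
    cmean (\<lambda>\<zeta>. \<phi> \<zeta> - \<psi> \<zeta>) = cmean \<phi> - cmean \<psi>"
  unfolding cmean_def by (simp add: integral_diff integrable_circle_cis scaleR_diff_right)

lemma cmean_sum:
  "finite I \<Longrightarrow> (\<And>i. i \<in> I \<Longrightarrow> continuous_on (sphere 0 1) (\<phi> i)) \<Longrightarrow>
    cmean (\<lambda>\<zeta>. \<Sum>i\<in>I. \<phi> i \<zeta>) = (\<Sum>i\<in>I. cmean (\<phi> i))"
  unfolding cmean_def by (simp add: integral_sum integrable_circle_cis scaleR_sum_right)

lemma cmean_mult_left:
  fixes \<phi> :: "complex \<Rightarrow> complex"
  shows "continuous_on (sphere 0 1) \<phi> \<Longrightarrow> cmean (\<lambda>\<zeta>. c * \<phi> \<zeta>) = c * cmean \<phi>"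
  by (rule cmean_linear[OF bounded_linear_mult_right])

lemma cmean_mult_left_real:
  fixes \<phi> :: "complex \<Rightarrow> real"
  shows "continuous_on (sphere 0 1) \<phi> \<Longrightarrow> cmean (\<lambda>\<zeta>. c * \<phi> \<zeta>) = c * cmean \<phi>"
  by (rule cmean_linear[OF bounded_linear_mult_right])

lemmas cmean_Re = cmean_linear[OF bounded_linear_Re]
lemmas cmean_cnj = cmean_linear[OF bounded_linear_cnj]
lemmas cmean_of_real = cmean_linear[OF bounded_linear_of_real]
lemmas cmean_nth = cmean_linear[OF bounded_linear_vec_nth]

lemma cmean_mono:
  fixes \<phi> \<psi> :: "complex \<Rightarrow> real"
  assumes "continuous_on (sphere 0 1) \<phi>" "continuous_on (sphere 0 1) \<psi>"
    and "\<And>\<zeta>. \<zeta> \<in> sphere 0 1 \<Longrightarrow> \<phi> \<zeta> \<le> \<psi> \<zeta>"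
  shows "cmean \<phi> \<le> cmean \<psi>"
  unfolding cmean_def
  using assms by (auto intro!: mult_left_mono integral_le integrable_circle_cis simp: divide_right_mono)

lemma norm_cmean_le:
  assumes "continuous_on (sphere 0 1) \<phi>" "continuous_on (sphere 0 1) \<psi>"
    and "\<And>\<zeta>. \<zeta> \<in> sphere 0 1 \<Longrightarrow> norm (\<phi> \<zeta>) \<le> \<psi> \<zeta>"
  shows "norm (cmean \<phi>) \<le> cmean \<psi>"
proof -
  have "norm (integral {0..2*pi} (\<lambda>t. \<phi> (cis t))) \<le> integral {0..2*pi} (\<lambda>t. \<psi> (cis t))"
    using assms by (auto intro!: integral_norm_bound_integral integrable_circle_cis)
  thus ?thesis by (simp add: cmean_def divide_right_mono field_simps)
qed

lemma cmean_nonneg: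
  fixes \<phi> :: "complex \<Rightarrow> real"
  assumes "continuous_on (sphere 0 1) \<phi>" "\<And>\<zeta>. \<zeta> \<in> sphere 0 1 \<Longrightarrow> 0 \<le> \<phi> \<zeta>"
  shows "0 \<le> cmean \<phi>"
  using cmean_mono[of "\<lambda>_. 0" \<phi>] assms by auto

lemma cmean_eq_0_imp:
  fixes \<phi> :: "complex \<Rightarrow> real"
  assumes "continuous_on (sphere 0 1) \<phi>" "\<And>\<zeta>. \<zeta> \<in> sphere 0 1 \<Longrightarrow> 0 \<le> \<phi> \<zeta>" "cmean \<phi> = 0"
    and "\<zeta> \<in> sphere 0 1"
  shows "\<phi> \<zeta> = 0"
proof -
  have "integral {0..2*pi} (\<lambda>t. \<phi> (cis t)) = 0" using assms(3) by (simp add: cmean_def)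
  hence "\<forall>t\<in>{0..2*pi}. \<phi> (cis t) = 0"
    using integral_eq_0_iff[of 0 "2*pi" "\<lambda>t. \<phi> (cis t)"] assms continuous_on_circle_cis[OF assms(1)]
    by auto
  thus ?thesis using circle_cisE[OF assms(4)] by metis
qed

lemma cmean_circle_derivative:
  assumes "\<And>t. ((\<lambda>t. \<phi> (cis t)) has_vector_derivative \<psi> (cis t)) (at t)"
  shows "cmean \<psi> = 0"
proof -
  have "((\<lambda>t. \<psi> (cis t)) has_integral (\<phi> (cis (2*pi)) - \<phi> (cis 0))) {0..2*pi}"
    using assms by (intro fundamental_theorem_of_calculus) (auto intro: has_vector_derivative_at_within)
  thus ?thesis by (simp add: cmean_def integral_unique)
qed

definition disc_alg :: "(complex \<Rightarrow> complex) \<Rightarrow> bool" where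
  "disc_alg \<phi> \<longleftrightarrow> \<phi> holomorphic_on ball 0 1 \<and> continuous_on (cball 0 1) \<phi>"

lemma disc_algI: "\<phi> holomorphic_on ball 0 1 \<Longrightarrow> continuous_on (cball 0 1) \<phi> \<Longrightarrow> disc_alg \<phi>"
  by (simp add: disc_alg_def)

lemma disc_alg_holo: "disc_alg \<phi> \<Longrightarrow> \<phi> holomorphic_on ball 0 1"
  and disc_alg_cont: "disc_alg \<phi> \<Longrightarrow> continuous_on (cball 0 1) \<phi>"
  by (simp_all add: disc_alg_def)

lemma disc_alg_cont_sphere: "disc_alg \<phi> \<Longrightarrow> continuous_on (sphere 0 1) \<phi>"
  by (rule continuous_on_subset[OF disc_alg_cont]) auto

lemma disc_alg_const [simp]: "disc_alg (\<lambda>_. c)"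
  and disc_alg_ident [simp]: "disc_alg (\<lambda>z. z)"
  and disc_alg_add: "disc_alg \<phi> \<Longrightarrow> disc_alg \<psi> \<Longrightarrow> disc_alg (\<lambda>z. \<phi> z + \<psi> z)"
  and disc_alg_diff: "disc_alg \<phi> \<Longrightarrow> disc_alg \<psi> \<Longrightarrow> disc_alg (\<lambda>z. \<phi> z - \<psi> z)"
  and disc_alg_mult: "disc_alg \<phi> \<Longrightarrow> disc_alg \<psi> \<Longrightarrow> disc_alg (\<lambda>z. \<phi> z * \<psi> z)"
  and disc_alg_power: "disc_alg \<phi> \<Longrightarrow> disc_alg (\<lambda>z. \<phi> z ^ k)"
  and disc_alg_divide: "disc_alg \<phi> \<Longrightarrow> disc_alg \<psi> \<Longrightarrow> (\<And>z. z \<in> cball 0 1 \<Longrightarrow> \<psi> z \<noteq> 0) \<Longrightarrow> disc_alg (\<lambda>z. \<phi> z / \<psi> z)"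
  and disc_alg_sum: "(\<And>i. i \<in> I \<Longrightarrow> disc_alg (\<Phi> i)) \<Longrightarrow> disc_alg (\<lambda>z. \<Sum>i\<in>I. \<Phi> i z)"
  unfolding disc_alg_def by (auto intro!: holomorphic_intros continuous_intros)

lemmas disc_alg_intros = disc_alg_const disc_alg_ident disc_alg_add disc_alg_diff disc_alg_mult
  disc_alg_power disc_alg_sum

lemma cmean_disc_alg:
  assumes "disc_alg \<phi>"
  shows "cmean \<phi> = \<phi> 0"
proof -
  have eq: "-\<i> * (\<i> * x) = x" "-\<i> * (2 * of_real pi * \<i> * x) = 2 * of_real pi * x" for x
    by (simp_all add: complex_eq_iff)
  have "((\<lambda>u. \<phi> u / (u - 0)) has_contour_integral (2 * of_real pi * \<i> * \<phi> 0)) (circlepath 0 1)"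
    using assms unfolding disc_alg_def by (intro Cauchy_integral_circlepath) auto
  hence "((\<lambda>t. \<phi> (cis t) / cis t * \<i> * cis t) has_integral (2 * of_real pi * \<i> * \<phi> 0)) {0..2*pi}"
    unfolding circlepath_def by (subst (asm) has_contour_integral_part_circlepath_iff) auto
  hence "((\<lambda>t. \<i> * \<phi> (cis t)) has_integral (2 * of_real pi * \<i> * \<phi> 0)) {0..2*pi}"
    by (simp add: mult.commute)
  hence "((\<lambda>t. -\<i> * (\<i> * \<phi> (cis t))) has_integral (-\<i> * (2 * of_real pi * \<i> * \<phi> 0))) {0..2*pi}"
    by (rule has_integral_mult_right)
  hence "((\<lambda>t. \<phi> (cis t)) has_integral (2 * of_real pi * \<phi> 0)) {0..2*pi}"
    unfolding eq .
  hence "integral {0..2*pi} (\<lambda>t. \<phi> (cis t)) = (2*pi) *\<^sub>R \<phi> 0"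
    by (simp add: integral_unique scaleR_conv_of_real)
  thus ?thesis by (simp add: cmean_def)
qed

lemma disc_alg_max:
  assumes "disc_alg \<phi>" "\<And>\<zeta>. \<zeta> \<in> sphere 0 1 \<Longrightarrow> cmod (\<phi> \<zeta>) \<le> B" "z \<in> cball 0 1"
  shows "cmod (\<phi> z) \<le> B"
  by (rule maximum_modulus_frontier[of \<phi> "cball 0 1"])
     (use assms in \<open>auto simp: disc_alg_def frontier_cball interior_cball\<close>)

lemma disc_alg_uniform_limit:
  \<comment> \<open>The maximum principle carries the Cauchy property from the circle to the closed
    disc. Sequences controlled only on the circle, such as difference quotients and kernel means,
    acquire holomorphic limits in this way.\<close>
  assumes da: "\<And>n. disc_alg (\<Phi> n)"
    and cau: "\<And>e. e > 0 \<Longrightarrow> \<exists>N. \<forall>m n. m \<ge> N \<longrightarrow> n \<ge> N \<longrightarrow> (\<forall>\<zeta>\<in>sphere 0 1. cmod (\<Phi> m \<zeta> - \<Phi> n \<zeta>) \<le> e)"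
  obtains \<phi> where "disc_alg \<phi>" "uniform_limit (cball 0 1) \<Phi> \<phi> sequentially"
proof -
  have "uniformly_Cauchy_on (cball 0 1) \<Phi>"
    unfolding uniformly_Cauchy_on_def
  proof (intro allI impI)
    fix e :: real assume "e > 0"
    then obtain N where N: "\<forall>m n. m \<ge> N \<longrightarrow> n \<ge> N \<longrightarrow> (\<forall>\<zeta>\<in>sphere 0 1. cmod (\<Phi> m \<zeta> - \<Phi> n \<zeta>) \<le> e/2)"
      using cau[of "e/2"] by auto
    show "\<exists>M. \<forall>x\<in>cball 0 1. \<forall>m\<ge>M. \<forall>n\<ge>M. dist (\<Phi> m x) (\<Phi> n x) < e"
    proof (intro exI[of _ N] ballI allI impI)
      fix x :: complex and m n assume "x \<in> cball 0 1" "m \<ge> N" "n \<ge> N"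
      hence "cmod (\<Phi> m x - \<Phi> n x) \<le> e/2"
        using disc_alg_max[OF disc_alg_diff[OF da da], of m n "e/2" x] N by blast
      thus "dist (\<Phi> m x) (\<Phi> n x) < e" using \<open>e > 0\<close> by (simp add: dist_norm)
    qed
  qed
  then obtain \<phi> where ul: "uniform_limit (cball 0 1) \<Phi> \<phi> sequentially"
    using uniformly_convergent_eq_Cauchy uniformly_convergent_on_def by metis
  have "continuous_on (cball 0 1) \<phi> \<and> \<phi> holomorphic_on ball 0 1"
    by (rule holomorphic_uniform_limit[OF _ ul])
       (use da in \<open>auto simp: disc_alg_def intro!: always_eventually\<close>)
  thus ?thesis using that ul disc_algI by blast
qed

text \<open>The value at \<open>a\<close> is a parameter and not \<open>deriv \<phi> a\<close>, so
  that the same quotient serves at a boundary point, where only the derivative within the closed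
  disc is available.\<close>

definition diff_quot :: "(complex \<Rightarrow> complex) \<Rightarrow> complex \<Rightarrow> complex \<Rightarrow> complex \<Rightarrow> complex" where
  "diff_quot \<phi> a D z = (if z = a then D else (\<phi> z - \<phi> a) / (z - a))"

lemma diff_quot_mult: "\<phi> z = \<phi> a + (z - a) * diff_quot \<phi> a D z"
  by (simp add: diff_quot_def)

lemma disc_alg_diff_quot:
  assumes da: "disc_alg \<phi>" and a: "a \<in> cball 0 1"
    and D: "(\<phi> has_field_derivative D) (at a within cball 0 1)"
  shows "disc_alg (diff_quot \<phi> a D)"
proof (rule disc_algI)
  have c: "continuous_on (cball 0 1) \<phi>" using da by (rule disc_alg_cont)
  show cont: "continuous_on (cball 0 1) (diff_quot \<phi> a D)"
    unfolding continuous_on_eq_continuous_within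
  proof
    fix x :: complex assume x: "x \<in> cball 0 1"
    show "continuous (at x within cball 0 1) (diff_quot \<phi> a D)"
    proof (cases "x = a")
      case True
      have "((\<lambda>y. (\<phi> y - \<phi> a) / (y - a)) \<longlongrightarrow> D) (at a within cball 0 1)"
        using D by (simp add: has_field_derivative_iff)
      hence "(diff_quot \<phi> a D \<longlongrightarrow> D) (at a within cball 0 1)"
        by (rule Lim_transform_eventually) (auto simp: diff_quot_def eventually_at intro!: exI[of _ 1])
      thus ?thesis by (simp add: True continuous_within diff_quot_def)
    next
      case False
      have "((\<lambda>y. (\<phi> y - \<phi> a) / (y - a)) \<longlongrightarrow> (\<phi> x - \<phi> a) / (x - a)) (at x within cball 0 1)"
        using c x False by (auto intro!: tendsto_intros simp: continuous_on_def)
      moreover have "\<forall>\<^sub>F y in at x within cball 0 1. (\<phi> y - \<phi> a) / (y - a) = diff_quot \<phi> a D y"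
        using False by (auto simp: diff_quot_def eventually_at dist_commute intro!: exI[of _ "dist x a"])
      ultimately have "(diff_quot \<phi> a D \<longlongrightarrow> (\<phi> x - \<phi> a) / (x - a)) (at x within cball 0 1)"
        by (rule Lim_transform_eventually)
      thus ?thesis using False by (simp add: continuous_within diff_quot_def)
    qed
  qed
  show "diff_quot \<phi> a D holomorphic_on ball 0 1"
  proof (rule no_isolated_singularity[of _ _ "{a}"])
    show "continuous_on (ball 0 1) (diff_quot \<phi> a D)"
      by (rule continuous_on_subset[OF cont]) auto
    have "(\<lambda>z. (\<phi> z - \<phi> a) / (z - a)) holomorphic_on ball 0 1 - {a}"
      using disc_alg_holo[OF da] by (auto intro!: holomorphic_intros intro: holomorphic_on_subset)
    thus "diff_quot \<phi> a D holomorphic_on ball 0 1 - {a}"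
      by (rule holomorphic_transform) (auto simp: diff_quot_def)
  qed auto
qed

lemma disc_alg_deriv_within:
  assumes "disc_alg \<phi>" "a \<in> ball 0 1"
  shows "(\<phi> has_field_derivative deriv \<phi> a) (at a within cball 0 1)"
  by (rule has_field_derivative_at_within, rule holomorphic_derivI[OF disc_alg_holo[OF assms(1)]])
     (use assms in auto)

section \<open>The Poisson kernel\<close>

text \<open>On the circle \<open>cnj \<zeta>\<close> is the inverse of \<open>\<zeta>\<close>, so
  the square of the distance to \<open>a\<close> becomes a holomorphic expression up to a factor
  \<open>\<zeta>\<close>. This reduces means against Poisson weights to Cauchy's formula at
  0.\<close>

lemma circle_norm_diff:
  assumes "\<zeta> \<in> sphere 0 1"
  shows "of_real ((cmod (\<zeta> - a))\<^sup>2) * \<zeta> = (\<zeta> - a) * (1 - cnj a * \<zeta>)"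
proof -
  have 1: "\<zeta> * cnj \<zeta> = 1" using assms by (simp add: complex_norm_square[symmetric])
  have "of_real ((cmod (\<zeta> - a))\<^sup>2) * \<zeta> = (\<zeta> - a) * (\<zeta> * cnj \<zeta> - cnj a * \<zeta>)"
    by (simp add: complex_norm_square algebra_simps del: of_real_power)
  thus ?thesis by (simp only: 1)
qed

lemma circle_norm_diff':
  assumes "\<zeta> \<in> sphere 0 1"
  shows "cmod (1 - cnj a * \<zeta>) = cmod (\<zeta> - a)"
proof -
  have 1: "\<zeta> * cnj \<zeta> = 1" using assms by (simp add: complex_norm_square[symmetric])
  have "cmod (1 - cnj a * \<zeta>) = cmod (\<zeta> * cnj \<zeta> - cnj a * \<zeta>)" by (simp only: 1)
  also have "\<dots> = cmod (\<zeta> * cnj (\<zeta> - a))" by (simp add: algebra_simps)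
  also have "\<dots> = cmod (\<zeta> - a)" using assms by (simp only: norm_mult complex_mod_cnj) simp
  finally show ?thesis .
qed

lemma Re_one_minus_pos:
  assumes "a \<in> ball 0 1" "z \<in> cball 0 1"
  shows "0 < Re (1 - cnj a * z)"
proof -
  have "cmod (cnj a * z) \<le> cmod a * 1"
    unfolding norm_mult complex_mod_cnj using assms by (intro mult_left_mono) auto
  also have "\<dots> < 1" using assms by simp
  finally show ?thesis using complex_Re_le_cmod[of "cnj a * z"] by simp
qed

lemma one_minus_nonzero:
  assumes "a \<in> ball 0 1" "z \<in> cball 0 1"
  shows "1 - cnj a * z \<noteq> 0"
  using Re_one_minus_pos[OF assms] by (metis zero_complex.simps(1) less_irrefl)

lemma defect_pos: "a \<in> ball 0 1 \<Longrightarrow> 0 < 1 - (cmod a)\<^sup>2"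
  by (simp add: power_less_one_iff)

definition poisson :: "complex \<Rightarrow> complex \<Rightarrow> real" where
  "poisson a \<zeta> = (1 - (cmod a)\<^sup>2) / (cmod (\<zeta> - a))\<^sup>2"

lemma poisson_pos:
  assumes "a \<in> ball 0 1" "\<zeta> \<in> sphere 0 1"
  shows "0 < poisson a \<zeta>"
proof -
  have "\<zeta> \<noteq> a" using assms by auto
  thus ?thesis using defect_pos[OF assms(1)] by (simp add: poisson_def)
qed

lemma poisson_nonneg: "a \<in> ball 0 1 \<Longrightarrow> \<zeta> \<in> sphere 0 1 \<Longrightarrow> 0 \<le> poisson a \<zeta>"
  using poisson_pos less_imp_le by blast

lemma continuous_on_poisson [continuous_intros]:
  "a \<in> ball 0 1 \<Longrightarrow> continuous_on (sphere 0 1) (poisson a)"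
  unfolding poisson_def by (auto intro!: continuous_intros)

lemma poisson_norm_diff:
  "a \<in> ball 0 1 \<Longrightarrow> \<zeta> \<in> sphere 0 1 \<Longrightarrow> poisson a \<zeta> * (cmod (\<zeta> - a))\<^sup>2 = 1 - (cmod a)\<^sup>2"
  by (auto simp: poisson_def)

lemma poisson_complex:
  assumes "a \<in> ball 0 1" "\<zeta> \<in> sphere 0 1"
  shows "of_real (poisson a \<zeta>) * ((\<zeta> - a) * (1 - cnj a * \<zeta>)) = of_real (1 - (cmod a)\<^sup>2) * \<zeta>"
  using arg_cong[OF poisson_norm_diff[OF assms], of complex_of_real]
  by (simp add: circle_norm_diff[OF assms(2), symmetric] mult.assoc[symmetric] del: of_real_diff)

text \<open>A zero at \<open>a\<close> cancels the pole of the kernel inside the disc. What is left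
  is in the disc algebra whenever \<open>k\<close> is, and its factor \<open>\<zeta>\<close> makes
  it vanish at 0.\<close>

lemma poisson_mult_diff:
  assumes "a \<in> ball 0 1" "\<zeta> \<in> sphere 0 1"
  shows "of_real (poisson a \<zeta>) * ((\<zeta> - a) * k) = of_real (1 - (cmod a)\<^sup>2) * \<zeta> * k / (1 - cnj a * \<zeta>)"
proof -
  have "1 - cnj a * \<zeta> \<noteq> 0" using one_minus_nonzero[of a \<zeta>] assms by simp
  moreover have "of_real (poisson a \<zeta>) * ((\<zeta> - a) * k) * (1 - cnj a * \<zeta>) =
      (of_real (poisson a \<zeta>) * ((\<zeta> - a) * (1 - cnj a * \<zeta>))) * k"
    by (simp only: mult_ac)
  ultimately show ?thesis
    unfolding poisson_complex[OF assms] by (simp add: eq_divide_eq mult_ac)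
qed

lemma poisson_eq_Re:
  assumes "a \<in> ball 0 1" "\<zeta> \<in> sphere 0 1"
  shows "poisson a \<zeta> = Re ((1 + cnj a * \<zeta>) / (1 - cnj a * \<zeta>))"
proof -
  have "cmod (cnj a * \<zeta>) = cmod a" using assms by (simp add: norm_mult)
  hence n: "(Re (cnj a * \<zeta>))\<^sup>2 + (Im (cnj a * \<zeta>))\<^sup>2 = (cmod a)\<^sup>2"
    by (metis cmod_power2)
  have "Re ((1 + q) * cnj (1 - q)) = 1 - ((Re q)\<^sup>2 + (Im q)\<^sup>2)" for q
    by (simp add: power2_eq_square algebra_simps)
  hence "Re ((1 + cnj a * \<zeta>) * cnj (1 - cnj a * \<zeta>)) = 1 - (cmod a)\<^sup>2"
    using n by presburger
  moreover have "Re (x / y) = Re (x * cnj y) / (cmod y)\<^sup>2" for x y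
    by (subst complex_div_cnj) (metis Re_divide_of_real)
  ultimately show ?thesis
    unfolding poisson_def by (simp only: circle_norm_diff'[OF assms(2)])
qed

lemma cmean_poisson [simp]:
  assumes a: "a \<in> ball 0 1"
  shows "cmean (poisson a) = 1"
proof -
  let ?h = "\<lambda>z. (1 + cnj a * z) / (1 - cnj a * z)"
  have h: "disc_alg ?h"
    using one_minus_nonzero[OF a] by (intro disc_alg_divide disc_alg_intros) auto
  have "cmean (poisson a) = cmean (\<lambda>\<zeta>. Re (?h \<zeta>))"
    by (intro cmean_cong poisson_eq_Re a)
  also have "\<dots> = Re (?h 0)"
    by (subst cmean_Re[OF disc_alg_cont_sphere[OF h]]) (simp add: cmean_disc_alg[OF h])
  finally show ?thesis by simp
qed

lemma cmean_poisson_disc_alg: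
  assumes a: "a \<in> ball 0 1" and \<phi>: "disc_alg \<phi>"
  shows "cmean (\<lambda>\<zeta>. of_real (poisson a \<zeta>) * \<phi> \<zeta>) = \<phi> a"
proof -
  define k where "k = diff_quot \<phi> a (deriv \<phi> a)"
  have k: "disc_alg k"
    unfolding k_def by (intro disc_alg_diff_quot \<phi> disc_alg_deriv_within a) (use a in auto)
  define \<psi> where "\<psi> z = of_real (1 - (cmod a)\<^sup>2) * z * k z / (1 - cnj a * z)" for z
  have \<psi>: "disc_alg \<psi>"
    unfolding \<psi>_def using one_minus_nonzero[OF a] by (intro disc_alg_divide disc_alg_intros k) auto
  have "cmean (\<lambda>\<zeta>. of_real (poisson a \<zeta>) * \<phi> \<zeta>) = cmean (\<lambda>\<zeta>. \<phi> a * of_real (poisson a \<zeta>) + \<psi> \<zeta>)"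
  proof (rule cmean_cong)
    fix \<zeta> :: complex assume \<zeta>: "\<zeta> \<in> sphere 0 1"
    have "\<phi> \<zeta> = \<phi> a + (\<zeta> - a) * k \<zeta>" unfolding k_def by (rule diff_quot_mult)
    hence "of_real (poisson a \<zeta>) * \<phi> \<zeta> = of_real (poisson a \<zeta>) * (\<phi> a + (\<zeta> - a) * k \<zeta>)" by simp
    hence "of_real (poisson a \<zeta>) * \<phi> \<zeta> = \<phi> a * of_real (poisson a \<zeta>) + of_real (poisson a \<zeta>) * ((\<zeta> - a) * k \<zeta>)"
      by (simp only: distrib_left mult.commute)
    thus "of_real (poisson a \<zeta>) * \<phi> \<zeta> = \<phi> a * of_real (poisson a \<zeta>) + \<psi> \<zeta>"
      by (simp add: poisson_mult_diff[OF a \<zeta>] \<psi>_def)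
  qed
  also have "\<dots> = \<phi> a * of_real (cmean (poisson a)) + \<psi> 0"
    using a \<psi> by (subst cmean_add cmean_mult_left cmean_of_real;
        (intro continuous_intros disc_alg_cont_sphere)?; simp add: cmean_disc_alg)+
  also have "\<dots> = \<phi> a" using a by (simp add: \<psi>_def)
  finally show ?thesis .
qed

text \<open>One factor of the kernel is the real part of the disc algebra function
  \<open>?h\<close>, and the other factor reproduces \<open>?h\<close> at \<open>a\<close>.\<close>

lemma cmean_poisson_sq:
  assumes a: "a \<in> ball 0 1"
  shows "cmean (\<lambda>\<zeta>. (poisson a \<zeta>)\<^sup>2) = (1 + (cmod a)\<^sup>2) / (1 - (cmod a)\<^sup>2)"
proof -
  let ?h = "\<lambda>z. (1 + cnj a * z) / (1 - cnj a * z)"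
  have h: "disc_alg ?h"
    using one_minus_nonzero[OF a] by (intro disc_alg_divide disc_alg_intros) auto
  have "cmean (\<lambda>\<zeta>. (poisson a \<zeta>)\<^sup>2) = cmean (\<lambda>\<zeta>. Re (of_real (poisson a \<zeta>) * ?h \<zeta>))"
    by (intro cmean_cong) (simp add: power2_eq_square poisson_eq_Re[OF a, symmetric] del: times_divide_eq_right)
  also have "\<dots> = Re (cmean (\<lambda>\<zeta>. of_real (poisson a \<zeta>) * ?h \<zeta>))"
    by (intro cmean_Re continuous_intros disc_alg_cont_sphere h a) (use one_minus_nonzero[OF a] in auto)
  also have "\<dots> = Re (?h a)" by (simp only: cmean_poisson_disc_alg[OF a h])
  also have "?h a = of_real ((1 + (cmod a)\<^sup>2) / (1 - (cmod a)\<^sup>2))"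
    by (simp add: complex_norm_square mult.commute del: of_real_power)
  finally show ?thesis by (simp only: Re_complex_of_real)
qed

lemma cmean_poisson_sq_le:
  assumes a: "a \<in> ball 0 1"
  shows "cmean (\<lambda>\<zeta>. (poisson a \<zeta>)\<^sup>2) \<le> 2 / (1 - (cmod a)\<^sup>2)"
  unfolding cmean_poisson_sq[OF a] using defect_pos[OF a] by (intro divide_right_mono) auto

text \<open>Each of the two zeros at \<open>a\<close> pays for one factor of the kernel and leaves a
  factor \<open>z\<close>; the resulting disc algebra function vanishes at 0.\<close>

lemma cmean_poisson_sq_mult:
  assumes a: "a \<in> ball 0 1" and "disc_alg \<phi>" "disc_alg \<psi>" "\<phi> a = 0" "\<psi> a = 0"
  shows "cmean (\<lambda>\<zeta>. of_real ((poisson a \<zeta>)\<^sup>2) * (\<phi> \<zeta> * \<psi> \<zeta>)) = 0"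
proof -
  define k l where "k = diff_quot \<phi> a (deriv \<phi> a)" and "l = diff_quot \<psi> a (deriv \<psi> a)"
  have kl: "disc_alg k" "disc_alg l"
    unfolding k_def l_def by (intro disc_alg_diff_quot assms disc_alg_deriv_within; use a in auto)+
  have eq: "\<phi> z = (z - a) * k z" "\<psi> z = (z - a) * l z" for z
    using diff_quot_mult[of \<phi> z a "deriv \<phi> a"] diff_quot_mult[of \<psi> z a "deriv \<psi> a"] assms(4,5)
    by (auto simp: k_def l_def)
  let ?D = "of_real (1 - (cmod a)\<^sup>2) :: complex"
  define \<eta> where "\<eta> z = (?D * z * k z) * (?D * z * l z) / (1 - cnj a * z)^2" for z
  have \<eta>: "disc_alg \<eta>"
    unfolding \<eta>_def using one_minus_nonzero[OF a] by (intro disc_alg_divide disc_alg_intros kl) auto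
  have "cmean (\<lambda>\<zeta>. of_real ((poisson a \<zeta>)\<^sup>2) * (\<phi> \<zeta> * \<psi> \<zeta>)) = cmean \<eta>"
  proof (rule cmean_cong)
    fix \<zeta> :: complex assume \<zeta>: "\<zeta> \<in> sphere 0 1"
    have "of_real ((poisson a \<zeta>)\<^sup>2) * (\<phi> \<zeta> * \<psi> \<zeta>) =
        (of_real (poisson a \<zeta>) * ((\<zeta> - a) * k \<zeta>)) * (of_real (poisson a \<zeta>) * ((\<zeta> - a) * l \<zeta>))"
      by (simp add: eq power2_eq_square algebra_simps)
    thus "of_real ((poisson a \<zeta>)\<^sup>2) * (\<phi> \<zeta> * \<psi> \<zeta>) = \<eta> \<zeta>"
      unfolding poisson_mult_diff[OF a \<zeta>] \<eta>_def by (simp add: power2_eq_square)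
  qed
  also have "\<dots> = \<eta> 0" by (rule cmean_disc_alg[OF \<eta>])
  finally show ?thesis by (simp add: \<eta>_def)
qed

text \<open>The single zero cancels one kernel, \<open>cnj \<zeta>\<close> removes the factor
  \<open>\<zeta>\<close> so produced, and the other kernel evaluates the difference quotient at
  \<open>a\<close>.\<close>

lemma cmean_poisson_sq_deriv:
  assumes a: "a \<in> ball 0 1" and \<phi>: "disc_alg \<phi>" "\<phi> a = 0"
  shows "cmean (\<lambda>\<zeta>. of_real ((poisson a \<zeta>)\<^sup>2) * (cnj \<zeta> * \<phi> \<zeta>)) = deriv \<phi> a"
proof -
  define k where "k = diff_quot \<phi> a (deriv \<phi> a)"
  have k: "disc_alg k"
    unfolding k_def by (intro disc_alg_diff_quot \<phi> disc_alg_deriv_within a) (use a in auto)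
  let ?D = "of_real (1 - (cmod a)\<^sup>2) :: complex"
  define \<eta> where "\<eta> z = ?D * k z / (1 - cnj a * z)" for z
  have \<eta>: "disc_alg \<eta>"
    unfolding \<eta>_def using one_minus_nonzero[OF a] by (intro disc_alg_divide disc_alg_intros k) auto
  have "cmean (\<lambda>\<zeta>. of_real ((poisson a \<zeta>)\<^sup>2) * (cnj \<zeta> * \<phi> \<zeta>)) = cmean (\<lambda>\<zeta>. of_real (poisson a \<zeta>) * \<eta> \<zeta>)"
  proof (rule cmean_cong)
    fix \<zeta> :: complex assume \<zeta>: "\<zeta> \<in> sphere 0 1"
    have 1: "cnj \<zeta> * \<zeta> = 1"
      using \<zeta> by (simp add: complex_norm_square[symmetric] mult.commute)
    have "\<phi> \<zeta> = (\<zeta> - a) * k \<zeta>"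
      using diff_quot_mult[of \<phi> \<zeta> a "deriv \<phi> a"] \<phi>(2) by (simp add: k_def)
    hence "of_real ((poisson a \<zeta>)\<^sup>2) * (cnj \<zeta> * \<phi> \<zeta>) =
        of_real (poisson a \<zeta>) * (cnj \<zeta> * (of_real (poisson a \<zeta>) * ((\<zeta> - a) * k \<zeta>)))"
      by (simp add: power2_eq_square mult_ac)
    also have "\<dots> = of_real (poisson a \<zeta>) * ((cnj \<zeta> * \<zeta>) * \<eta> \<zeta>)"
      unfolding poisson_mult_diff[OF a \<zeta>] \<eta>_def by (simp add: mult_ac)
    finally show "of_real ((poisson a \<zeta>)\<^sup>2) * (cnj \<zeta> * \<phi> \<zeta>) = of_real (poisson a \<zeta>) * \<eta> \<zeta>"
      by (simp only: 1 mult_1)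
  qed
  also have "\<dots> = \<eta> a" by (rule cmean_poisson_disc_alg[OF a \<eta>])
  also have "1 - cnj a * a = ?D"
    by (simp add: complex_norm_square mult.commute del: of_real_power)
  hence "\<eta> a = deriv \<phi> a"
    using defect_pos[OF a] one_minus_nonzero[of a a] a by (simp add: \<eta>_def k_def diff_quot_def)
  finally show ?thesis .
qed

section \<open>Poisson moments of the distance to the evaluation point\<close>

lemma Re_powr_ge:
  assumes "0 < Re w" "0 < \<alpha>" "\<alpha> < 1"
  shows "cmod w powr \<alpha> * cos (\<alpha> * pi / 2) \<le> Re (w powr of_real \<alpha>)"
proof -
  have w: "w \<noteq> 0" using assms(1) by auto
  have "\<bar>Im (Ln w)\<bar> < pi / 2" using Re_Ln_pos_lt[OF w] assms(1) by simp
  hence "\<bar>\<alpha> * Im (Ln w)\<bar> \<le> \<alpha> * pi / 2"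
    using assms by (simp add: abs_mult)
  hence "cos (\<alpha> * pi / 2) \<le> cos \<bar>\<alpha> * Im (Ln w)\<bar>"
    using assms by (intro cos_monotone_0_pi_le) (auto simp: mult_le_cancel_right1)
  hence c: "cos (\<alpha> * pi / 2) \<le> cos (\<alpha> * Im (Ln w))" by simp
  have "Re (w powr of_real \<alpha>) = exp (\<alpha> * ln (cmod w)) * cos (\<alpha> * Im (Ln w))"
    using w by (simp add: powr_def Re_exp)
  also have "exp (\<alpha> * ln (cmod w)) = cmod w powr \<alpha>" using w by (simp add: powr_def)
  finally show ?thesis using c by (simp add: mult_left_mono)
qed

text \<open>A harmonic majorant: on the circle \<open>cmod (\<zeta> - a)\<close> equals the modulus
  of \<open>1 - cnj a * \<zeta>\<close>, whose real part is positive throughout the disc. Its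
  principal power is therefore in the disc algebra, has argument at most
  \<open>\<alpha> * pi / 2\<close>, and is reproduced at \<open>a\<close>. The cosine is the loss in
  passing from the modulus to the real part.\<close>

lemma cmean_poisson_powr_le:
  assumes a: "a \<in> ball 0 1" and \<alpha>: "0 < \<alpha>" "\<alpha> < 1"
  shows "cmean (\<lambda>\<zeta>. poisson a \<zeta> * cmod (\<zeta> - a) powr \<alpha>) \<le> (1 - (cmod a)\<^sup>2) powr \<alpha> / cos (\<alpha> * pi / 2)"
proof -
  have c: "0 < cos (\<alpha> * pi / 2)" using \<alpha> by (intro cos_gt_zero) auto
  let ?h = "\<lambda>z. (1 - cnj a * z) powr of_real \<alpha>"
  have nn: "1 - cnj a * z \<notin> \<real>\<^sub>\<le>\<^sub>0" if "z \<in> cball 0 1" for z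
    using Re_one_minus_pos[OF a that] by (auto simp: complex_nonpos_Reals_iff)
  have hol: "?h holomorphic_on {z. 0 < Re (1 - cnj a * z)}"
    by (intro holomorphic_intros) (auto simp: complex_nonpos_Reals_iff)
  have h: "disc_alg ?h"
    by (intro disc_algI holomorphic_on_imp_continuous_on holomorphic_on_subset[OF hol])
       (use Re_one_minus_pos[OF a] in auto)
  have cont: "continuous_on (sphere 0 1) (\<lambda>\<zeta>. of_real (poisson a \<zeta>) * ?h \<zeta>)"
    by (intro continuous_on_mult disc_alg_cont_sphere[OF h] continuous_on_of_real continuous_on_poisson a)
  have contr: "continuous_on (sphere 0 1) (\<lambda>\<zeta>. poisson a \<zeta> * cmod (\<zeta> - a) powr \<alpha>)"
    using a by (intro continuous_intros) auto
  have "cos (\<alpha> * pi / 2) * cmean (\<lambda>\<zeta>. poisson a \<zeta> * cmod (\<zeta> - a) powr \<alpha>) =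
      cmean (\<lambda>\<zeta>. cos (\<alpha> * pi / 2) * (poisson a \<zeta> * cmod (\<zeta> - a) powr \<alpha>))"
    by (rule cmean_mult_left_real[symmetric, OF contr])
  also have "\<dots> \<le> cmean (\<lambda>\<zeta>. Re (of_real (poisson a \<zeta>) * ?h \<zeta>))"
  proof (rule cmean_mono)
    show "continuous_on (sphere 0 1) (\<lambda>\<zeta>. Re (of_real (poisson a \<zeta>) * ?h \<zeta>))"
      by (intro continuous_intros cont)
    show "continuous_on (sphere 0 1) (\<lambda>\<zeta>. cos (\<alpha> * pi / 2) * (poisson a \<zeta> * cmod (\<zeta> - a) powr \<alpha>))"
      by (intro continuous_intros contr)
    fix \<zeta> :: complex assume \<zeta>: "\<zeta> \<in> sphere 0 1"
    hence "cmod (\<zeta> - a) powr \<alpha> * cos (\<alpha> * pi / 2) \<le> Re (?h \<zeta>)"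
      using Re_powr_ge[OF Re_one_minus_pos[OF a, of \<zeta>] \<alpha>] circle_norm_diff'[OF \<zeta>, of a] by simp
    hence "poisson a \<zeta> * (cmod (\<zeta> - a) powr \<alpha> * cos (\<alpha> * pi / 2)) \<le> poisson a \<zeta> * Re (?h \<zeta>)"
      using poisson_nonneg[OF a \<zeta>] by (rule mult_left_mono)
    thus "cos (\<alpha> * pi / 2) * (poisson a \<zeta> * cmod (\<zeta> - a) powr \<alpha>) \<le> Re (of_real (poisson a \<zeta>) * ?h \<zeta>)"
      by (simp add: mult_ac)
  qed
  also have "\<dots> = Re (?h a)"
    by (subst cmean_Re[OF cont]) (simp only: cmean_poisson_disc_alg[OF a h])
  also have "1 - cnj a * a = of_real (1 - (cmod a)\<^sup>2)"
    by (simp add: complex_norm_square mult.commute del: of_real_power)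
  hence "Re (?h a) = (1 - (cmod a)\<^sup>2) powr \<alpha>"
    using defect_pos[OF a] by (simp only: powr_of_real less_imp_le Re_complex_of_real)
  finally show ?thesis using c by (simp add: field_simps)
qed

text \<open>Interpolation at scale \<open>\<delta>\<close> between the exponents 0 and 2, whose
  moments are explicit because the kernel times the squared distance is constant on the
  circle.\<close>

lemma powr_young:
  fixes x \<delta> \<alpha> :: real
  assumes "0 < \<delta>" "0 \<le> x" "0 < \<alpha>" "\<alpha> < 1"
  shows "x powr (2*\<alpha>) \<le> \<delta> powr (2*\<alpha>) * (1 + x\<^sup>2 / \<delta>\<^sup>2)"
proof -
  have "(x/\<delta>) powr (2*\<alpha>) \<le> 1 + (x/\<delta>)\<^sup>2"
  proof (cases "x/\<delta> \<le> 1")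
    case True
    hence "(x/\<delta>) powr (2*\<alpha>) \<le> 1" using assms by (intro powr_le1) auto
    thus ?thesis by (meson le_add_same_cancel1 order_trans zero_le_power2)
  next
    case False
    hence "(x/\<delta>) powr (2*\<alpha>) \<le> (x/\<delta>) powr 2" using assms by (intro powr_mono) auto
    thus ?thesis using False assms by (simp add: powr_numeral)
  qed
  hence "\<delta> powr (2*\<alpha>) * (x/\<delta>) powr (2*\<alpha>) \<le> \<delta> powr (2*\<alpha>) * (1 + (x/\<delta>)\<^sup>2)"
    by (intro mult_left_mono) auto
  thus ?thesis using assms by (simp add: powr_divide power_divide)
qed

text \<open>The interpolation scale is \<open>?d\<close>. Exponent 0 costs the mean of the squared
  kernel, at most \<open>2 / ?d\<close>; exponent 2 turns one kernel into a constant and costs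
  \<open>1 / ?d\<close>. Together they give the 3.\<close>

lemma cmean_poisson_sq_powr_le:
  assumes a: "a \<in> ball 0 1" and \<alpha>: "0 < \<alpha>" "\<alpha> < 1"
  shows "cmean (\<lambda>\<zeta>. (poisson a \<zeta>)\<^sup>2 * cmod (\<zeta> - a) powr (2*\<alpha>)) \<le> 3 * (1 - (cmod a)\<^sup>2) powr (2*\<alpha> - 1)"
proof -
  let ?d = "1 - (cmod a)\<^sup>2"
  have d: "?d > 0" by (rule defect_pos[OF a])
  have lin: "cmean (\<lambda>\<zeta>. X * ((poisson a \<zeta>)\<^sup>2 + c * poisson a \<zeta>)) =
      X * (cmean (\<lambda>\<zeta>. (poisson a \<zeta>)\<^sup>2) + c * cmean (poisson a))" for X c
  proof -
    have "cmean (\<lambda>\<zeta>. X * ((poisson a \<zeta>)\<^sup>2 + c * poisson a \<zeta>)) = X * cmean (\<lambda>\<zeta>. (poisson a \<zeta>)\<^sup>2 + c * poisson a \<zeta>)"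
      by (intro cmean_mult_left_real continuous_intros a)
    also have "cmean (\<lambda>\<zeta>. (poisson a \<zeta>)\<^sup>2 + c * poisson a \<zeta>) =
        cmean (\<lambda>\<zeta>. (poisson a \<zeta>)\<^sup>2) + cmean (\<lambda>\<zeta>. c * poisson a \<zeta>)"
      by (intro cmean_add continuous_intros a)
    also have "cmean (\<lambda>\<zeta>. c * poisson a \<zeta>) = c * cmean (poisson a)"
      by (intro cmean_mult_left_real continuous_intros a)
    finally show ?thesis .
  qed
  have "cmean (\<lambda>\<zeta>. (poisson a \<zeta>)\<^sup>2 * cmod (\<zeta> - a) powr (2*\<alpha>)) \<le>
     cmean (\<lambda>\<zeta>. ?d powr (2*\<alpha>) * ((poisson a \<zeta>)\<^sup>2 + (1/?d) * poisson a \<zeta>))"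
  proof (rule cmean_mono)
    fix \<zeta> :: complex assume \<zeta>: "\<zeta> \<in> sphere 0 1"
    have "(poisson a \<zeta>)\<^sup>2 * cmod (\<zeta> - a) powr (2*\<alpha>) \<le>
      (poisson a \<zeta>)\<^sup>2 * (?d powr (2*\<alpha>) * (1 + (cmod (\<zeta> - a))\<^sup>2 / ?d\<^sup>2))"
      using powr_young[OF d, of "cmod (\<zeta> - a)" \<alpha>] \<alpha> by (intro mult_left_mono) auto
    also have "\<dots> = ?d powr (2*\<alpha>) * ((poisson a \<zeta>)\<^sup>2 + poisson a \<zeta> * (poisson a \<zeta> * (cmod (\<zeta> - a))\<^sup>2) / ?d\<^sup>2)"
      by (simp add: algebra_simps power2_eq_square[of "poisson a \<zeta>"])
    also have "\<dots> = ?d powr (2*\<alpha>) * ((poisson a \<zeta>)\<^sup>2 + (1/?d) * poisson a \<zeta>)"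
      unfolding poisson_norm_diff[OF a \<zeta>] using d by (simp add: power2_eq_square[of ?d])
    finally show "(poisson a \<zeta>)\<^sup>2 * cmod (\<zeta> - a) powr (2*\<alpha>) \<le> ?d powr (2*\<alpha>) * ((poisson a \<zeta>)\<^sup>2 + (1/?d) * poisson a \<zeta>)" .
  qed (use a d in \<open>auto intro!: continuous_intros\<close>)
  also have "\<dots> = ?d powr (2*\<alpha>) * (cmean (\<lambda>\<zeta>. (poisson a \<zeta>)\<^sup>2) + (1/?d) * cmean (poisson a))"
    by (rule lin)
  also have "\<dots> \<le> ?d powr (2*\<alpha>) * (3 / ?d)"
  proof (rule mult_left_mono)
    have "cmean (\<lambda>\<zeta>. (poisson a \<zeta>)\<^sup>2) + 1 / ?d * cmean (poisson a) \<le> 2 / ?d + 1 / ?d"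
      using cmean_poisson_sq_le[OF a] a by simp
    also have "\<dots> = 3 / ?d" by (simp add: add_divide_distrib[symmetric])
    finally show "cmean (\<lambda>\<zeta>. (poisson a \<zeta>)\<^sup>2) + 1 / ?d * cmean (poisson a) \<le> 3 / ?d" .
  qed simp
  also have "\<dots> = 3 * ?d powr (2*\<alpha> - 1)" using d by (simp add: powr_diff)
  finally show ?thesis .
qed

text \<open>With a single kernel the scale that balances the two terms is the square root of
  \<open>?d\<close>, where each contributes mean 1. This yields the exponent \<open>\<alpha>\<close>
  only, but for every \<open>\<alpha>\<close> in the unit interval.\<close>

lemma cmean_poisson_powr2_le:
  assumes a: "a \<in> ball 0 1" and \<alpha>: "0 < \<alpha>" "\<alpha> < 1"
  shows "cmean (\<lambda>\<zeta>. poisson a \<zeta> * cmod (\<zeta> - a) powr (2*\<alpha>)) \<le> 2 * (1 - (cmod a)\<^sup>2) powr \<alpha>"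
proof -
  let ?d = "1 - (cmod a)\<^sup>2"
  have d: "?d > 0" by (rule defect_pos[OF a])
  have d2: "(?d powr (1/2)) powr (2*\<alpha>) = ?d powr \<alpha>" "(?d powr (1/2))\<^sup>2 = ?d"
    using d by (simp_all add: powr_powr powr_half_sqrt[symmetric] powr_powr[of _ _ 2] flip: powr_numeral)
  have "cmean (\<lambda>\<zeta>. poisson a \<zeta> * cmod (\<zeta> - a) powr (2*\<alpha>)) \<le> cmean (\<lambda>\<zeta>. ?d powr \<alpha> * (poisson a \<zeta> + 1))"
  proof (rule cmean_mono)
    fix \<zeta> :: complex assume \<zeta>: "\<zeta> \<in> sphere 0 1"
    have "poisson a \<zeta> * cmod (\<zeta> - a) powr (2*\<alpha>) \<le>
      poisson a \<zeta> * (?d powr \<alpha> * (1 + (cmod (\<zeta> - a))\<^sup>2 / ?d))"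
      using powr_young[of "?d powr (1/2)" "cmod (\<zeta> - a)" \<alpha>] d \<alpha> poisson_nonneg[OF a \<zeta>] d2
      by (intro mult_left_mono) auto
    also have "\<dots> = ?d powr \<alpha> * (poisson a \<zeta> + (poisson a \<zeta> * (cmod (\<zeta> - a))\<^sup>2) / ?d)"
      by (simp add: algebra_simps)
    also have "\<dots> = ?d powr \<alpha> * (poisson a \<zeta> + 1)"
      unfolding poisson_norm_diff[OF a \<zeta>] using d by simp
    finally show "poisson a \<zeta> * cmod (\<zeta> - a) powr (2*\<alpha>) \<le> ?d powr \<alpha> * (poisson a \<zeta> + 1)" .
  qed (use a d in \<open>auto intro!: continuous_intros\<close>)
  also have "\<dots> = ?d powr \<alpha> * (cmean (poisson a) + 1)"
    using a by (subst cmean_mult_left_real cmean_add; (intro continuous_intros)?; simp)+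
  finally show ?thesis using a by simp
qed

section \<open>Coercive symbols and the weighted energy estimates\<close>

definition cdot :: "complex ^ 'n \<Rightarrow> complex ^ 'n \<Rightarrow> complex" where
  "cdot v w = (\<Sum>i\<in>UNIV. v $ i * w $ i)"

lemma norm_cdot_le: "cmod (cdot v w) \<le> norm v * norm w"
proof -
  have "cmod (cdot v w) \<le> (\<Sum>i\<in>UNIV. \<bar>cmod (v $ i)\<bar> * \<bar>cmod (w $ i)\<bar>)"
    unfolding cdot_def by (rule sum_norm_le) (simp add: norm_mult)
  also have "\<dots> \<le> norm v * norm w"
    unfolding norm_vec_def by (rule L2_set_mult_ineq)
  finally show ?thesis .
qed

lemma bounded_bilinear_cdot: "bounded_bilinear cdot"
proof
  show "\<exists>K. \<forall>a b::complex^'n. norm (cdot a b) \<le> norm a * norm b * K"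
    by (rule exI[of _ 1]) (simp add: norm_cdot_le)
qed (simp_all add: cdot_def algebra_simps sum.distrib scaleR_sum_right)

lemmas continuous_on_cdot [continuous_intros] = bounded_bilinear.continuous_on[OF bounded_bilinear_cdot]
lemmas cdot_add_right = bounded_bilinear.add_right[OF bounded_bilinear_cdot]
lemmas cdot_diff_right = bounded_bilinear.diff_right[OF bounded_bilinear_cdot]
lemmas cdot_zero_left = bounded_bilinear.zero_left[OF bounded_bilinear_cdot]

definition disc_alg_vec :: "(complex \<Rightarrow> complex ^ 'n) \<Rightarrow> bool" where
  "disc_alg_vec u \<longleftrightarrow> (\<forall>i. disc_alg (\<lambda>z. u z $ i))"

lemma disc_alg_vec_nth: "disc_alg_vec u \<Longrightarrow> disc_alg (\<lambda>z. u z $ i)"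
  by (simp add: disc_alg_vec_def)

lemma disc_alg_vec_cont:
  assumes "disc_alg_vec u"
  shows "continuous_on (cball 0 1) u"
proof -
  have "continuous_on (cball 0 1) (\<lambda>z. \<chi> i. u z $ i)"
    using assms by (intro continuous_on_vec_lambda disc_alg_cont disc_alg_vec_nth)
  thus ?thesis by simp
qed

lemma disc_alg_vec_cont_sphere: "disc_alg_vec u \<Longrightarrow> continuous_on (sphere 0 1) u"
  by (rule continuous_on_subset[OF disc_alg_vec_cont]) auto

lemma disc_alg_vec_const: "disc_alg_vec (\<lambda>_. c)"
  and disc_alg_vec_add: "disc_alg_vec u \<Longrightarrow> disc_alg_vec w \<Longrightarrow> disc_alg_vec (\<lambda>z. u z + w z)"
  and disc_alg_vec_diff: "disc_alg_vec u \<Longrightarrow> disc_alg_vec w \<Longrightarrow> disc_alg_vec (\<lambda>z. u z - w z)"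
  and disc_alg_vec_scaleR: "disc_alg_vec u \<Longrightarrow> disc_alg_vec (\<lambda>z. r *\<^sub>R u z)"
  and disc_alg_vec_cmult: "disc_alg \<phi> \<Longrightarrow> disc_alg_vec u \<Longrightarrow> disc_alg_vec (\<lambda>z. \<phi> z *s u z)"
  and disc_alg_cdot: "disc_alg_vec u \<Longrightarrow> disc_alg_vec w \<Longrightarrow> disc_alg (\<lambda>z. cdot (u z) (w z))"
  unfolding disc_alg_vec_def cdot_def
  by (auto simp: scaleR_conv_of_real[where 'a=complex] intro!: disc_alg_intros)

lemmas disc_alg_vec_intros = disc_alg_vec_const disc_alg_vec_add disc_alg_vec_diff
  disc_alg_vec_scaleR disc_alg_vec_cmult

lemma cmean_poisson_disc_alg_vec:
  assumes a: "a \<in> ball 0 1" and u: "disc_alg_vec u"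
  shows "cmean (\<lambda>\<zeta>. poisson a \<zeta> *\<^sub>R u \<zeta>) = u a"
proof -
  have c: "continuous_on (sphere 0 1) (\<lambda>\<zeta>. poisson a \<zeta> *\<^sub>R u \<zeta>)"
    by (intro continuous_intros a disc_alg_vec_cont_sphere u)
  have "cmean (\<lambda>\<zeta>. poisson a \<zeta> *\<^sub>R u \<zeta>) $ i = u a $ i" for i
    unfolding cmean_nth[OF c, symmetric]
    using cmean_poisson_disc_alg[OF a disc_alg_vec_nth[OF u, of i]]
    by (simp add: scaleR_conv_of_real[where 'a=complex])
  thus ?thesis by (simp add: vec_eq_iff)
qed

text \<open>The maps are bounded linear over the reals, since the symbol contains a conjugation. The
  Lipschitz bound is what a continuously differentiable symbol provides; it measures the error of
  freezing the symbol at a boundary point.\<close>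

locale coercive_symbol =
  fixes A :: "complex \<Rightarrow> (complex ^ 'n) \<Rightarrow>\<^sub>L (complex ^ 'n)" and \<epsilon> \<Lambda> :: real
  assumes eps_pos: "0 < \<epsilon>"
    and coercive: "\<zeta> \<in> sphere 0 1 \<Longrightarrow> \<epsilon> * (norm v)\<^sup>2 \<le> Re (cdot v (A \<zeta> v))"
    and lipschitz: "\<zeta> \<in> sphere 0 1 \<Longrightarrow> \<eta> \<in> sphere 0 1 \<Longrightarrow> norm (A \<zeta> - A \<eta>) \<le> \<Lambda> * cmod (\<zeta> - \<eta>)"
begin

lemma Lip_nonneg: "0 \<le> \<Lambda>"
proof -
  have "0 \<le> norm (A 1 - A (-1))" by simp
  also have "\<dots> \<le> \<Lambda> * cmod (1 - (-1))" by (rule lipschitz) auto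
  finally show ?thesis by simp
qed

lemma continuous_on_symbol [continuous_intros]: "continuous_on (sphere 0 1) A"
proof (rule continuous_on_subset[OF lipschitz_on_continuous_on])
  show "\<Lambda>-lipschitz_on (sphere 0 1) A"
    using lipschitz Lip_nonneg by (auto simp: lipschitz_on_def dist_norm)
qed auto

text \<open>Orthogonality trades the coercive term for the product of \<open>u\<close> and
  \<open>e\<close>, which is absorbed by completing a square:
  \<open>2 * \<epsilon> * (\<epsilon> * x\<^sup>2 - x * y)\<close> is at least
  \<open>\<epsilon>\<^sup>2 * x\<^sup>2 - y\<^sup>2\<close>. The weight is arbitrary, and its choice
  later decides which holomorphic cancellation gives the orthogonality.\<close>

lemma energy:
  assumes W: "continuous_on (sphere 0 1) W" "\<And>\<zeta>. \<zeta> \<in> sphere 0 1 \<Longrightarrow> 0 \<le> W \<zeta>"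
    and u: "continuous_on (sphere 0 1) u" and e: "continuous_on (sphere 0 1) e"
    and orth: "cmean (\<lambda>\<zeta>. of_real (W \<zeta>) * cdot (u \<zeta>) (A \<zeta> (u \<zeta>) + e \<zeta>)) = 0"
  shows "\<epsilon>\<^sup>2 * cmean (\<lambda>\<zeta>. W \<zeta> * (norm (u \<zeta>))\<^sup>2) \<le> cmean (\<lambda>\<zeta>. W \<zeta> * (norm (e \<zeta>))\<^sup>2)"
proof -
  note ci = continuous_intros W u e
  let ?q = "\<lambda>\<zeta>. of_real (W \<zeta>) * cdot (u \<zeta>) (A \<zeta> (u \<zeta>) + e \<zeta>)"
  have q: "continuous_on (sphere 0 1) ?q" by (intro ci)
  have "cmean (\<lambda>\<zeta>. \<epsilon>\<^sup>2 * (W \<zeta> * (norm (u \<zeta>))\<^sup>2) - W \<zeta> * (norm (e \<zeta>))\<^sup>2) \<le> cmean (\<lambda>\<zeta>. 2 * \<epsilon> * Re (?q \<zeta>))"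
  proof (rule cmean_mono)
    show "continuous_on (sphere 0 1) (\<lambda>\<zeta>. 2 * \<epsilon> * Re (?q \<zeta>))" by (intro ci)
    show "continuous_on (sphere 0 1) (\<lambda>\<zeta>. \<epsilon>\<^sup>2 * (W \<zeta> * (norm (u \<zeta>))\<^sup>2) - W \<zeta> * (norm (e \<zeta>))\<^sup>2)" by (intro ci)
    fix \<zeta> :: complex assume \<zeta>: "\<zeta> \<in> sphere 0 1"
    let ?u = "norm (u \<zeta>)" and ?e = "norm (e \<zeta>)"
    have "- (?u * ?e) \<le> Re (cdot (u \<zeta>) (e \<zeta>))"
      using norm_cdot_le[of "u \<zeta>" "e \<zeta>"] abs_Re_le_cmod[of "cdot (u \<zeta>) (e \<zeta>)"] by linarith
    hence "\<epsilon> * ?u\<^sup>2 - ?u * ?e \<le> Re (cdot (u \<zeta>) (A \<zeta> (u \<zeta>) + e \<zeta>))"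
      using coercive[OF \<zeta>, of "u \<zeta>"] by (simp add: cdot_add_right)
    hence "2 * \<epsilon> * (\<epsilon> * ?u\<^sup>2 - ?u * ?e) \<le> 2 * \<epsilon> * Re (cdot (u \<zeta>) (A \<zeta> (u \<zeta>) + e \<zeta>))"
      using eps_pos by (intro mult_left_mono) auto
    moreover have "0 \<le> (\<epsilon> * ?u - ?e)\<^sup>2" by simp
    ultimately have "\<epsilon>\<^sup>2 * ?u\<^sup>2 - ?e\<^sup>2 \<le> 2 * \<epsilon> * Re (cdot (u \<zeta>) (A \<zeta> (u \<zeta>) + e \<zeta>))"
      by (simp add: power2_eq_square algebra_simps)
    hence "W \<zeta> * (\<epsilon>\<^sup>2 * ?u\<^sup>2 - ?e\<^sup>2) \<le> W \<zeta> * (2 * \<epsilon> * Re (cdot (u \<zeta>) (A \<zeta> (u \<zeta>) + e \<zeta>)))"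
      using W(2)[OF \<zeta>] by (rule mult_left_mono)
    thus "\<epsilon>\<^sup>2 * (W \<zeta> * ?u\<^sup>2) - W \<zeta> * ?e\<^sup>2 \<le> 2 * \<epsilon> * Re (?q \<zeta>)"
      by (simp add: algebra_simps)
  qed
  also have "\<dots> = 2 * \<epsilon> * Re (cmean ?q)"
    by (subst cmean_mult_left_real) (intro ci, simp only: cmean_Re[OF q])
  also have "\<dots> = 0" using orth by simp
  finally have "cmean (\<lambda>\<zeta>. \<epsilon>\<^sup>2 * (W \<zeta> * (norm (u \<zeta>))\<^sup>2) - W \<zeta> * (norm (e \<zeta>))\<^sup>2) \<le> 0" .
  moreover have "cmean (\<lambda>\<zeta>. \<epsilon>\<^sup>2 * (W \<zeta> * (norm (u \<zeta>))\<^sup>2) - W \<zeta> * (norm (e \<zeta>))\<^sup>2) =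
      \<epsilon>\<^sup>2 * cmean (\<lambda>\<zeta>. W \<zeta> * (norm (u \<zeta>))\<^sup>2) - cmean (\<lambda>\<zeta>. W \<zeta> * (norm (e \<zeta>))\<^sup>2)"
    by (subst cmean_diff, (intro ci)+, subst cmean_mult_left_real, (intro ci)+, rule refl)
  ultimately show ?thesis by simp
qed

end

lemma young_mult:
  fixes x y t :: real
  assumes "0 < t"
  shows "x * y \<le> (t * x\<^sup>2 + y\<^sup>2 / t) / 2"
proof -
  have "0 \<le> (t * x - y)\<^sup>2 / t" using assms by simp
  also have "\<dots> = t * x\<^sup>2 + y\<^sup>2 / t - 2 * (x * y)"
    using assms by (simp add: power2_eq_square field_simps)
  finally show ?thesis by simp
qed

lemma powr_sq: "(x powr p)\<^sup>2 = x powr (2 * p)" for x p :: real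
  by (simp add: power2_eq_square flip: powr_add)

lemma norm_point_diff_le:
  assumes "a \<in> ball 0 1" "\<sigma> \<in> sphere 0 1" "a = of_real (cmod a) * \<sigma>" "\<zeta> \<in> sphere 0 1"
  shows "cmod (\<zeta> - \<sigma>) \<le> 2 * cmod (\<zeta> - a)"
proof -
  have "\<sigma> - a = of_real (1 - cmod a) * \<sigma>" using assms(3) by (simp add: algebra_simps)
  hence "cmod (\<sigma> - a) = 1 - cmod a" using assms by (simp add: norm_mult del: of_real_diff)
  also have "\<dots> \<le> cmod (\<zeta> - a)" using norm_triangle_ineq2[of \<zeta> a] assms by simp
  finally have "cmod (\<sigma> - a) \<le> cmod (\<zeta> - a)" .
  moreover have "cmod (\<zeta> - \<sigma>) \<le> cmod (\<zeta> - a) + cmod (\<sigma> - a)"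
    using norm_triangle_ineq4[of "\<zeta> - a" "\<sigma> - a"] by simp
  ultimately show ?thesis by simp
qed

text \<open>The weight \<^term>\<open>poisson a\<close> reproduces the disc algebra, and its square annihilates products of
  functions vanishing at \<^term>\<open>a\<close>. Testing the equation with \<^term>\<open>u - (\<lambda>_. u a)\<close> against these two
  weights turns coercivity into Campanato-type estimates at the scale of the distance of
  \<^term>\<open>a\<close> to the circle.\<close>

locale interior_estimate = coercive_symbol A \<epsilon> \<Lambda>
  for A :: "complex \<Rightarrow> (complex ^ 'n) \<Rightarrow>\<^sub>L (complex ^ 'n)" and \<epsilon> \<Lambda> +
  fixes \<alpha> :: real and u F f :: "complex \<Rightarrow> complex ^ 'n" and a \<sigma> :: complex and N :: real
  assumes alpha: "0 < \<alpha>" "\<alpha> < 1"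
    and a: "a \<in> ball 0 1" and \<sigma>: "\<sigma> \<in> sphere 0 1" and a_eq: "a = of_real (cmod a) * \<sigma>"
    and u: "disc_alg_vec u" and F: "disc_alg_vec F" and f: "continuous_on (sphere 0 1) f"
    and eq: "\<zeta> \<in> sphere 0 1 \<Longrightarrow> F \<zeta> = A \<zeta> (u \<zeta>) + f \<zeta>"
    and N: "0 < N"
    and osc: "\<zeta> \<in> sphere 0 1 \<Longrightarrow>
      norm (f \<zeta> - f \<sigma> + (A \<zeta> - A \<sigma>) (u a)) \<le> N * cmod (\<zeta> - a) powr \<alpha>"
begin

definition "\<delta> = 1 - (cmod a)\<^sup>2"
definition "w \<zeta> = u \<zeta> - u a"
definition "e \<zeta> = f \<zeta> - f \<sigma> + (A \<zeta> - A \<sigma>) (u a)"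
definition "\<kappa> = f \<sigma> + A \<sigma> (u a)"
text \<open>The bracket is the constant of \<open>mean_dist_w\<close>, multiplied by the Lipschitz
  bound for \<open>A \<zeta> - A \<sigma>\<close>; the cosine comes from
  \<open>cmean_poisson_powr_le\<close>. In \<open>K3\<close> the outer 2 is from the square of a
  sum, and 3 and 2 are the constants of the two moments of the squared kernel.\<close>

definition "K1 = 2 * \<Lambda> * (1/2 + 1/\<epsilon>\<^sup>2) + 1 / cos (\<alpha> * pi / 2)"
definition "K3 = 2 * (3 + 2 * K1\<^sup>2)"

lemma delta_pos: "0 < \<delta>" and delta_le: "\<delta> \<le> 1"
  using defect_pos[OF a] by (auto simp: \<delta>_def)

lemma cont_w [continuous_intros]: "continuous_on (sphere 0 1) w"
  unfolding w_def by (intro continuous_intros disc_alg_vec_cont_sphere u)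

lemma cont_e [continuous_intros]: "continuous_on (sphere 0 1) e"
  unfolding e_def by (intro continuous_intros f)

lemma disc_w: "disc_alg_vec w"
  unfolding w_def by (intro disc_alg_vec_intros u)

lemma eq_we: "\<zeta> \<in> sphere 0 1 \<Longrightarrow> A \<zeta> (w \<zeta>) + e \<zeta> = F \<zeta> - \<kappa>"
  unfolding w_def e_def \<kappa>_def
  by (simp add: eq blinfun.diff_left blinfun.diff_right algebra_simps)

lemmas cpois = continuous_on_poisson[OF a]

lemma norm_e_le: "\<zeta> \<in> sphere 0 1 \<Longrightarrow> norm (e \<zeta>) \<le> N * cmod (\<zeta> - a) powr \<alpha>"
  unfolding e_def by (rule osc)

lemma cont_dist_powr [continuous_intros]: "continuous_on (sphere 0 1) (\<lambda>\<zeta>. cmod (\<zeta> - a) powr p)"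
  using a by (intro continuous_intros) auto

text \<open>The product of \<open>w\<close> and \<open>F - \<kappa>\<close> is holomorphic and
  \<open>w a = 0\<close>, so its Poisson mean vanishes and \<open>energy\<close> applies.\<close>

lemma L2_poisson: "cmean (\<lambda>\<zeta>. poisson a \<zeta> * (norm (w \<zeta>))\<^sup>2) \<le> 2 * N\<^sup>2 / \<epsilon>\<^sup>2 * \<delta> powr \<alpha>"
proof -
  have "\<epsilon>\<^sup>2 * cmean (\<lambda>\<zeta>. poisson a \<zeta> * (norm (w \<zeta>))\<^sup>2) \<le> cmean (\<lambda>\<zeta>. poisson a \<zeta> * (norm (e \<zeta>))\<^sup>2)"
  proof (rule energy)
    have "cmean (\<lambda>\<zeta>. of_real (poisson a \<zeta>) * cdot (w \<zeta>) (A \<zeta> (w \<zeta>) + e \<zeta>)) =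
        cmean (\<lambda>\<zeta>. of_real (poisson a \<zeta>) * cdot (w \<zeta>) (F \<zeta> - \<kappa>))"
      by (rule cmean_cong) (simp add: eq_we)
    also have "\<dots> = cdot (w a) (F a - \<kappa>)"
      by (intro cmean_poisson_disc_alg[OF a] disc_alg_cdot disc_w disc_alg_vec_intros F)
    finally show "cmean (\<lambda>\<zeta>. of_real (poisson a \<zeta>) * cdot (w \<zeta>) (A \<zeta> (w \<zeta>) + e \<zeta>)) = 0"
      by (simp add: w_def cdot_zero_left)
  qed (auto intro!: continuous_intros cpois poisson_nonneg[OF a])
  also have "\<dots> \<le> cmean (\<lambda>\<zeta>. N\<^sup>2 * (poisson a \<zeta> * cmod (\<zeta> - a) powr (2*\<alpha>)))"
  proof (rule cmean_mono)
    fix \<zeta> :: complex assume \<zeta>: "\<zeta> \<in> sphere 0 1"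
    have "(norm (e \<zeta>))\<^sup>2 \<le> (N * cmod (\<zeta> - a) powr \<alpha>)\<^sup>2"
      by (intro power_mono norm_e_le \<zeta>) auto
    also have "\<dots> = N\<^sup>2 * cmod (\<zeta> - a) powr (2*\<alpha>)"
      by (simp add: power_mult_distrib powr_sq)
    finally have "poisson a \<zeta> * (norm (e \<zeta>))\<^sup>2 \<le> poisson a \<zeta> * (N\<^sup>2 * cmod (\<zeta> - a) powr (2*\<alpha>))"
      using poisson_nonneg[OF a \<zeta>] by (rule mult_left_mono)
    thus "poisson a \<zeta> * (norm (e \<zeta>))\<^sup>2 \<le> N\<^sup>2 * (poisson a \<zeta> * cmod (\<zeta> - a) powr (2*\<alpha>))"
      by (simp add: mult_ac)
  qed (auto intro!: continuous_intros cpois)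
  also have "\<dots> = N\<^sup>2 * cmean (\<lambda>\<zeta>. poisson a \<zeta> * cmod (\<zeta> - a) powr (2*\<alpha>))"
    by (intro cmean_mult_left_real continuous_intros cpois)
  also have "\<dots> \<le> N\<^sup>2 * (2 * \<delta> powr \<alpha>)"
    unfolding \<delta>_def by (intro mult_left_mono cmean_poisson_powr2_le a alpha) auto
  finally show ?thesis using eps_pos by (simp add: field_simps)
qed

lemma mean_dist_w: "cmean (\<lambda>\<zeta>. poisson a \<zeta> * (cmod (\<zeta> - a) * norm (w \<zeta>))) \<le> (1/2 + 1/\<epsilon>\<^sup>2) * N * \<delta> powr \<alpha>"
proof -
  \<comment> \<open>This value balances \<open>t * \<delta>\<close> against
    \<open>N\<^sup>2 * \<delta> powr \<alpha> / t\<close>; both become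
    \<open>N * \<delta> powr ((1 + \<alpha>) / 2)\<close>, which is at most
    \<open>N * \<delta> powr \<alpha>\<close> as \<open>\<delta>\<close> is at most 1.\<close>
  define t where "t = N * \<delta> powr ((\<alpha> - 1) / 2)"
  have t: "0 < t" using N delta_pos by (simp add: t_def)
  have "cmean (\<lambda>\<zeta>. poisson a \<zeta> * (cmod (\<zeta> - a) * norm (w \<zeta>))) \<le>
      cmean (\<lambda>\<zeta>. t/2 * (poisson a \<zeta> * (cmod (\<zeta> - a))\<^sup>2) + (1 / (2*t)) * (poisson a \<zeta> * (norm (w \<zeta>))\<^sup>2))"
  proof (rule cmean_mono)
    fix \<zeta> :: complex assume \<zeta>: "\<zeta> \<in> sphere 0 1"
    show "poisson a \<zeta> * (cmod (\<zeta> - a) * norm (w \<zeta>)) \<le>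
       t/2 * (poisson a \<zeta> * (cmod (\<zeta> - a))\<^sup>2) + (1 / (2*t)) * (poisson a \<zeta> * (norm (w \<zeta>))\<^sup>2)"
      using mult_left_mono[OF young_mult[OF t, of "cmod (\<zeta> - a)" "norm (w \<zeta>)"] poisson_nonneg[OF a \<zeta>]]
      by (simp add: algebra_simps add_divide_distrib)
  qed (use t in \<open>auto intro!: continuous_intros cpois\<close>)
  also have "\<dots> = t/2 * cmean (\<lambda>\<zeta>. poisson a \<zeta> * (cmod (\<zeta> - a))\<^sup>2) +
      1 / (2*t) * cmean (\<lambda>\<zeta>. poisson a \<zeta> * (norm (w \<zeta>))\<^sup>2)"
  proof -
    have "cmean (\<lambda>\<zeta>. p * (poisson a \<zeta> * (cmod (\<zeta> - a))\<^sup>2) + q * (poisson a \<zeta> * (norm (w \<zeta>))\<^sup>2)) =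
       p * cmean (\<lambda>\<zeta>. poisson a \<zeta> * (cmod (\<zeta> - a))\<^sup>2) + q * cmean (\<lambda>\<zeta>. poisson a \<zeta> * (norm (w \<zeta>))\<^sup>2)" for p q
      by (simp add: cmean_add cmean_mult_left_real continuous_intros cpois)
    thus ?thesis .
  qed
  also have "cmean (\<lambda>\<zeta>. poisson a \<zeta> * (cmod (\<zeta> - a))\<^sup>2) = \<delta>"
    using cmean_cong[of "\<lambda>\<zeta>. poisson a \<zeta> * (cmod (\<zeta> - a))\<^sup>2" "\<lambda>_. \<delta>"] poisson_norm_diff[OF a]
    by (simp add: \<delta>_def)
  also have "t/2 * \<delta> + 1 / (2*t) * cmean (\<lambda>\<zeta>. poisson a \<zeta> * (norm (w \<zeta>))\<^sup>2) \<le>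
      t/2 * \<delta> + 1 / (2*t) * (2 * N\<^sup>2 / \<epsilon>\<^sup>2 * \<delta> powr \<alpha>)"
    using t by (intro add_left_mono mult_left_mono L2_poisson) auto
  also have "\<dots> = (1/2 + 1/\<epsilon>\<^sup>2) * N * \<delta> powr ((1 + \<alpha>) / 2)"
  proof -
    have p: "\<delta> powr ((1 + \<alpha>) / 2) = \<delta> powr ((\<alpha> - 1) / 2) * \<delta>"
    proof -
      have "(1 + \<alpha>) / 2 = (\<alpha> - 1) / 2 + 1" by (simp add: field_simps)
      thus ?thesis using delta_pos by (simp only: powr_add) simp
    qed
    have q: "\<delta> powr \<alpha> = \<delta> powr ((\<alpha> - 1) / 2) * (\<delta> powr ((\<alpha> - 1) / 2) * \<delta>)"
    proof -
      have "\<alpha> = (\<alpha> - 1) / 2 + (1 + \<alpha>) / 2" by (simp add: field_simps)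
      hence "\<delta> powr \<alpha> = \<delta> powr ((\<alpha> - 1) / 2) * \<delta> powr ((1 + \<alpha>) / 2)" by (metis powr_add)
      thus ?thesis by (simp only: p)
    qed
    show ?thesis
      unfolding t_def p q using N delta_pos eps_pos by (simp add: field_simps power2_eq_square)
  qed
  also have "\<dots> \<le> (1/2 + 1/\<epsilon>\<^sup>2) * N * \<delta> powr \<alpha>"
    using N delta_pos delta_le alpha eps_pos by (intro mult_left_mono powr_mono') auto
  finally show ?thesis .
qed

lemma boundary_value: "norm (F a - \<kappa>) \<le> K1 * N * \<delta> powr \<alpha>"
proof -
  have cF: "continuous_on (sphere 0 1) F" by (rule disc_alg_vec_cont_sphere[OF F])
  have w0: "cmean (\<lambda>\<zeta>. poisson a \<zeta> *\<^sub>R w \<zeta>) = 0"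
    using cmean_poisson_disc_alg_vec[OF a disc_w] by (simp add: w_def)
  have c1: "continuous_on (sphere 0 1) (\<lambda>\<zeta>. poisson a \<zeta> *\<^sub>R (A \<sigma> (w \<zeta>)))"
    and c2: "continuous_on (sphere 0 1) (\<lambda>\<zeta>. poisson a \<zeta> *\<^sub>R (F \<zeta> - \<kappa>))"
    by (intro continuous_intros cpois cF)+
  have "cmean (\<lambda>\<zeta>. poisson a \<zeta> *\<^sub>R (A \<sigma> (w \<zeta>))) = A \<sigma> (cmean (\<lambda>\<zeta>. poisson a \<zeta> *\<^sub>R w \<zeta>))"
    by (subst cmean_linear[OF blinfun.bounded_linear_right, symmetric])
       (auto intro!: continuous_intros cpois simp: blinfun.scaleR_right)
  hence 0: "cmean (\<lambda>\<zeta>. poisson a \<zeta> *\<^sub>R (A \<sigma> (w \<zeta>))) = 0" by (simp add: w0 blinfun.zero_right)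
  have "F a - \<kappa> = cmean (\<lambda>\<zeta>. poisson a \<zeta> *\<^sub>R (F \<zeta> - \<kappa>))"
    by (rule cmean_poisson_disc_alg_vec[OF a, symmetric]) (intro disc_alg_vec_intros F)
  also have "\<dots> = cmean (\<lambda>\<zeta>. poisson a \<zeta> *\<^sub>R (F \<zeta> - \<kappa>) - poisson a \<zeta> *\<^sub>R (A \<sigma> (w \<zeta>)))"
    by (simp add: cmean_diff c1 c2 0)
  finally have Fa: "F a - \<kappa> = cmean (\<lambda>\<zeta>. poisson a \<zeta> *\<^sub>R (F \<zeta> - \<kappa>) - poisson a \<zeta> *\<^sub>R (A \<sigma> (w \<zeta>)))" .
  have "norm (F a - \<kappa>) \<le> cmean (\<lambda>\<zeta>. 2 * \<Lambda> * (poisson a \<zeta> * (cmod (\<zeta> - a) * norm (w \<zeta>)))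
       + N * (poisson a \<zeta> * cmod (\<zeta> - a) powr \<alpha>))"
    unfolding Fa
  proof (rule norm_cmean_le)
    fix \<zeta> :: complex assume \<zeta>: "\<zeta> \<in> sphere 0 1"
    have "poisson a \<zeta> *\<^sub>R (F \<zeta> - \<kappa>) - poisson a \<zeta> *\<^sub>R (A \<sigma> (w \<zeta>)) = poisson a \<zeta> *\<^sub>R ((A \<zeta> - A \<sigma>) (w \<zeta>) + e \<zeta>)"
      by (simp add: eq_we[OF \<zeta>, symmetric] blinfun.diff_left algebra_simps)
    also have "norm \<dots> = poisson a \<zeta> * norm ((A \<zeta> - A \<sigma>) (w \<zeta>) + e \<zeta>)"
      using poisson_nonneg[OF a \<zeta>] by simp
    also have "\<dots> \<le> poisson a \<zeta> * (2 * \<Lambda> * (cmod (\<zeta> - a) * norm (w \<zeta>)) + N * cmod (\<zeta> - a) powr \<alpha>)"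
    proof (rule mult_left_mono[OF _ poisson_nonneg[OF a \<zeta>]])
      have "norm (A \<zeta> - A \<sigma>) \<le> \<Lambda> * (2 * cmod (\<zeta> - a))"
        using lipschitz[OF \<zeta> \<sigma>] mult_left_mono[OF norm_point_diff_le[OF a \<sigma> a_eq \<zeta>] Lip_nonneg] by linarith
      hence "norm (A \<zeta> - A \<sigma>) * norm (w \<zeta>) \<le> \<Lambda> * (2 * cmod (\<zeta> - a)) * norm (w \<zeta>)"
        by (rule mult_right_mono) simp
      hence "norm ((A \<zeta> - A \<sigma>) (w \<zeta>)) \<le> 2 * \<Lambda> * (cmod (\<zeta> - a) * norm (w \<zeta>))"
        using norm_blinfun[of "A \<zeta> - A \<sigma>" "w \<zeta>"] by (simp add: mult_ac)
      thus "norm ((A \<zeta> - A \<sigma>) (w \<zeta>) + e \<zeta>) \<le> 2 * \<Lambda> * (cmod (\<zeta> - a) * norm (w \<zeta>)) + N * cmod (\<zeta> - a) powr \<alpha>"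
        using norm_e_le[OF \<zeta>] norm_triangle_mono by blast
    qed
    finally show "norm (poisson a \<zeta> *\<^sub>R (F \<zeta> - \<kappa>) - poisson a \<zeta> *\<^sub>R (A \<sigma> (w \<zeta>))) \<le>
      2 * \<Lambda> * (poisson a \<zeta> * (cmod (\<zeta> - a) * norm (w \<zeta>))) + N * (poisson a \<zeta> * cmod (\<zeta> - a) powr \<alpha>)"
      by (simp add: algebra_simps)
  qed (intro continuous_intros cpois cF)+
  also have "\<dots> = 2 * \<Lambda> * cmean (\<lambda>\<zeta>. poisson a \<zeta> * (cmod (\<zeta> - a) * norm (w \<zeta>)))
      + N * cmean (\<lambda>\<zeta>. poisson a \<zeta> * cmod (\<zeta> - a) powr \<alpha>)"
    by (subst cmean_add cmean_mult_left_real, (intro continuous_intros cpois)+)+ (rule refl)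
  also have "\<dots> \<le> 2 * \<Lambda> * ((1/2 + 1/\<epsilon>\<^sup>2) * N * \<delta> powr \<alpha>) + N * (\<delta> powr \<alpha> / cos (\<alpha> * pi / 2))"
    using Lip_nonneg N unfolding \<delta>_def
    by (intro add_mono mult_left_mono cmean_poisson_powr_le a alpha mean_dist_w[unfolded \<delta>_def]) auto
  also have "\<dots> = K1 * N * \<delta> powr \<alpha>" by (simp add: K1_def algebra_simps)
  finally show ?thesis .
qed

text \<open>The squared kernel annihilates only products in which both factors vanish at
  \<open>a\<close>. Hence the equation is centred at \<open>F a\<close> and not at
  \<open>\<kappa>\<close>, and the difference \<open>\<kappa> - F a\<close> joins the error, where
  \<open>boundary_value\<close> controls it.\<close>

lemma L2_poisson_sq: "cmean (\<lambda>\<zeta>. (poisson a \<zeta>)\<^sup>2 * (norm (w \<zeta>))\<^sup>2) \<le> K3 / \<epsilon>\<^sup>2 * N\<^sup>2 * \<delta> powr (2*\<alpha> - 1)"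
proof -
  let ?e = "\<lambda>\<zeta>. e \<zeta> + (\<kappa> - F a)"
  have "\<epsilon>\<^sup>2 * cmean (\<lambda>\<zeta>. (poisson a \<zeta>)\<^sup>2 * (norm (w \<zeta>))\<^sup>2) \<le> cmean (\<lambda>\<zeta>. (poisson a \<zeta>)\<^sup>2 * (norm (?e \<zeta>))\<^sup>2)"
  proof (rule energy)
    have G: "disc_alg (\<lambda>z. F z $ i - F a $ i)" "disc_alg (\<lambda>z. w z $ i)" for i
      using F disc_w by (auto intro!: disc_alg_intros disc_alg_vec_nth)
    have c: "continuous_on (sphere 0 1) (\<lambda>\<zeta>. of_real ((poisson a \<zeta>)\<^sup>2) * (w \<zeta> $ i * (F \<zeta> $ i - F a $ i)))" for i
      by (intro continuous_intros cpois disc_alg_cont_sphere G)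
    have "cmean (\<lambda>\<zeta>. of_real ((poisson a \<zeta>)\<^sup>2) * cdot (w \<zeta>) (A \<zeta> (w \<zeta>) + ?e \<zeta>)) =
        cmean (\<lambda>\<zeta>. \<Sum>i\<in>UNIV. of_real ((poisson a \<zeta>)\<^sup>2) * (w \<zeta> $ i * (F \<zeta> $ i - F a $ i)))"
    proof (rule cmean_cong)
      fix \<zeta> :: complex assume \<zeta>: "\<zeta> \<in> sphere 0 1"
      have "A \<zeta> (w \<zeta>) + ?e \<zeta> = F \<zeta> - F a" using eq_we[OF \<zeta>] by (simp add: algebra_simps)
      thus "of_real ((poisson a \<zeta>)\<^sup>2) * cdot (w \<zeta>) (A \<zeta> (w \<zeta>) + ?e \<zeta>) =
         (\<Sum>i\<in>UNIV. of_real ((poisson a \<zeta>)\<^sup>2) * (w \<zeta> $ i * (F \<zeta> $ i - F a $ i)))"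
        by (simp only: cdot_def sum_distrib_left vector_minus_component)
    qed
    also have "\<dots> = (\<Sum>i\<in>UNIV. cmean (\<lambda>\<zeta>. of_real ((poisson a \<zeta>)\<^sup>2) * (w \<zeta> $ i * (F \<zeta> $ i - F a $ i))))"
      by (rule cmean_sum[OF finite_class.finite_UNIV c])
    also have "\<dots> = 0"
      by (intro sum.neutral ballI cmean_poisson_sq_mult[OF a] G) (simp_all add: w_def)
    finally show "cmean (\<lambda>\<zeta>. of_real ((poisson a \<zeta>)\<^sup>2) * cdot (w \<zeta>) (A \<zeta> (w \<zeta>) + ?e \<zeta>)) = 0" .
  qed (auto intro!: continuous_intros cpois)
  also have "\<dots> \<le> cmean (\<lambda>\<zeta>. 2 * N\<^sup>2 * ((poisson a \<zeta>)\<^sup>2 * cmod (\<zeta> - a) powr (2*\<alpha>)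
        + K1\<^sup>2 * \<delta> powr (2*\<alpha>) * (poisson a \<zeta>)\<^sup>2))"
  proof (rule cmean_mono)
    fix \<zeta> :: complex assume \<zeta>: "\<zeta> \<in> sphere 0 1"
    let ?x = "cmod (\<zeta> - a) powr \<alpha>" and ?y = "K1 * \<delta> powr \<alpha>"
    have "norm (?e \<zeta>) \<le> norm (e \<zeta>) + norm (F a - \<kappa>)"
      using norm_triangle_ineq4[of "e \<zeta>" "F a - \<kappa>"] by (simp add: algebra_simps)
    also have "\<dots> \<le> N * (?x + ?y)" using norm_e_le[OF \<zeta>] boundary_value by (simp add: algebra_simps)
    finally have "(norm (?e \<zeta>))\<^sup>2 \<le> (N * (?x + ?y))\<^sup>2" by (rule power_mono) simp
    also have "\<dots> = N\<^sup>2 * (?x + ?y)\<^sup>2" by (simp add: power_mult_distrib)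
    also have "\<dots> \<le> N\<^sup>2 * (2 * ?x\<^sup>2 + 2 * ?y\<^sup>2)"
    proof (rule mult_left_mono)
      have "0 \<le> (?x - ?y)\<^sup>2" by simp
      thus "(?x + ?y)\<^sup>2 \<le> 2 * ?x\<^sup>2 + 2 * ?y\<^sup>2" by (simp add: power2_eq_square algebra_simps)
    qed simp
    also have "\<dots> = 2 * N\<^sup>2 * (cmod (\<zeta> - a) powr (2*\<alpha>) + K1\<^sup>2 * \<delta> powr (2*\<alpha>))"
      by (simp add: power_mult_distrib powr_sq algebra_simps)
    finally have "(poisson a \<zeta>)\<^sup>2 * (norm (?e \<zeta>))\<^sup>2 \<le>
        (poisson a \<zeta>)\<^sup>2 * (2 * N\<^sup>2 * (cmod (\<zeta> - a) powr (2*\<alpha>) + K1\<^sup>2 * \<delta> powr (2*\<alpha>)))"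
      by (rule mult_left_mono) simp
    thus "(poisson a \<zeta>)\<^sup>2 * (norm (?e \<zeta>))\<^sup>2 \<le> 2 * N\<^sup>2 * ((poisson a \<zeta>)\<^sup>2 * cmod (\<zeta> - a) powr (2*\<alpha>)
        + K1\<^sup>2 * \<delta> powr (2*\<alpha>) * (poisson a \<zeta>)\<^sup>2)"
      by (simp add: algebra_simps)
  qed (auto intro!: continuous_intros cpois)
  also have "\<dots> = 2 * N\<^sup>2 * (cmean (\<lambda>\<zeta>. (poisson a \<zeta>)\<^sup>2 * cmod (\<zeta> - a) powr (2*\<alpha>))
        + K1\<^sup>2 * \<delta> powr (2*\<alpha>) * cmean (\<lambda>\<zeta>. (poisson a \<zeta>)\<^sup>2))"
    by (subst cmean_add cmean_mult_left_real, (intro continuous_intros cpois)+)+ (rule refl)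
  also have "\<dots> \<le> 2 * N\<^sup>2 * (3 * \<delta> powr (2*\<alpha> - 1) + K1\<^sup>2 * \<delta> powr (2*\<alpha>) * (2 / \<delta>))"
    unfolding \<delta>_def
    by (intro mult_left_mono add_mono cmean_poisson_sq_powr_le cmean_poisson_sq_le a alpha) auto
  also have "\<dots> = K3 * N\<^sup>2 * \<delta> powr (2*\<alpha> - 1)"
    using delta_pos by (simp add: K3_def powr_diff field_simps)
  finally show ?thesis using eps_pos by (simp add: field_simps)
qed

lemma deriv_bound: "cmod (deriv (\<lambda>z. u z $ i) a) \<le> (1 + K3 / (2 * \<epsilon>\<^sup>2)) * N * \<delta> powr (\<alpha> - 1)"
proof -
  \<comment> \<open>The expected size of \<open>w\<close> within distance \<open>\<delta>\<close> of
    \<open>a\<close>; with it both terms of Young's inequality are of order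
    \<open>N * \<delta> powr (\<alpha> - 1)\<close>.\<close>
  define t where "t = N * \<delta> powr \<alpha>"
  have t: "0 < t" using N delta_pos by (simp add: t_def)
  have wi: "disc_alg (\<lambda>z. w z $ i)" using disc_w by (rule disc_alg_vec_nth)
  have "deriv (\<lambda>z. u z $ i) a = deriv (\<lambda>z. w z $ i) a"
  proof -
    have "(\<lambda>z. u z $ i) field_differentiable (at a)"
      by (rule holomorphic_on_imp_differentiable_at[OF disc_alg_holo[OF disc_alg_vec_nth[OF u]] open_ball a])
    thus ?thesis by (simp add: w_def)
  qed
  also have "\<dots> = cmean (\<lambda>\<zeta>. of_real ((poisson a \<zeta>)\<^sup>2) * (cnj \<zeta> * w \<zeta> $ i))"
    by (rule cmean_poisson_sq_deriv[OF a wi, symmetric]) (simp add: w_def)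
  finally have d: "deriv (\<lambda>z. u z $ i) a = cmean (\<lambda>\<zeta>. of_real ((poisson a \<zeta>)\<^sup>2) * (cnj \<zeta> * w \<zeta> $ i))" .
  have "cmod (deriv (\<lambda>z. u z $ i) a) \<le>
     cmean (\<lambda>\<zeta>. t/2 * (poisson a \<zeta>)\<^sup>2 + (1 / (2*t)) * ((poisson a \<zeta>)\<^sup>2 * (norm (w \<zeta>))\<^sup>2))"
    unfolding d
  proof (rule norm_cmean_le)
    fix \<zeta> :: complex assume \<zeta>: "\<zeta> \<in> sphere 0 1"
    have "cmod (of_real ((poisson a \<zeta>)\<^sup>2) * (cnj \<zeta> * w \<zeta> $ i)) = (poisson a \<zeta>)\<^sup>2 * cmod (w \<zeta> $ i)"
      using \<zeta> by (simp add: norm_mult norm_power)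
    also have "\<dots> \<le> (poisson a \<zeta>)\<^sup>2 * ((t * 1\<^sup>2 + (norm (w \<zeta>))\<^sup>2 / t) / 2)"
      using young_mult[OF t, of 1 "norm (w \<zeta>)"] Finite_Cartesian_Product.norm_nth_le[of "w \<zeta>" i]
      by (intro mult_left_mono) auto
    finally show "cmod (of_real ((poisson a \<zeta>)\<^sup>2) * (cnj \<zeta> * w \<zeta> $ i)) \<le>
        t/2 * (poisson a \<zeta>)\<^sup>2 + (1 / (2*t)) * ((poisson a \<zeta>)\<^sup>2 * (norm (w \<zeta>))\<^sup>2)"
      by (simp add: algebra_simps add_divide_distrib)
  qed (intro continuous_intros cpois disc_alg_cont_sphere wi)+
  also have "\<dots> = t/2 * cmean (\<lambda>\<zeta>. (poisson a \<zeta>)\<^sup>2)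
      + 1 / (2*t) * cmean (\<lambda>\<zeta>. (poisson a \<zeta>)\<^sup>2 * (norm (w \<zeta>))\<^sup>2)"
    by (subst cmean_add cmean_mult_left_real, (intro continuous_intros cpois)+)+ (rule refl)
  also have "\<dots> \<le> t/2 * (2 / \<delta>) + 1 / (2*t) * (K3 / \<epsilon>\<^sup>2 * N\<^sup>2 * \<delta> powr (2*\<alpha> - 1))"
    using t unfolding \<delta>_def
    by (intro add_mono mult_left_mono cmean_poisson_sq_le a L2_poisson_sq[unfolded \<delta>_def]) auto
  also have "\<dots> = (1 + K3 / (2 * \<epsilon>\<^sup>2)) * N * \<delta> powr (\<alpha> - 1)"
  proof -
    have 1: "\<delta> powr (2*\<alpha> - 1) = \<delta> powr \<alpha> * \<delta> powr (\<alpha> - 1)"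
      using delta_pos by (simp flip: powr_add)
    have 2: "\<delta> powr \<alpha> = \<delta> * \<delta> powr (\<alpha> - 1)"
      using delta_pos by (simp add: powr_diff)
    show ?thesis
      unfolding t_def 1 unfolding 2 using N delta_pos eps_pos by (simp add: field_simps power2_eq_square)
  qed
  finally show ?thesis .
qed

end

section \<open>Growth and Hoelder estimates inside the disc\<close>

lemma has_vector_derivative_vec:
  fixes f :: "real \<Rightarrow> complex ^ 'n"
  assumes "\<And>i. ((\<lambda>t. f t $ i) has_vector_derivative f' $ i) (at x within S)"
  shows "(f has_vector_derivative f') (at x within S)"
proof -
  have bl: "bounded_linear (axis i :: complex \<Rightarrow> complex ^ 'n)" for i
  proof (rule bounded_linear_intro[where K = 1])
    show "norm (axis i x :: complex ^ 'n) \<le> norm x * 1" for x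
    proof -
      have "norm (axis i x :: complex ^ 'n) \<le> (\<Sum>j\<in>UNIV. cmod (axis i x $ j))"
        unfolding norm_vec_def by (rule L2_set_le_sum) simp
      also have "\<dots> = (\<Sum>j\<in>UNIV. if j = i then cmod x else 0)"
        by (intro sum.cong) (auto simp: axis_def)
      finally show ?thesis by simp
    qed
  qed (auto simp: axis_def vec_eq_iff)
  have eq: "v = (\<Sum>i\<in>UNIV. axis i (v $ i))" for v :: "complex ^ 'n"
    by (simp add: vec_eq_iff axis_def)
  have "((\<lambda>t. \<Sum>i\<in>UNIV. axis i (f t $ i)) has_vector_derivative (\<Sum>i\<in>UNIV. axis i (f' $ i))) (at x within S)"
    by (intro has_vector_derivative_sum bounded_linear.has_vector_derivative[OF bl] assms)
  thus ?thesis by (simp only: eq[symmetric])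
qed

section \<open>Interior estimates with constants depending only on the symbol and the
  exponent\<close>

context coercive_symbol
begin

text \<open>\<open>M\<close> is an explicit parameter so that the estimates are uniform over
  families of data. Its positivity keeps \<open>M + norm (u a)\<close> away from zero also when the
  solution vanishes at \<open>a\<close>.\<close>

definition holder_solution ::
  "real \<Rightarrow> real \<Rightarrow> (complex \<Rightarrow> complex ^ 'n) \<Rightarrow> (complex \<Rightarrow> complex ^ 'n) \<Rightarrow> (complex \<Rightarrow> complex ^ 'n) \<Rightarrow> bool" where
  "holder_solution \<alpha> M u F f \<longleftrightarrow> disc_alg_vec u \<and> disc_alg_vec F \<and> 0 < M \<and>
     (\<forall>\<zeta>\<in>sphere 0 1. F \<zeta> = A \<zeta> (u \<zeta>) + f \<zeta>) \<and>
     (\<forall>\<zeta>\<in>sphere 0 1. \<forall>\<eta>\<in>sphere 0 1. norm (f \<zeta> - f \<eta>) \<le> M * cmod (\<zeta> - \<eta>) powr \<alpha>)"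

text \<open>\<open>K\<close> has to be fixed before the solution and the point. For this reason
  \<open>k1\<close> and \<open>k3\<close> repeat the constants of the estimate locale, which contain
  only \<open>\<epsilon>\<close>, \<open>\<Lambda>\<close> and \<open>\<alpha>\<close>, ahead of its
  interpretation.\<close>

lemma interior_bounds:
  assumes alpha: "0 < \<alpha>" "\<alpha> < 1"
  obtains K where "0 < K"
    "\<And>u F f a \<sigma> M i. a \<in> ball 0 1 \<Longrightarrow> \<sigma> \<in> sphere 0 1 \<Longrightarrow> a = of_real (cmod a) * \<sigma> \<Longrightarrow> holder_solution \<alpha> M u F f
     \<Longrightarrow> cmod (deriv (\<lambda>z. u z $ i) a) \<le> K * (M + norm (u a)) * (1 - cmod a) powr (\<alpha> - 1)"
    "\<And>u F f a \<sigma> M. a \<in> ball 0 1 \<Longrightarrow> \<sigma> \<in> sphere 0 1 \<Longrightarrow> a = of_real (cmod a) * \<sigma> \<Longrightarrow> holder_solution \<alpha> M u F f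
     \<Longrightarrow> norm (F a - (f \<sigma> + A \<sigma> (u a))) \<le> K * (M + norm (u a)) * (1 - cmod a) powr \<alpha>"
proof -
  define k1 where "k1 = 2 * \<Lambda> * (1/2 + 1/\<epsilon>\<^sup>2) + 1 / cos (\<alpha> * pi / 2)"
  define k3 where "k3 = 2 * (3 + 2 * k1\<^sup>2)"
  define K where "K = (2 + 4 * \<Lambda>) * (2 * k1 + (1 + k3 / (2 * \<epsilon>\<^sup>2)))"
  have k13: "0 \<le> k1" "0 \<le> k3"
    unfolding k3_def k1_def using Lip_nonneg cos_gt_zero[of "\<alpha> * pi / 2"] alpha by auto
  have ec: "0 \<le> k3 / (2 * \<epsilon>\<^sup>2)" using k13 by simp
  have KK: "(2 + 4 * \<Lambda>) * (1 + k3 / (2 * \<epsilon>\<^sup>2)) \<le> K" "(2 + 4 * \<Lambda>) * (2 * k1) \<le> K"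
    unfolding K_def using Lip_nonneg k13 ec by (intro mult_left_mono; simp)+
  have "0 < (2 + 4 * \<Lambda>) * (1 + k3 / (2 * \<epsilon>\<^sup>2))" using Lip_nonneg ec by (intro mult_pos_pos) auto
  hence Kpos: "0 < K" using KK by linarith
  have main: "cmod (deriv (\<lambda>z. u z $ i) a) \<le> K * (M + norm (u a)) * (1 - cmod a) powr (\<alpha> - 1) \<and>
      norm (F a - (f \<sigma> + A \<sigma> (u a))) \<le> K * (M + norm (u a)) * (1 - cmod a) powr \<alpha>"
    if a: "a \<in> ball 0 1" and \<sigma>: "\<sigma> \<in> sphere 0 1" and a\<sigma>: "a = of_real (cmod a) * \<sigma>"
      and sol: "holder_solution \<alpha> M u F f"
    for u F f a \<sigma> M i
  proof -
    have u: "disc_alg_vec u" and F: "disc_alg_vec F" and M: "0 < M"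
      and eq: "\<And>\<zeta>. \<zeta> \<in> sphere 0 1 \<Longrightarrow> F \<zeta> = A \<zeta> (u \<zeta>) + f \<zeta>"
      and hol: "\<And>\<zeta> \<eta>. \<zeta> \<in> sphere 0 1 \<Longrightarrow> \<eta> \<in> sphere 0 1 \<Longrightarrow> norm (f \<zeta> - f \<eta>) \<le> M * cmod (\<zeta> - \<eta>) powr \<alpha>"
      using sol unfolding holder_solution_def by blast+
    \<comment> \<open>The distance to \<open>\<sigma>\<close> is at most twice the distance
      \<open>?y\<close> to \<open>a\<close>. This gives 2 for the data, since
      \<open>2 powr \<alpha>\<close> is at most 2, and 4 for the symbol, where moreover
      \<open>?y\<close> is at most \<open>2 * ?y powr \<alpha>\<close>.\<close>
    define N where "N = (2 + 4 * \<Lambda>) * (M + norm (u a))"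
    have MN: "0 < M + norm (u a)" using M by (simp add: add_pos_nonneg)
    interpret interior_estimate A \<epsilon> \<Lambda> \<alpha> u F f a \<sigma> N
    proof
      have "continuous_on (sphere 0 1) (\<lambda>\<zeta>. F \<zeta> - A \<zeta> (u \<zeta>))"
        by (intro continuous_intros disc_alg_vec_cont_sphere u F)
      thus "continuous_on (sphere 0 1) f"
        by (rule continuous_on_eq) (simp add: eq)
      show "0 < N" unfolding N_def using Lip_nonneg MN by (intro mult_pos_pos) auto
      fix \<zeta> :: complex assume \<zeta>: "\<zeta> \<in> sphere 0 1"
      let ?y = "cmod (\<zeta> - a)"
      have y: "0 < ?y" "?y \<le> 2"
        using \<zeta> a norm_triangle_ineq4[of \<zeta> a] by auto
      have le: "cmod (\<zeta> - \<sigma>) \<le> 2 * ?y" by (rule norm_point_diff_le[OF a \<sigma> a\<sigma> \<zeta>])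
      have "norm (f \<zeta> - f \<sigma>) \<le> M * (2 * ?y) powr \<alpha>"
      proof -
        have "cmod (\<zeta> - \<sigma>) powr \<alpha> \<le> (2 * ?y) powr \<alpha>" using le alpha by (intro powr_mono2) auto
        hence "M * cmod (\<zeta> - \<sigma>) powr \<alpha> \<le> M * (2 * ?y) powr \<alpha>" using M by simp
        thus ?thesis using hol[OF \<zeta> \<sigma>] by linarith
      qed
      also have "(2 * ?y) powr \<alpha> \<le> 2 * ?y powr \<alpha>"
        using powr_mono[of \<alpha> 1 2] alpha by (simp add: powr_mult mult_right_mono)
      finally have 1: "norm (f \<zeta> - f \<sigma>) \<le> 2 * M * ?y powr \<alpha>" using M by simp
      have "norm ((A \<zeta> - A \<sigma>) (u a)) \<le> norm (A \<zeta> - A \<sigma>) * norm (u a)" by (rule norm_blinfun)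
      also have "\<dots> \<le> \<Lambda> * (2 * ?y) * norm (u a)"
        using lipschitz[OF \<zeta> \<sigma>] mult_left_mono[OF le Lip_nonneg] by (intro mult_right_mono) auto
      also have "?y = ?y powr \<alpha> * ?y powr (1 - \<alpha>)" using y by (simp flip: powr_add)
      also have "\<Lambda> * (2 * (?y powr \<alpha> * ?y powr (1 - \<alpha>))) * norm (u a) \<le>
          \<Lambda> * (2 * (?y powr \<alpha> * 2)) * norm (u a)"
      proof -
        have "?y powr (1 - \<alpha>) \<le> 2 powr (1 - \<alpha>)" using y alpha by (intro powr_mono2) auto
        also have "\<dots> \<le> 2" using powr_mono[of "1 - \<alpha>" 1 2] alpha by simp
        finally show ?thesis using Lip_nonneg by (intro mult_right_mono mult_left_mono) auto
      qed
      finally have 2: "norm ((A \<zeta> - A \<sigma>) (u a)) \<le> 4 * \<Lambda> * norm (u a) * ?y powr \<alpha>"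
        by (simp add: mult_ac)
      have "norm (f \<zeta> - f \<sigma> + (A \<zeta> - A \<sigma>) (u a)) \<le> (2 * M + 4 * \<Lambda> * norm (u a)) * ?y powr \<alpha>"
        using norm_triangle_ineq[of "f \<zeta> - f \<sigma>" "(A \<zeta> - A \<sigma>) (u a)"] 1 2 by (simp add: algebra_simps)
      also have "\<dots> \<le> N * ?y powr \<alpha>"
        unfolding N_def using M Lip_nonneg
        by (intro mult_right_mono) (auto simp: algebra_simps)
      finally show "norm (f \<zeta> - f \<sigma> + (A \<zeta> - A \<sigma>) (u a)) \<le> N * ?y powr \<alpha>" .
    qed (use alpha a \<sigma> a\<sigma> u F eq in auto)
    have d: "1 - cmod a \<le> \<delta>" "\<delta> \<le> 2 * (1 - cmod a)" "0 < 1 - cmod a"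
    proof -
      have "\<delta> = (1 + cmod a) * (1 - cmod a)" by (simp add: \<delta>_def power2_eq_square algebra_simps)
      thus "1 - cmod a \<le> \<delta>" "\<delta> \<le> 2 * (1 - cmod a)"
        using a mult_right_mono[of 1 "1 + cmod a" "1 - cmod a"] mult_right_mono[of "1 + cmod a" 2 "1 - cmod a"]
        by auto
    qed (use a in auto)
    have "k1 = K1" "k3 = K3"
      by (simp_all add: k1_def k3_def K1_def K3_def)
    note KE = this[symmetric]
    have "cmod (deriv (\<lambda>z. u z $ i) a) \<le> (1 + k3 / (2 * \<epsilon>\<^sup>2)) * N * \<delta> powr (\<alpha> - 1)"
      using deriv_bound[of i] unfolding KE .
    also have "\<dots> \<le> (1 + k3 / (2 * \<epsilon>\<^sup>2)) * N * (1 - cmod a) powr (\<alpha> - 1)"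
      using N ec d alpha by (intro mult_left_mono powr_mono2') auto
    also have "(1 + k3 / (2 * \<epsilon>\<^sup>2)) * N = ((2 + 4 * \<Lambda>) * (1 + k3 / (2 * \<epsilon>\<^sup>2))) * (M + norm (u a))"
      by (simp add: N_def)
    also have "\<dots> * (1 - cmod a) powr (\<alpha> - 1) \<le> K * (M + norm (u a)) * (1 - cmod a) powr (\<alpha> - 1)"
      using KK(1) MN by (intro mult_right_mono) auto
    finally have r1: "cmod (deriv (\<lambda>z. u z $ i) a) \<le> K * (M + norm (u a)) * (1 - cmod a) powr (\<alpha> - 1)" .
    have "norm (F a - (f \<sigma> + A \<sigma> (u a))) \<le> k1 * N * \<delta> powr \<alpha>"
      using boundary_value unfolding KE \<kappa>_def .
    also have "\<dots> \<le> k1 * N * (2 * (1 - cmod a) powr \<alpha>)"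
    proof (rule mult_left_mono)
      have "\<delta> powr \<alpha> \<le> (2 * (1 - cmod a)) powr \<alpha>"
        using d delta_pos alpha by (intro powr_mono2) auto
      also have "\<dots> \<le> 2 * (1 - cmod a) powr \<alpha>"
        using powr_mono[of \<alpha> 1 2] alpha d powr_mult[of 2 "1 - cmod a" \<alpha>] by (simp only: mult_right_mono) simp
      finally show "\<delta> powr \<alpha> \<le> 2 * (1 - cmod a) powr \<alpha>" .
    qed (use k13 N in auto)
    also have "\<dots> = ((2 + 4 * \<Lambda>) * (2 * k1)) * (M + norm (u a)) * (1 - cmod a) powr \<alpha>"
      by (simp add: N_def)
    also have "\<dots> \<le> K * (M + norm (u a)) * (1 - cmod a) powr \<alpha>"
      using KK(2) MN by (intro mult_right_mono) auto
    finally show ?thesis using r1 by blast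
  qed
  show ?thesis
    by (rule that[OF Kpos]) (use main in blast)+
qed

end

text \<open>Gronwall's inequality in differential form: the second term of \<open>q\<close> is an
  antiderivative that compensates the singular growth rate, which is integrable up to the circle.
  The logarithm of \<open>M\<^sup>2\<close> plus a squared norm is used because it stays smooth
  where \<open>u\<close> vanishes.\<close>

lemma gronwall_radial:
  fixes u :: "complex \<Rightarrow> complex ^ 'n" and K M \<alpha> :: real
  assumes u: "disc_alg_vec u" and M: "0 < M" and K: "0 \<le> K" and alpha: "0 < \<alpha>"
    and der: "\<And>a i. a \<in> ball 0 1 \<Longrightarrow> cmod (deriv (\<lambda>z. u z $ i) a) \<le> K * (M + norm (u a)) * (1 - cmod a) powr (\<alpha> - 1)"
    and a: "a \<in> ball 0 1"
  shows "norm (u a) \<le> exp (2 * real CARD('n) * K / \<alpha>) * (M + norm (u 0))"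
proof -
  define n where "n = real CARD('n)"
  \<comment> \<open>The factor \<open>n\<close> passes from components to the norm, one 2 is from
    differentiating the square, and the other from \<open>x * (M + x)\<close> being at most
    \<open>2 * (M\<^sup>2 + x\<^sup>2)\<close>.\<close>
  define C where "C = 4 * n * K"
  define p where "p t = u (of_real t * a)" for t :: real
  define v where "v t = (\<chi> i. a * deriv (\<lambda>z. u z $ i) (of_real t * a))" for t :: real
  define q where "q t = ln (M\<^sup>2 + p t \<bullet> p t) + (C/\<alpha>) * (1 - t * cmod a) powr \<alpha>" for t
  have in_ball: "of_real t * a \<in> ball 0 1" "0 < 1 - t * cmod a" if "0 \<le> t" "t \<le> 1" for t
  proof -
    have "t * cmod a \<le> 1 * cmod a" using that by (intro mult_right_mono) auto
    thus "of_real t * a \<in> ball 0 1" "0 < 1 - t * cmod a" using a that by (auto simp: norm_mult)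
  qed
  have dp: "(p has_vector_derivative v t) (at t)" if t: "0 \<le> t" "t \<le> 1" for t
  proof (rule has_vector_derivative_vec)
    fix i
    have "((\<lambda>s. of_real s * a) has_vector_derivative a) (at t)"
      by (auto intro!: derivative_eq_intros)
    moreover have "((\<lambda>z. u z $ i) has_field_derivative deriv (\<lambda>z. u z $ i) (of_real t * a)) (at (of_real t * a))"
      by (rule holomorphic_derivI[OF disc_alg_holo[OF disc_alg_vec_nth[OF u]] open_ball in_ball(1)[OF t]])
    ultimately have "((\<lambda>z. u z $ i) \<circ> (\<lambda>s. of_real s * a) has_vector_derivative a * deriv (\<lambda>z. u z $ i) (of_real t * a)) (at t)"
      by (rule field_vector_diff_chain_at)
    thus "((\<lambda>t. p t $ i) has_vector_derivative v t $ i) (at t)"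
      by (simp add: p_def v_def o_def)
  qed
  have vb: "norm (v t) \<le> n * (cmod a * (K * (M + norm (p t)) * (1 - t * cmod a) powr (\<alpha> - 1)))"
    if t: "0 \<le> t" "t \<le> 1" for t
  proof -
    have "norm (v t) \<le> (\<Sum>i\<in>UNIV. cmod (v t $ i))"
      unfolding norm_vec_def by (rule L2_set_le_sum) simp
    also have "\<dots> \<le> (\<Sum>i\<in>(UNIV::'n set). cmod a * (K * (M + norm (p t)) * (1 - t * cmod a) powr (\<alpha> - 1)))"
    proof (rule sum_mono)
      fix i
      show "cmod (v t $ i) \<le> cmod a * (K * (M + norm (p t)) * (1 - t * cmod a) powr (\<alpha> - 1))"
        using der[OF in_ball(1)[OF t], of i] t
        by (auto simp: v_def norm_mult p_def intro!: mult_left_mono)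
    qed
    finally show ?thesis by (simp add: n_def)
  qed
  have "q 1 \<le> q 0"
  proof (rule DERIV_nonpos_imp_nonincreasing[of 0 1 q])
    fix t :: real assume t: "0 \<le> t" "t \<le> 1"
    let ?b = "cmod a * (1 - t * cmod a) powr (\<alpha> - 1)"
    have pos: "0 < M\<^sup>2 + p t \<bullet> p t" using M by (simp add: add_pos_nonneg)
    have "((\<lambda>t. p t \<bullet> p t) has_vector_derivative (p t \<bullet> v t + v t \<bullet> p t)) (at t)"
      by (rule bounded_bilinear.has_vector_derivative[OF bounded_bilinear_inner dp[OF t] dp[OF t]])
    hence "((\<lambda>t. p t \<bullet> p t) has_real_derivative 2 * (p t \<bullet> v t)) (at t)"
      by (simp add: has_real_derivative_iff_has_vector_derivative inner_commute)
    hence "(q has_real_derivative (2 * (p t \<bullet> v t)) / (M\<^sup>2 + p t \<bullet> p t)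
       + (C/\<alpha>) * (\<alpha> * (1 - t * cmod a) powr (\<alpha> - 1) * (- cmod a))) (at t)"
      unfolding q_def using pos in_ball(2)[OF t] by (auto intro!: derivative_eq_intros)
    moreover have "(2 * (p t \<bullet> v t)) / (M\<^sup>2 + p t \<bullet> p t) \<le> C * ?b"
    proof -
      have "p t \<bullet> v t \<le> norm (p t) * norm (v t)" by (rule norm_cauchy_schwarz)
      also have "\<dots> \<le> norm (p t) * (n * (K * (M + norm (p t)) * ?b))"
        using vb[OF t] by (intro mult_left_mono) (simp_all add: mult_ac)
      also have "\<dots> = (n * K * ?b) * (norm (p t) * (M + norm (p t)))" by (simp add: mult_ac)
      also have "\<dots> \<le> (n * K * ?b) * (2 * (M\<^sup>2 + (norm (p t))\<^sup>2))"
      proof (rule mult_left_mono)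
        have "2 * (M\<^sup>2 + x\<^sup>2) - x * (M + x) = 3/2 * M\<^sup>2 + x\<^sup>2 / 2 + (M - x)\<^sup>2 / 2" for x
          by (simp add: power2_eq_square field_simps)
        moreover have "0 \<le> 3/2 * M\<^sup>2 + x\<^sup>2 / 2 + (M - x)\<^sup>2 / 2" for x by simp
        ultimately show "norm (p t) * (M + norm (p t)) \<le> 2 * (M\<^sup>2 + (norm (p t))\<^sup>2)"
          by (metis diff_ge_0_iff_ge)
      qed (use K in \<open>simp add: n_def\<close>)
      finally have "2 * (p t \<bullet> v t) \<le> C * ?b * (M\<^sup>2 + p t \<bullet> p t)"
        by (simp add: C_def power2_norm_eq_inner algebra_simps)
      thus ?thesis using pos by (simp add: field_simps)
    qed
    moreover have "(C/\<alpha>) * (\<alpha> * (1 - t * cmod a) powr (\<alpha> - 1) * (- cmod a)) = - (C * ?b)"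
      using alpha by simp
    ultimately show "\<exists>y. (q has_real_derivative y) (at t) \<and> y \<le> 0"
      by (smt (verit))
  qed simp
  moreover have "0 \<le> (C/\<alpha>) * (1 - 1 * cmod a) powr \<alpha>" using K alpha by (simp add: C_def n_def)
  ultimately have "ln (M\<^sup>2 + p 1 \<bullet> p 1) \<le> ln (M\<^sup>2 + p 0 \<bullet> p 0) + C/\<alpha>"
    by (simp add: q_def)
  hence "ln (M\<^sup>2 + (norm (u a))\<^sup>2) \<le> ln (M\<^sup>2 + (norm (u 0))\<^sup>2) + C/\<alpha>"
    by (simp add: p_def power2_norm_eq_inner)
  hence "M\<^sup>2 + (norm (u a))\<^sup>2 \<le> (M\<^sup>2 + (norm (u 0))\<^sup>2) * exp (C/\<alpha>)"
    using M by (metis (no_types, opaque_lifting) add_pos_nonneg exp_add exp_le_cancel_iff exp_ln zero_le_power2 zero_less_power)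
  also have "\<dots> \<le> (M + norm (u 0))\<^sup>2 * exp (C/\<alpha>)"
    using M by (intro mult_right_mono) (auto simp: power2_sum)
  also have "\<dots> = (exp (C/(2*\<alpha>)) * (M + norm (u 0)))\<^sup>2"
  proof -
    have "C/\<alpha> = C/(2*\<alpha>) + C/(2*\<alpha>)" using alpha by simp
    hence "exp (C/\<alpha>) = (exp (C/(2*\<alpha>)))\<^sup>2" by (metis exp_add power2_eq_square)
    thus ?thesis by (simp add: power_mult_distrib mult.commute)
  qed
  finally have "(norm (u a))\<^sup>2 \<le> (exp (C/(2*\<alpha>)) * (M + norm (u 0)))\<^sup>2"
    using zero_le_power2[of M] by linarith
  hence "norm (u a) \<le> exp (C/(2*\<alpha>)) * (M + norm (u 0))"
    by (rule power2_le_imp_le) (use M in auto)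
  thus ?thesis by (simp add: C_def n_def mult_ac)
qed

text \<open>Along the ray the derivative is dominated by that of \<open>\<phi>\<close>, because
  \<open>cmod z\<close> is at most 1; the increment of \<open>\<phi>\<close> is the right-hand
  side.\<close>

lemma hardy_littlewood_radial:
  assumes v: "v holomorphic_on ball 0 1" and alpha: "0 < \<alpha>" "\<alpha> \<le> 1" and K: "0 \<le> K"
    and der: "\<And>a. a \<in> ball 0 1 \<Longrightarrow> cmod (deriv v a) \<le> K * (1 - cmod a) powr (\<alpha> - 1)"
    and z: "z \<in> ball 0 1" and s: "0 \<le> s" "s < 1"
  shows "cmod (v z - v (of_real s * z)) \<le> K / \<alpha> * (1 - s) powr \<alpha>"
proof -
  define \<phi> where "\<phi> t = - (K / \<alpha>) * (1 - t) powr \<alpha>" for t :: real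
  define p where "p t = v (of_real t * z)" for t :: real
  have in_ball: "of_real t * z \<in> ball 0 1" "t * cmod z \<le> t" if "0 \<le> t" "t \<le> 1" for t
  proof -
    have "t * cmod z \<le> 1 * cmod z" using that by (intro mult_right_mono) auto
    thus "of_real t * z \<in> ball 0 1" using z that by (auto simp: norm_mult)
    show "t * cmod z \<le> t" using z that by (simp add: mult_left_le)
  qed
  have dp: "(p has_vector_derivative z * deriv v (of_real t * z)) (at t)" if t: "0 \<le> t" "t \<le> 1" for t
  proof -
    have "((\<lambda>s. of_real s * z) has_vector_derivative z) (at t)"
      by (auto intro!: derivative_eq_intros)
    moreover have "(v has_field_derivative deriv v (of_real t * z)) (at (of_real t * z))"
      by (rule holomorphic_derivI[OF v open_ball in_ball(1)[OF t]])
    ultimately have "(v \<circ> (\<lambda>s. of_real s * z) has_vector_derivative z * deriv v (of_real t * z)) (at t)"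
      by (rule field_vector_diff_chain_at)
    thus ?thesis by (simp add: p_def[abs_def] o_def)
  qed
  have "norm (p 1 - p s) \<le> \<phi> 1 - \<phi> s"
  proof (rule differentiable_bound_general[where f' = "\<lambda>t. z * deriv v (of_real t * z)" and \<phi>' = "\<lambda>t. K * (1 - t) powr (\<alpha> - 1)"])
    show "continuous_on {s..1} p"
    proof (intro continuous_at_imp_continuous_on ballI)
      fix x assume "x \<in> {s..1}"
      thus "isCont p x" using s by (intro has_vector_derivative_continuous[OF dp]) auto
    qed
    show "continuous_on {s..1} \<phi>"
      unfolding \<phi>_def using alpha by (intro continuous_on_mult continuous_on_powr' continuous_intros) auto
    fix t assume t: "s < t" "t < 1"
    show "(p has_vector_derivative z * deriv v (of_real t * z)) (at t)" using dp t s by simp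
    show "(\<phi> has_vector_derivative K * (1 - t) powr (\<alpha> - 1)) (at t)"
      unfolding \<phi>_def has_real_derivative_iff_has_vector_derivative[symmetric]
      using t alpha by (auto intro!: derivative_eq_intros)
    have "cmod (z * deriv v (of_real t * z)) \<le> 1 * (K * (1 - cmod (of_real t * z)) powr (\<alpha> - 1))"
      unfolding norm_mult[of z] using der[OF in_ball(1)[of t]] t s z by (intro mult_mono) auto
    also have "\<dots> \<le> K * (1 - t) powr (\<alpha> - 1)"
      using in_ball(2)[of t] t s alpha K by (auto simp: norm_mult intro!: mult_left_mono powr_mono2')
    finally show "norm (z * deriv v (of_real t * z)) \<le> K * (1 - t) powr (\<alpha> - 1)" .
  qed (use s in auto)
  thus ?thesis using alpha by (simp add: p_def \<phi>_def)
qed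

text \<open>Both points are shrunk by the factor \<open>s = 1 - d\<close>. In the disc of radius
  \<open>s\<close> the derivative is at most \<open>K * d powr (\<alpha> - 1)\<close>, so the middle
  step costs \<open>K * d powr \<alpha>\<close>; the two radial steps cost
  \<open>1 / \<alpha>\<close> times that each. For \<open>d\<close> at least 1 a comparison with the
  value at 0 is enough.\<close>

lemma hardy_littlewood:
  assumes v: "v holomorphic_on ball 0 1" and alpha: "0 < \<alpha>" "\<alpha> \<le> 1" and K: "0 \<le> K"
    and der: "\<And>a. a \<in> ball 0 1 \<Longrightarrow> cmod (deriv v a) \<le> K * (1 - cmod a) powr (\<alpha> - 1)"
    and z: "z \<in> ball 0 1" and w: "w \<in> ball 0 1"
  shows "cmod (v z - v w) \<le> (2 / \<alpha> + 1) * K * cmod (z - w) powr \<alpha>"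
proof -
  define d where "d = cmod (z - w)"
  note rad = hardy_littlewood_radial[OF v alpha K der]
  consider "d = 0" | "0 < d" "d < 1" | "1 \<le> d" unfolding d_def by fastforce
  thus ?thesis
  proof cases
    case 1
    thus ?thesis by (simp add: d_def)
  next
    case 2
    define s where "s = 1 - d"
    have s: "0 < s" "s < 1" using 2 by (auto simp: s_def)
    have "cmod (v (of_real s * z) - v (of_real s * w)) \<le> K * d powr (\<alpha> - 1) * cmod (of_real s * z - of_real s * w)"
    proof (rule field_differentiable_bound[of "cball 0 s" v "deriv v"])
      fix x :: complex assume x: "x \<in> cball 0 s"
      hence xb: "x \<in> ball 0 1" using s by auto
      show "(v has_field_derivative deriv v x) (at x within cball 0 s)"
        using holomorphic_derivI[OF v open_ball xb] by (rule has_field_derivative_at_within)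
      have "cmod (deriv v x) \<le> K * (1 - cmod x) powr (\<alpha> - 1)" by (rule der[OF xb])
      also have "\<dots> \<le> K * d powr (\<alpha> - 1)"
        using x xb alpha K 2 by (intro mult_left_mono powr_mono2') (auto simp: s_def)
      finally show "cmod (deriv v x) \<le> K * d powr (\<alpha> - 1)" .
    qed (use s z w in \<open>auto simp: norm_mult mult_left_le\<close>)
    also have "cmod (of_real s * z - of_real s * w) = s * d"
      using s by (simp add: d_def norm_mult flip: right_diff_distrib)
    also have "K * d powr (\<alpha> - 1) * (s * d) \<le> K * d powr (\<alpha> - 1) * (1 * d)"
      using s 2 K by (intro mult_left_mono mult_right_mono) auto
    also have "\<dots> = K * d powr \<alpha>" using 2 by (simp add: powr_diff)
    finally have "cmod (v (of_real s * z) - v (of_real s * w)) \<le> K * d powr \<alpha>" .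
    moreover have "cmod (v z - v (of_real s * z)) \<le> K / \<alpha> * d powr \<alpha>"
      "cmod (v w - v (of_real s * w)) \<le> K / \<alpha> * d powr \<alpha>"
      using rad[OF _ z, of s] rad[OF _ w, of s] s by (auto simp: s_def)
    moreover have "cmod (v z - v w) \<le> cmod (v z - v (of_real s * z)) +
        cmod (v (of_real s * z) - v (of_real s * w)) + cmod (v w - v (of_real s * w))"
    proof -
      have "v z - v w = (v z - v (of_real s * z)) + (v (of_real s * z) - v (of_real s * w))
          - (v w - v (of_real s * w))" by simp
      thus ?thesis by (metis (no_types, lifting) norm_triangle_ineq norm_triangle_ineq4 add_right_mono order_trans)
    qed
    moreover have "(2 / \<alpha> + 1) * K * d powr \<alpha> = K / \<alpha> * d powr \<alpha> + K * d powr \<alpha> + K / \<alpha> * d powr \<alpha>"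
      by (simp add: algebra_simps add_divide_distrib)
    ultimately show ?thesis unfolding d_def by linarith
  next
    case 3
    have "cmod (v z - v 0) \<le> K / \<alpha>" "cmod (v w - v 0) \<le> K / \<alpha>"
      using rad[OF _ z, of 0] rad[OF _ w, of 0] by auto
    hence "cmod (v z - v w) \<le> 2 / \<alpha> * K * 1"
      using norm_triangle_ineq4[of "v z - v 0" "v w - v 0"] by simp
    also have "\<dots> \<le> (2 / \<alpha> + 1) * K * d powr \<alpha>"
      using 3 alpha K by (intro mult_mono) (auto simp: ge_one_powr_ge_zero)
    finally show ?thesis by (simp add: d_def)
  qed
qed

section \<open>Hoelder spaces on the circle\<close>

lemma has_vector_derivative_cis_at: "(cis has_vector_derivative \<i> * cis t) (at t)"
proof -
  have "((\<lambda>t. \<i> * of_real t) has_vector_derivative \<i>) (at t)"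
    by (auto intro!: derivative_eq_intros)
  moreover have "(exp has_field_derivative exp (\<i> * of_real t)) (at (\<i> * of_real t))"
    by (rule DERIV_exp)
  ultimately have "(exp \<circ> (\<lambda>t. \<i> * of_real t) has_vector_derivative \<i> * exp (\<i> * of_real t)) (at t)"
    by (rule field_vector_diff_chain_at)
  moreover have "exp \<circ> (\<lambda>t. \<i> * of_real t) = cis"
    by (rule ext) (simp add: cis_conv_exp)
  ultimately show ?thesis by (simp add: cis_conv_exp)
qed

lemma dist_cis_le: "cmod (cis s - cis t) \<le> \<bar>s - t\<bar>"
proof -
  have "cmod (cis s - cis t) \<le> 1 * norm (s - t)"
  proof (rule differentiable_bound[of UNIV cis "\<lambda>x h. h *\<^sub>R (\<i> * cis x)"])
    fix x :: real
    show "(cis has_derivative (\<lambda>h. h *\<^sub>R (\<i> * cis x))) (at x within UNIV)"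
      using has_vector_derivative_cis_at[of x] by (simp add: has_vector_derivative_def)
    show "onorm (\<lambda>h. h *\<^sub>R (\<i> * cis x)) \<le> 1"
      by (rule onorm_le) (simp add: norm_mult)
  qed auto
  thus ?thesis by simp
qed

text \<open>The angles are chosen through the principal argument of the quotient, so that nearby
  points get nearby angles. Close to 1 the logarithm has Lipschitz constant 2; at chord length above
  \<open>1/2\<close> the bound \<open>pi < 4\<close> gives the factor 8.\<close>

lemma arc_chord:
  assumes "\<zeta> \<in> sphere 0 1" "\<eta> \<in> sphere 0 1"
  obtains s t where "\<zeta> = cis s" "\<eta> = cis t" "\<bar>s - t\<bar> \<le> 8 * cmod (\<zeta> - \<eta>)"
proof -
  define w where "w = \<zeta> / \<eta>"
  have n: "cmod \<zeta> = 1" "cmod \<eta> = 1" "\<eta> \<noteq> 0" using assms by auto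
  have w: "cmod w = 1" using n by (simp add: w_def norm_divide)
  hence w0: "w \<noteq> 0" by auto
  define \<theta> where "\<theta> = Arg w"
  have cw: "w = cis \<theta>" unfolding \<theta>_def using cis_Arg[OF w0] w by (simp add: sgn_eq)
  have ch: "cmod (\<zeta> - \<eta>) = cmod (w - 1)"
  proof -
    have "\<zeta> - \<eta> = \<eta> * (w - 1)" using n by (simp add: w_def algebra_simps)
    thus ?thesis using n by (simp add: norm_mult)
  qed
  have "\<bar>\<theta>\<bar> \<le> 8 * cmod (w - 1)"
  proof (cases "cmod (w - 1) \<le> 1/2")
    case True
    have "cmod (Ln w - Ln 1) \<le> 2 * cmod (w - 1)"
    proof (rule field_differentiable_bound[of "cball 1 (1/2)" Ln "\<lambda>x. 1/x"])
      fix x :: complex assume x: "x \<in> cball 1 (1/2)"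
      hence x': "cmod (1 - x) \<le> 1/2" by (simp add: dist_norm)
      have "1/2 \<le> cmod x" using norm_triangle_ineq[of "1 - x" x] x' by simp
      thus "cmod (1/x) \<le> 2" by (cases "x = 0") (simp_all add: norm_divide field_simps)
      have "\<bar>Re (1 - x)\<bar> \<le> 1/2" using abs_Re_le_cmod[of "1 - x"] x' by linarith
      hence "x \<notin> \<real>\<^sub>\<le>\<^sub>0" by (auto simp: complex_nonpos_Reals_iff abs_if split: if_splits)
      thus "(Ln has_field_derivative 1/x) (at x within cball 1 (1/2))"
        by (auto intro!: derivative_eq_intros simp: inverse_eq_divide)
    qed (use True in \<open>auto simp: dist_norm norm_minus_commute\<close>)
    moreover have "\<bar>\<theta>\<bar> \<le> cmod (Ln w)"
      using abs_Im_le_cmod[of "Ln w"] by (simp add: \<theta>_def Arg_def w0)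
    ultimately show ?thesis by simp
  next
    case False
    have "\<bar>\<theta>\<bar> \<le> pi" unfolding \<theta>_def using Arg_bounded[of w] by (simp add: abs_if)
    also have "\<dots> < 4" by (rule pi_less_4)
    finally show ?thesis using False by simp
  qed
  moreover have "\<eta> = cis (Arg \<eta>)" using cis_Arg[OF n(3)] n by (simp add: sgn_eq)
  moreover from this have "\<zeta> = cis (Arg \<eta> + \<theta>)"
    using n cw by (simp add: w_def cis_mult[symmetric] field_simps)
  ultimately show ?thesis using that[of "Arg \<eta> + \<theta>" "Arg \<eta>"] ch by simp
qed

lemma vector_derivative_bound:
  fixes f :: "real \<Rightarrow> 'a::real_normed_vector"
  assumes der: "\<And>x. (f has_vector_derivative f' x) (at x)" and B: "\<And>x. norm (f' x) \<le> B"
  shows "norm (f s - f t) \<le> B * \<bar>s - t\<bar>"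
proof -
  have "norm (f s - f t) \<le> B * norm (s - t)"
  proof (rule differentiable_bound[of UNIV f "\<lambda>x h. h *\<^sub>R f' x"])
    fix x :: real
    show "(f has_derivative (\<lambda>h. h *\<^sub>R f' x)) (at x within UNIV)"
      using der[of x] by (simp add: has_vector_derivative_def)
    show "onorm (\<lambda>h. h *\<^sub>R f' x) \<le> B"
      by (rule onorm_le) (use B[of x] in \<open>simp add: mult.commute[of B] mult_left_mono\<close>)
  qed auto
  thus ?thesis by simp
qed

lemma holder_circle_0:
  "holder_circle 0 \<alpha> F \<longleftrightarrow> (\<exists>C. \<forall>s t. norm (F (cis s) - F (cis t)) \<le> C * \<bar>s - t\<bar> powr \<alpha>)"
proof
  assume "holder_circle 0 \<alpha> F"
  thus "\<exists>C. \<forall>s t. norm (F (cis s) - F (cis t)) \<le> C * \<bar>s - t\<bar> powr \<alpha>"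
    unfolding holder_circle_def by (metis)
next
  assume "\<exists>C. \<forall>s t. norm (F (cis s) - F (cis t)) \<le> C * \<bar>s - t\<bar> powr \<alpha>"
  thus "holder_circle 0 \<alpha> F"
    unfolding holder_circle_def by (intro exI[of _ "\<lambda>_ \<theta>. F (cis \<theta>)"]) auto
qed

lemma holder_circle_Suc:
  "holder_circle (Suc k) \<alpha> F \<longleftrightarrow>
     (\<exists>F1. holder_circle k \<alpha> F1 \<and> (\<forall>\<theta>. ((\<lambda>t. F (cis t)) has_vector_derivative F1 (cis \<theta>)) (at \<theta>)))"
proof
  assume "holder_circle (Suc k) \<alpha> F"
  then obtain D where D0: "\<And>\<theta>. D 0 \<theta> = F (cis \<theta>)"
    and DS: "\<And>j \<theta>. j < Suc k \<Longrightarrow> (D j has_vector_derivative D (Suc j) \<theta>) (at \<theta>)"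
    and DC: "\<exists>C. \<forall>s t. norm (D (Suc k) s - D (Suc k) t) \<le> C * \<bar>s - t\<bar> powr \<alpha>"
    unfolding holder_circle_def by blast
  have D0f: "D 0 = (\<lambda>t. F (cis t))" by (rule ext) (rule D0)
  define F1 where "F1 \<zeta> = D 1 (Arg \<zeta>)" for \<zeta>
  have D1: "D 1 \<theta> = F1 (cis \<theta>)" for \<theta>
  proof -
    define c where "c = Arg (cis \<theta>) - \<theta>"
    have "cis (Arg (cis \<theta>)) = cis \<theta>" using cis_Arg[of "cis \<theta>"] by (simp add: sgn_eq)
    hence cc: "cis c = 1" by (simp add: c_def flip: cis_divide)
    have "(D 0 has_vector_derivative D (Suc 0) (\<theta> + c)) (at (\<theta> + c))" by (rule DS) simp
    hence "(D 0 \<circ> (\<lambda>t. t + c) has_vector_derivative 1 *\<^sub>R D (Suc 0) (\<theta> + c)) (at \<theta>)"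
      by (intro vector_diff_chain_at) (auto intro!: derivative_eq_intros)
    moreover have "D 0 \<circ> (\<lambda>t. t + c) = D 0"
      by (simp add: D0f o_def cc flip: cis_mult)
    ultimately have "(D 0 has_vector_derivative D 1 (\<theta> + c)) (at \<theta>)" by simp
    moreover have "(D 0 has_vector_derivative D 1 \<theta>) (at \<theta>)" using DS[of 0 \<theta>] by simp
    ultimately have "D 1 (\<theta> + c) = D 1 \<theta>" by (rule vector_derivative_unique_at)
    thus ?thesis by (simp add: F1_def c_def)
  qed
  have "holder_circle k \<alpha> F1"
    unfolding holder_circle_def
    by (intro exI[of _ "\<lambda>j. D (Suc j)"]) (use D1 DS DC in auto)
  moreover have "((\<lambda>t. F (cis t)) has_vector_derivative F1 (cis \<theta>)) (at \<theta>)" for \<theta>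
    using DS[of 0 \<theta>] D1[of \<theta>] by (simp add: D0f)
  ultimately show "\<exists>F1. holder_circle k \<alpha> F1 \<and> (\<forall>\<theta>. ((\<lambda>t. F (cis t)) has_vector_derivative F1 (cis \<theta>)) (at \<theta>))"
    by blast
next
  assume "\<exists>F1. holder_circle k \<alpha> F1 \<and> (\<forall>\<theta>. ((\<lambda>t. F (cis t)) has_vector_derivative F1 (cis \<theta>)) (at \<theta>))"
  then obtain F1 D where D0: "\<And>\<theta>. D 0 \<theta> = F1 (cis \<theta>)"
    and DS: "\<And>j \<theta>. j < k \<Longrightarrow> (D j has_vector_derivative D (Suc j) \<theta>) (at \<theta>)"
    and DC: "\<exists>C. \<forall>s t. norm (D k s - D k t) \<le> C * \<bar>s - t\<bar> powr \<alpha>"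
    and F: "\<And>\<theta>. ((\<lambda>t. F (cis t)) has_vector_derivative F1 (cis \<theta>)) (at \<theta>)"
    unfolding holder_circle_def by blast
  show "holder_circle (Suc k) \<alpha> F"
    unfolding holder_circle_def
  proof (rule exI[of _ "\<lambda>j. case j of 0 \<Rightarrow> (\<lambda>t. F (cis t)) | Suc i \<Rightarrow> D i"], intro conjI allI impI)
    fix j \<theta> assume "j < Suc k"
    thus "((case j of 0 \<Rightarrow> \<lambda>t. F (cis t) | Suc i \<Rightarrow> D i) has_vector_derivative
        (case Suc j of 0 \<Rightarrow> \<lambda>t. F (cis t) | Suc i \<Rightarrow> D i) \<theta>) (at \<theta>)"
      using F DS D0 by (cases j) auto
  qed (use DC in auto)
qed

lemma holder_circle_SucE:
  assumes "holder_circle (Suc k) \<alpha> F"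
  obtains F1 where "holder_circle k \<alpha> F1" "\<And>\<theta>. ((\<lambda>t. F (cis t)) has_vector_derivative F1 (cis \<theta>)) (at \<theta>)"
  using assms holder_circle_Suc by blast

lemma holder_circle_SucI:
  "holder_circle k \<alpha> F1 \<Longrightarrow> (\<And>\<theta>. ((\<lambda>t. F (cis t)) has_vector_derivative F1 (cis \<theta>)) (at \<theta>)) \<Longrightarrow>
   holder_circle (Suc k) \<alpha> F"
  using holder_circle_Suc by blast

lemma holder_circle_0I:
  assumes alpha: "0 \<le> \<alpha>" and C: "0 \<le> C"
    and hol: "\<And>\<zeta> \<eta>. \<zeta> \<in> sphere 0 1 \<Longrightarrow> \<eta> \<in> sphere 0 1 \<Longrightarrow> norm (F \<zeta> - F \<eta>) \<le> C * cmod (\<zeta> - \<eta>) powr \<alpha>"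
  shows "holder_circle 0 \<alpha> F"
  unfolding holder_circle_0
proof (intro exI allI)
  fix s t
  have "norm (F (cis s) - F (cis t)) \<le> C * cmod (cis s - cis t) powr \<alpha>" by (rule hol) auto
  also have "\<dots> \<le> C * \<bar>s - t\<bar> powr \<alpha>"
    using alpha C by (intro mult_left_mono powr_mono2 dist_cis_le) auto
  finally show "norm (F (cis s) - F (cis t)) \<le> C * \<bar>s - t\<bar> powr \<alpha>" .
qed

lemma chord_holder:
  assumes alpha: "0 \<le> \<alpha>"
    and hol: "\<And>s t. norm (F (cis s) - F (cis t)) \<le> C * \<bar>s - t\<bar> powr \<alpha>"
    and "\<zeta> \<in> sphere 0 1" "\<eta> \<in> sphere 0 1"
  shows "norm (F \<zeta> - F \<eta>) \<le> C * 8 powr \<alpha> * cmod (\<zeta> - \<eta>) powr \<alpha>"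
proof -
  have "0 \<le> norm (F (cis 0) - F (cis 1))" by simp
  also have "\<dots> \<le> C" using hol[of 0 1] by simp
  finally have C: "0 \<le> C" .
  obtain s t where st: "\<zeta> = cis s" "\<eta> = cis t" "\<bar>s - t\<bar> \<le> 8 * cmod (\<zeta> - \<eta>)"
    using arc_chord assms by metis
  have "norm (F \<zeta> - F \<eta>) \<le> C * \<bar>s - t\<bar> powr \<alpha>" using hol st by simp
  also have "\<dots> \<le> C * (8 * cmod (\<zeta> - \<eta>)) powr \<alpha>"
    using C alpha st by (intro mult_left_mono powr_mono2) auto
  finally show ?thesis by (simp add: powr_mult)
qed

lemma holder_circle_0E:
  assumes "holder_circle 0 \<alpha> F" "0 \<le> \<alpha>"
  obtains C where "0 < C"
    "\<And>\<zeta> \<eta>. \<zeta> \<in> sphere 0 1 \<Longrightarrow> \<eta> \<in> sphere 0 1 \<Longrightarrow> norm (F \<zeta> - F \<eta>) \<le> C * cmod (\<zeta> - \<eta>) powr \<alpha>"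
proof -
  obtain C where C: "\<And>s t. norm (F (cis s) - F (cis t)) \<le> C * \<bar>s - t\<bar> powr \<alpha>"
    using assms(1) holder_circle_0 by blast
  show ?thesis
  proof (rule that[of "\<bar>C * 8 powr \<alpha>\<bar> + 1"])
    fix \<zeta> \<eta> :: complex assume "\<zeta> \<in> sphere 0 1" "\<eta> \<in> sphere 0 1"
    hence "norm (F \<zeta> - F \<eta>) \<le> C * 8 powr \<alpha> * cmod (\<zeta> - \<eta>) powr \<alpha>"
      using chord_holder[of \<alpha> F C] C assms by blast
    also have "\<dots> \<le> (\<bar>C * 8 powr \<alpha>\<bar> + 1) * cmod (\<zeta> - \<eta>) powr \<alpha>"
      by (intro mult_right_mono) auto
    finally show "norm (F \<zeta> - F \<eta>) \<le> (\<bar>C * 8 powr \<alpha>\<bar> + 1) * cmod (\<zeta> - \<eta>) powr \<alpha>" .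
  qed simp
qed

lemma continuous_on_circleI:
  assumes "\<And>\<zeta> \<eta>. \<zeta> \<in> sphere 0 1 \<Longrightarrow> \<eta> \<in> sphere 0 1 \<Longrightarrow> norm (F \<zeta> - F \<eta>) \<le> C * cmod (\<zeta> - \<eta>) powr \<alpha>"
    and "0 < \<alpha>"
  shows "continuous_on (sphere 0 1) F"
  unfolding continuous_on_def
proof
  fix \<zeta> :: complex assume \<zeta>: "\<zeta> \<in> sphere 0 1"
  have "((\<lambda>\<eta>. C * cmod (\<eta> - \<zeta>) powr \<alpha>) \<longlongrightarrow> C * 0 powr \<alpha>) (at \<zeta> within sphere 0 1)"
    by (intro tendsto_mult tendsto_const tendsto_powr' tendsto_norm_zero LIM_zero tendsto_ident_at) (use assms in auto)
  hence "((\<lambda>\<eta>. C * cmod (\<eta> - \<zeta>) powr \<alpha>) \<longlongrightarrow> 0) (at \<zeta> within sphere 0 1)" by simp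
  moreover have "\<forall>\<^sub>F \<eta> in at \<zeta> within sphere 0 1. norm (F \<eta> - F \<zeta>) \<le> C * cmod (\<eta> - \<zeta>) powr \<alpha>"
    using assms(1) \<zeta> by (auto simp: eventually_at intro!: exI[of _ 1])
  ultimately have "((\<lambda>\<eta>. F \<eta> - F \<zeta>) \<longlongrightarrow> 0) (at \<zeta> within sphere 0 1)"
    by (rule Lim_null_comparison[rotated])
  thus "(F \<longlongrightarrow> F \<zeta>) (at \<zeta> within sphere 0 1)" by (rule LIM_zero_cancel)
qed

lemma circle_lipschitz:
  assumes der: "\<And>\<theta>. ((\<lambda>t. F (cis t)) has_vector_derivative F1 (cis \<theta>)) (at \<theta>)"
    and F1: "continuous_on (sphere 0 1) F1"
  obtains C where "0 < C"
    "\<And>s t. norm (F (cis s) - F (cis t)) \<le> C * \<bar>s - t\<bar>"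
    "\<And>\<zeta> \<eta>. \<zeta> \<in> sphere 0 1 \<Longrightarrow> \<eta> \<in> sphere 0 1 \<Longrightarrow> norm (F \<zeta> - F \<eta>) \<le> C * cmod (\<zeta> - \<eta>)"
    "\<And>\<zeta>. \<zeta> \<in> sphere 0 1 \<Longrightarrow> norm (F1 \<zeta>) \<le> C"
proof -
  have "bounded (F1 ` sphere 0 1)" by (intro compact_imp_bounded compact_continuous_image F1) simp
  then obtain B where B: "0 < B" "\<And>\<zeta>. \<zeta> \<in> sphere 0 1 \<Longrightarrow> norm (F1 \<zeta>) \<le> B"
    unfolding bounded_pos by auto
  have lip: "norm (F (cis s) - F (cis t)) \<le> B * \<bar>s - t\<bar>" for s t
    using vector_derivative_bound[OF der, of B s t] B by auto
  hence "norm (F (cis s) - F (cis t)) \<le> B * \<bar>s - t\<bar> powr 1" for s t by simp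
  from chord_holder[of 1 F B, OF _ this]
  have ch: "norm (F \<zeta> - F \<eta>) \<le> B * 8 * cmod (\<zeta> - \<eta>)" if "\<zeta> \<in> sphere 0 1" "\<eta> \<in> sphere 0 1" for \<zeta> \<eta>
    using that by simp
  show ?thesis
  proof (rule that[of "8 * B"])
    show "norm (F (cis s) - F (cis t)) \<le> 8 * B * \<bar>s - t\<bar>" for s t
    proof -
      have "B * \<bar>s - t\<bar> \<le> 8 * B * \<bar>s - t\<bar>" using B by (intro mult_right_mono) auto
      thus ?thesis using lip[of s t] by linarith
    qed
    show "norm (F \<zeta> - F \<eta>) \<le> 8 * B * cmod (\<zeta> - \<eta>)" if "\<zeta> \<in> sphere 0 1" "\<eta> \<in> sphere 0 1" for \<zeta> \<eta>
      using ch[OF that] by (simp add: mult.commute)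
    show "norm (F1 \<zeta>) \<le> 8 * B" if "\<zeta> \<in> sphere 0 1" for \<zeta>
      using B(2)[OF that] B(1) by linarith
  qed (use B in auto)
qed

lemma chord_le_powr:
  assumes "\<zeta> \<in> sphere 0 1" "\<eta> \<in> sphere 0 1" "0 < \<alpha>" "\<alpha> \<le> 1"
  shows "cmod (\<zeta> - \<eta>) \<le> 2 * cmod (\<zeta> - \<eta>) powr \<alpha>"
proof (cases "\<zeta> = \<eta>")
  case False
  let ?y = "cmod (\<zeta> - \<eta>)"
  have y: "0 < ?y" "?y \<le> 2" using False assms norm_triangle_ineq4[of \<zeta> \<eta>] by auto
  have "?y = ?y powr \<alpha> * ?y powr (1 - \<alpha>)" using y by (simp flip: powr_add)
  also have "\<dots> \<le> ?y powr \<alpha> * 2"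
  proof (rule mult_left_mono)
    have "?y powr (1 - \<alpha>) \<le> 2 powr (1 - \<alpha>)" using y assms by (intro powr_mono2) auto
    also have "\<dots> \<le> 2" using powr_mono[of "1 - \<alpha>" 1 2] assms by simp
    finally show "?y powr (1 - \<alpha>) \<le> 2" .
  qed simp
  finally show ?thesis by simp
qed simp

lemma lipschitz_imp_holder_circle_0:
  assumes "0 < \<alpha>" "\<alpha> \<le> 1" "0 \<le> C"
    and lip: "\<And>\<zeta> \<eta>. \<zeta> \<in> sphere 0 1 \<Longrightarrow> \<eta> \<in> sphere 0 1 \<Longrightarrow> norm (F \<zeta> - F \<eta>) \<le> C * cmod (\<zeta> - \<eta>)"
  shows "holder_circle 0 \<alpha> F"
proof (rule holder_circle_0I)
  fix \<zeta> \<eta> :: complex assume z: "\<zeta> \<in> sphere 0 1" "\<eta> \<in> sphere 0 1"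
  have "C * cmod (\<zeta> - \<eta>) \<le> C * (2 * cmod (\<zeta> - \<eta>) powr \<alpha>)"
    using assms z by (intro mult_left_mono chord_le_powr) auto
  thus "norm (F \<zeta> - F \<eta>) \<le> (2 * C) * cmod (\<zeta> - \<eta>) powr \<alpha>" using lip[OF z] by simp
qed (use assms in auto)

lemma holder_circle_cont_aux:
  assumes alpha: "0 < \<alpha>" "\<alpha> \<le> 1"
  shows "holder_circle k \<alpha> F \<Longrightarrow> continuous_on (sphere 0 1) F \<and> holder_circle 0 \<alpha> F"
proof (induction k arbitrary: F)
  case 0
  then obtain C where "\<And>\<zeta> \<eta>. \<zeta> \<in> sphere 0 1 \<Longrightarrow> \<eta> \<in> sphere 0 1 \<Longrightarrow> norm (F \<zeta> - F \<eta>) \<le> C * cmod (\<zeta> - \<eta>) powr \<alpha>"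
    using holder_circle_0E alpha less_imp_le by metis
  with continuous_on_circleI 0 alpha show ?case by blast
next
  case (Suc k)
  then obtain F1 where F1: "holder_circle k \<alpha> F1"
    "\<And>\<theta>. ((\<lambda>t. F (cis t)) has_vector_derivative F1 (cis \<theta>)) (at \<theta>)"
    using holder_circle_SucE by blast
  obtain C where C: "0 < C" "\<And>\<zeta> \<eta>. \<zeta> \<in> sphere 0 1 \<Longrightarrow> \<eta> \<in> sphere 0 1 \<Longrightarrow> norm (F \<zeta> - F \<eta>) \<le> C * cmod (\<zeta> - \<eta>)"
    using circle_lipschitz[OF F1(2)] Suc.IH[OF F1(1)] by metis
  have "continuous_on (sphere 0 1) F"
    by (rule continuous_on_circleI[where C = C and \<alpha> = 1]) (use C in auto)
  moreover have "holder_circle 0 \<alpha> F"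
    by (rule lipschitz_imp_holder_circle_0[OF alpha, of C]) (use C in auto)
  ultimately show ?case by blast
qed

lemma holder_circle_continuous:
  "holder_circle k \<alpha> F \<Longrightarrow> 0 < \<alpha> \<Longrightarrow> \<alpha> \<le> 1 \<Longrightarrow> continuous_on (sphere 0 1) F"
  using holder_circle_cont_aux by blast

lemma holder_circle_Suc_lower:
  assumes alpha: "0 < \<alpha>" "\<alpha> \<le> 1"
  shows "holder_circle (Suc k) \<alpha> F \<Longrightarrow> holder_circle k \<alpha> F"
proof (induction k arbitrary: F)
  case 0
  thus ?case using holder_circle_cont_aux[OF alpha] by blast
next
  case (Suc k)
  then obtain F1 where F1: "holder_circle (Suc k) \<alpha> F1"
    "\<And>\<theta>. ((\<lambda>t. F (cis t)) has_vector_derivative F1 (cis \<theta>)) (at \<theta>)"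
    using holder_circle_SucE by blast
  thus ?case using Suc.IH holder_circle_SucI by blast
qed

lemma holder_circle_mono:
  assumes alpha: "0 < \<alpha>" "\<alpha> \<le> 1" and "j \<le> k" "holder_circle k \<alpha> F"
  shows "holder_circle j \<alpha> F"
  using assms(3,4) by (induction rule: dec_induct) (auto dest: holder_circle_Suc_lower[OF alpha])

lemma holder_circle_linear:
  assumes h: "bounded_linear h"
  shows "holder_circle k \<alpha> F \<Longrightarrow> holder_circle k \<alpha> (\<lambda>\<zeta>. h (F \<zeta>))"
proof (induction k arbitrary: F)
  case 0
  interpret bounded_linear h by fact
  obtain K where K: "0 \<le> K" "\<And>x. norm (h x) \<le> norm x * K" using nonneg_bounded by blast
  obtain C where C: "\<And>s t. norm (F (cis s) - F (cis t)) \<le> C * \<bar>s - t\<bar> powr \<alpha>"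
    using 0 holder_circle_0 by blast
  show ?case
    unfolding holder_circle_0
  proof (intro exI allI)
    fix s t
    have "norm (h (F (cis s)) - h (F (cis t))) \<le> norm (F (cis s) - F (cis t)) * K"
      unfolding diff[symmetric] by (rule K)
    also have "\<dots> \<le> C * \<bar>s - t\<bar> powr \<alpha> * K" using C K by (intro mult_right_mono) auto
    finally show "norm (h (F (cis s)) - h (F (cis t))) \<le> (C * K) * \<bar>s - t\<bar> powr \<alpha>"
      by (simp add: mult_ac)
  qed
next
  case (Suc k)
  then obtain F1 where F1: "holder_circle k \<alpha> F1"
    "\<And>\<theta>. ((\<lambda>t. F (cis t)) has_vector_derivative F1 (cis \<theta>)) (at \<theta>)"
    using holder_circle_SucE by blast
  show ?case
    by (rule holder_circle_SucI[OF Suc.IH[OF F1(1)]]) (rule bounded_linear.has_vector_derivative[OF h F1(2)])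
qed

lemma holder_circle_add:
  "holder_circle k \<alpha> F \<Longrightarrow> holder_circle k \<alpha> G \<Longrightarrow> holder_circle k \<alpha> (\<lambda>\<zeta>. F \<zeta> + G \<zeta>)"
proof (induction k arbitrary: F G)
  case 0
  obtain C where C: "\<And>s t. norm (F (cis s) - F (cis t)) \<le> C * \<bar>s - t\<bar> powr \<alpha>"
    using 0 holder_circle_0 by blast
  obtain C' where C': "\<And>s t. norm (G (cis s) - G (cis t)) \<le> C' * \<bar>s - t\<bar> powr \<alpha>"
    using 0 holder_circle_0 by blast
  show ?case
    unfolding holder_circle_0
  proof (intro exI allI)
    fix s t
    show "norm (F (cis s) + G (cis s) - (F (cis t) + G (cis t))) \<le> (C + C') * \<bar>s - t\<bar> powr \<alpha>"
      using norm_diff_triangle_ineq[of "F (cis s)" "G (cis s)" "F (cis t)" "G (cis t)"] C[of s t] C'[of s t]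
      by (simp add: algebra_simps)
  qed
next
  case (Suc k)
  obtain F1 where F1: "holder_circle k \<alpha> F1"
    "\<And>\<theta>. ((\<lambda>t. F (cis t)) has_vector_derivative F1 (cis \<theta>)) (at \<theta>)"
    using Suc.prems holder_circle_SucE by blast
  obtain G1 where G1: "holder_circle k \<alpha> G1"
    "\<And>\<theta>. ((\<lambda>t. G (cis t)) has_vector_derivative G1 (cis \<theta>)) (at \<theta>)"
    using Suc.prems holder_circle_SucE by blast
  show ?case
    by (rule holder_circle_SucI[OF Suc.IH[OF F1(1) G1(1)]]) (intro has_vector_derivative_add F1 G1)
qed

lemma holder_circle_const: "holder_circle k \<alpha> (\<lambda>_. c)"
proof (induction k arbitrary: c)
  case 0
  show ?case unfolding holder_circle_0 by (intro exI[of _ 0]) simp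
next
  case (Suc k)
  show ?case by (rule holder_circle_SucI[OF Suc.IH]) (rule has_vector_derivative_const)
qed

lemma holder_circle_cong:
  assumes "holder_circle k \<alpha> F" "\<And>\<zeta>. \<zeta> \<in> sphere 0 1 \<Longrightarrow> F \<zeta> = G \<zeta>"
  shows "holder_circle k \<alpha> G"
  using assms unfolding holder_circle_def by simp

lemma holder_circle_bilinear:
  assumes p: "bounded_bilinear p" and alpha: "0 < \<alpha>" "\<alpha> \<le> 1"
  shows "holder_circle k \<alpha> F \<Longrightarrow> holder_circle k \<alpha> G \<Longrightarrow> holder_circle k \<alpha> (\<lambda>\<zeta>. p (F \<zeta>) (G \<zeta>))"
proof (induction k arbitrary: F G)
  case 0
  interpret bounded_bilinear p by fact
  obtain K where K: "0 \<le> K" "\<And>x y. norm (p x y) \<le> norm x * norm y * K" using nonneg_bounded by blast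
  obtain C where C: "\<And>s t. norm (F (cis s) - F (cis t)) \<le> C * \<bar>s - t\<bar> powr \<alpha>"
    using 0 holder_circle_0 by blast
  obtain C' where C': "\<And>s t. norm (G (cis s) - G (cis t)) \<le> C' * \<bar>s - t\<bar> powr \<alpha>"
    using 0 holder_circle_0 by blast
  have "bounded (F ` sphere 0 1)" "bounded (G ` sphere 0 1)"
    using 0 holder_circle_continuous[OF _ alpha]
    by (auto intro!: compact_imp_bounded compact_continuous_image)
  then obtain B B' where B: "0 < B" "\<And>t. norm (F (cis t)) \<le> B" and B': "0 < B'" "\<And>t. norm (G (cis t)) \<le> B'"
    unfolding bounded_pos by auto
  show ?case
    unfolding holder_circle_0
  proof (intro exI allI)
    fix s t
    have "p (F (cis s)) (G (cis s)) - p (F (cis t)) (G (cis t)) =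
        p (F (cis s) - F (cis t)) (G (cis s)) + p (F (cis t)) (G (cis s) - G (cis t))"
      by (simp add: diff_left diff_right)
    also have "norm \<dots> \<le> norm (F (cis s) - F (cis t)) * norm (G (cis s)) * K
       + norm (F (cis t)) * norm (G (cis s) - G (cis t)) * K"
      by (intro norm_triangle_mono K)
    also have "\<dots> \<le> (C * \<bar>s - t\<bar> powr \<alpha>) * B' * K + B * (C' * \<bar>s - t\<bar> powr \<alpha>) * K"
      using B B' K C[of s t] C'[of s t] order_trans[OF norm_ge_zero C[of s t]]
      by (intro add_mono mult_right_mono mult_mono) auto
    finally show "norm (p (F (cis s)) (G (cis s)) - p (F (cis t)) (G (cis t))) \<le>
        (C * B' * K + B * C' * K) * \<bar>s - t\<bar> powr \<alpha>"
      by (simp add: algebra_simps)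
  qed
next
  case (Suc k)
  obtain F1 where F1: "holder_circle k \<alpha> F1"
    "\<And>\<theta>. ((\<lambda>t. F (cis t)) has_vector_derivative F1 (cis \<theta>)) (at \<theta>)"
    using Suc.prems holder_circle_SucE by blast
  obtain G1 where G1: "holder_circle k \<alpha> G1"
    "\<And>\<theta>. ((\<lambda>t. G (cis t)) has_vector_derivative G1 (cis \<theta>)) (at \<theta>)"
    using Suc.prems holder_circle_SucE by blast
  have FG: "holder_circle k \<alpha> F" "holder_circle k \<alpha> G"
    using Suc.prems holder_circle_Suc_lower[OF alpha] by blast+
  show ?case
    by (rule holder_circle_SucI[OF holder_circle_add[OF Suc.IH[OF FG(1) G1(1)] Suc.IH[OF F1(1) FG(2)]]])
       (rule bounded_bilinear.has_vector_derivative[OF p F1(2) G1(2)])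
qed

lemma holder_circle_ident:
  assumes alpha: "0 < \<alpha>" "\<alpha> \<le> 1"
  shows "holder_circle k \<alpha> (\<lambda>\<zeta>. c * \<zeta>)"
proof (induction k arbitrary: c)
  case 0
  show ?case
    by (rule lipschitz_imp_holder_circle_0[OF alpha, of "cmod c"])
       (auto simp: norm_mult simp flip: right_diff_distrib)
next
  case (Suc k)
  show ?case
  proof (rule holder_circle_SucI[OF Suc.IH[of "c * \<i>"]])
    fix \<theta>
    show "((\<lambda>t. c * cis t) has_vector_derivative c * \<i> * cis \<theta>) (at \<theta>)"
      using bounded_linear.has_vector_derivative[OF bounded_linear_mult_right has_vector_derivative_cis_at, of c \<theta>]
      by (simp add: mult.assoc)
  qed
qed

section \<open>Boundary derivatives in the disc algebra\<close>

lemma disc_alg_rotate: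
  assumes "disc_alg G" "cmod c \<le> 1"
  shows "disc_alg (\<lambda>z. G (c * z))"
proof (rule disc_algI)
  have le: "cmod (c * z) \<le> cmod z" for z
    unfolding norm_mult using assms(2) by (simp add: mult_left_le_one_le)
  show "(\<lambda>z. G (c * z)) holomorphic_on ball 0 1"
    by (rule holomorphic_on_compose_gen[unfolded o_def, of "\<lambda>z. c * z" _ G "ball 0 1"])
       (use disc_alg_holo[OF assms(1)] le_less_trans[OF le] in \<open>auto intro!: holomorphic_intros\<close>)
  show "continuous_on (cball 0 1) (\<lambda>z. G (c * z))"
    by (rule continuous_on_compose2[OF disc_alg_cont[OF assms(1)]])
       (use order_trans[OF le] in \<open>auto intro!: continuous_intros\<close>)
qed

lemma circle_difference_quotient:
  assumes G: "G holomorphic_on ball 0 1" and z: "z \<in> ball 0 1"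
    and h: "h \<longlonglongrightarrow> 0" "\<And>n. h n \<noteq> (0::real)"
  shows "(\<lambda>n. (G (cis (h n) * z) - G z) / of_real (h n)) \<longlonglongrightarrow> \<i> * z * deriv G z"
proof -
  have "((\<lambda>w. exp (\<i> * w) * z) has_field_derivative \<i> * z) (at 0)"
    by (auto intro!: derivative_eq_intros)
  moreover have "(G has_field_derivative deriv G z) (at (exp (\<i> * 0) * z))"
    using holomorphic_derivI[OF G open_ball z] by simp
  ultimately have "((\<lambda>w. G (exp (\<i> * w) * z)) has_field_derivative deriv G z * (\<i> * z)) (at 0)"
    using DERIV_chain2[of G "deriv G z" "\<lambda>w. exp (\<i> * w) * z" 0] by blast
  hence "((\<lambda>w. (G (exp (\<i> * w) * z) - G z) / w) \<longlongrightarrow> deriv G z * (\<i> * z)) (at 0)"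
    by (simp add: has_field_derivative_iff)
  moreover have "filterlim (\<lambda>n. complex_of_real (h n)) (at 0) sequentially"
    unfolding filterlim_at using h tendsto_of_real[OF h(1), where 'a=complex] by auto
  ultimately have "(\<lambda>n. (G (exp (\<i> * of_real (h n)) * z) - G z) / of_real (h n)) \<longlonglongrightarrow> deriv G z * (\<i> * z)"
    by (rule filterlim_compose)
  thus ?thesis by (simp add: cis_conv_exp mult_ac)
qed

lemma circle_difference_quotient_uniform:
  fixes G :: "complex \<Rightarrow> 'a::real_normed_vector"
  assumes der: "\<And>t. ((\<lambda>t. G (cis t)) has_vector_derivative G1 (cis t)) (at t)"
    and G1: "continuous_on (sphere 0 1) G1" and e: "0 < e"
  obtains d where "0 < d"
    "\<And>h \<zeta>. 0 < h \<Longrightarrow> h < d \<Longrightarrow> \<zeta> \<in> sphere 0 1 \<Longrightarrow> norm ((G (cis h * \<zeta>) - G \<zeta>) /\<^sub>R h - G1 \<zeta>) \<le> e"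
proof -
  have "uniformly_continuous_on (sphere 0 1) G1"
    by (intro compact_uniformly_continuous G1) simp
  then obtain d where d: "0 < d"
    "\<And>\<zeta> \<eta>. \<zeta> \<in> sphere 0 1 \<Longrightarrow> \<eta> \<in> sphere 0 1 \<Longrightarrow> dist \<zeta> \<eta> < d \<Longrightarrow> dist (G1 \<zeta>) (G1 \<eta>) < e"
    unfolding uniformly_continuous_on_def using e by metis
  show ?thesis
  proof (rule that[OF d(1)])
    fix h \<zeta> assume h: "0 < h" "h < d" and \<zeta>: "\<zeta> \<in> sphere (0::complex) 1"
    obtain t where t: "\<zeta> = cis t" using circle_cisE[OF \<zeta>] by metis
    have "norm (G (cis (t + h)) - G (cis t) - (t + h - t) *\<^sub>R G1 (cis t)) \<le> norm (t + h - t) * e"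
    proof (rule vector_differentiable_bound_linearization[where S = "{t..t+h}"])
      show "((\<lambda>t. G (cis t)) has_vector_derivative G1 (cis x)) (at x within {t..t+h})" for x
        using der by (rule has_vector_derivative_at_within)
      show "closed_segment t (t + h) \<subseteq> {t..t+h}" using h by (simp add: closed_segment_eq_real_ivl)
      fix x assume x: "x \<in> {t..t+h}"
      have "cmod (cis x - cis t) < d" using dist_cis_le[of x t] x h by auto
      thus "norm (G1 (cis x) - G1 (cis t)) \<le> e"
        using d(2)[of "cis x" "cis t"] by (simp add: dist_norm)
    qed (use h in auto)
    hence "norm (G (cis h * \<zeta>) - G \<zeta> - h *\<^sub>R G1 \<zeta>) \<le> h * e"
      using h by (simp add: t cis_mult add.commute)
    hence "norm (G (cis h * \<zeta>) - G \<zeta> - h *\<^sub>R G1 \<zeta>) / h \<le> e" using h by (simp add: field_simps)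
    moreover have "(G (cis h * \<zeta>) - G \<zeta>) /\<^sub>R h - G1 \<zeta> = (G (cis h * \<zeta>) - G \<zeta> - h *\<^sub>R G1 \<zeta>) /\<^sub>R h"
      using h by (simp add: scaleR_diff_right)
    ultimately show "norm ((G (cis h * \<zeta>) - G \<zeta>) /\<^sub>R h - G1 \<zeta>) \<le> e"
      using h by (simp add: divide_inverse mult.commute)
  qed
qed

text \<open>Difference quotients with respect to rotation belong to the disc algebra and converge
  uniformly on the circle to \<open>G1\<close>; by the maximum principle they converge on the disc,
  where the limit is computed by the chain rule.\<close>

lemma disc_alg_circle_derivative:
  assumes G: "disc_alg G"
    and der: "\<And>t. ((\<lambda>t. G (cis t)) has_vector_derivative G1 (cis t)) (at t)"
    and G1: "continuous_on (sphere 0 1) G1"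
  obtains V where "disc_alg V" "\<And>\<zeta>. \<zeta> \<in> sphere 0 1 \<Longrightarrow> V \<zeta> = G1 \<zeta>"
    "\<And>z. z \<in> ball 0 1 \<Longrightarrow> V z = \<i> * z * deriv G z"
proof -
  define h where "h n = 1 / real (Suc n)" for n
  have h: "h \<longlonglongrightarrow> 0" "\<And>n. 0 < h n"
    unfolding h_def using LIMSEQ_inverse_real_of_nat by (auto simp: inverse_eq_divide)
  define \<Phi> where "\<Phi> n z = (G (cis (h n) * z) - G z) / of_real (h n)" for n z
  have \<Phi>: "disc_alg (\<Phi> n)" for n
    unfolding \<Phi>_def using h(2)[of n]
    by (intro disc_alg_divide disc_alg_intros disc_alg_rotate G) auto
  have app: "\<exists>N. \<forall>n\<ge>N. \<forall>\<zeta>\<in>sphere 0 1. cmod (\<Phi> n \<zeta> - G1 \<zeta>) \<le> e" if e: "0 < e" for e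
  proof -
    obtain d where d: "0 < d"
      "\<And>h \<zeta>. 0 < h \<Longrightarrow> h < d \<Longrightarrow> \<zeta> \<in> sphere 0 1 \<Longrightarrow> cmod ((G (cis h * \<zeta>) - G \<zeta>) /\<^sub>R h - G1 \<zeta>) \<le> e"
      using circle_difference_quotient_uniform[OF der G1 e] by blast
    have "\<forall>\<^sub>F n in sequentially. h n < d" using h(1) d(1) by (rule order_tendstoD)
    then obtain N where N: "\<And>n. n \<ge> N \<Longrightarrow> h n < d" unfolding eventually_sequentially by blast
    have "\<Phi> n \<zeta> = (G (cis (h n) * \<zeta>) - G \<zeta>) /\<^sub>R h n" for n \<zeta>
      by (simp add: \<Phi>_def scaleR_conv_of_real divide_inverse mult.commute)
    thus ?thesis using d(2)[OF h(2) N] by (intro exI[of _ N] allI impI ballI) simp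
  qed
  obtain V where V: "disc_alg V" "uniform_limit (cball 0 1) \<Phi> V sequentially"
  proof (rule disc_alg_uniform_limit[OF \<Phi>])
    fix e :: real assume "0 < e"
    then obtain N where N: "\<forall>n\<ge>N. \<forall>\<zeta>\<in>sphere 0 1. cmod (\<Phi> n \<zeta> - G1 \<zeta>) \<le> e/2"
      using app half_gt_zero by blast
    show "\<exists>N. \<forall>m n. m \<ge> N \<longrightarrow> n \<ge> N \<longrightarrow> (\<forall>\<zeta>\<in>sphere 0 1. cmod (\<Phi> m \<zeta> - \<Phi> n \<zeta>) \<le> e)"
    proof (intro exI[of _ N] allI impI ballI)
      fix m n \<zeta> assume "m \<ge> N" "n \<ge> N" "\<zeta> \<in> sphere (0::complex) 1"
      thus "cmod (\<Phi> m \<zeta> - \<Phi> n \<zeta>) \<le> e"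
        using N[rule_format, of m \<zeta>] N[rule_format, of n \<zeta>]
          norm_triangle_ineq4[of "\<Phi> m \<zeta> - G1 \<zeta>" "\<Phi> n \<zeta> - G1 \<zeta>"] by simp
    qed
  qed blast
  have lim: "(\<lambda>n. \<Phi> n z) \<longlonglongrightarrow> V z" if "z \<in> cball 0 1" for z
    using tendsto_uniform_limitI[OF V(2) that] .
  show ?thesis
  proof (rule that[OF V(1)])
    fix \<zeta> :: complex assume \<zeta>: "\<zeta> \<in> sphere 0 1"
    have "(\<lambda>n. \<Phi> n \<zeta>) \<longlonglongrightarrow> G1 \<zeta>"
    proof (rule LIMSEQ_I)
      fix r :: real assume "0 < r"
      then obtain N where "\<forall>n\<ge>N. \<forall>\<zeta>\<in>sphere 0 1. cmod (\<Phi> n \<zeta> - G1 \<zeta>) \<le> r/2" using app[of "r/2"] by auto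
      thus "\<exists>N. \<forall>n\<ge>N. norm (\<Phi> n \<zeta> - G1 \<zeta>) < r"
        using \<zeta> \<open>0 < r\<close> by (intro exI[of _ N]) fastforce
    qed
    thus "V \<zeta> = G1 \<zeta>" using lim[of \<zeta>] \<zeta> LIMSEQ_unique by auto
  next
    fix z :: complex assume z: "z \<in> ball 0 1"
    have "(\<lambda>n. \<Phi> n z) \<longlonglongrightarrow> \<i> * z * deriv G z"
      unfolding \<Phi>_def using h by (intro circle_difference_quotient disc_alg_holo G z) (auto simp: less_imp_neq[symmetric])
    thus "V z = \<i> * z * deriv G z" using lim[of z] z LIMSEQ_unique by auto
  qed
qed

text \<open>\<open>V\<close> vanishes at 0, so dividing by \<open>\<i> * z\<close> extends
  \<open>deriv G\<close> continuously to the closed disc. The dilates of \<open>G\<close> are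
  differentiable on the closed disc with derivatives converging uniformly to \<open>E\<close>, and
  so their limit \<open>G\<close> is differentiable up to the circle.\<close>

lemma disc_alg_closed_disc_derivative:
  assumes G: "disc_alg G" and V: "continuous_on (cball 0 1) V"
    and eq: "\<And>z. z \<in> ball 0 1 \<Longrightarrow> V z = \<i> * z * deriv G z"
  obtains E where "disc_alg E" "\<And>z. z \<in> cball 0 1 \<Longrightarrow> (G has_field_derivative E z) (at z within cball 0 1)"
    "\<And>z. z \<in> cball 0 1 \<Longrightarrow> V z = \<i> * z * E z"
proof -
  have dG: "deriv G holomorphic_on ball 0 1"
    by (intro holomorphic_deriv disc_alg_holo G open_ball)
  have "(\<lambda>z. \<i> * z * deriv G z) holomorphic_on ball 0 1" by (intro holomorphic_intros dG)
  hence "V holomorphic_on ball 0 1" by (rule holomorphic_transform) (simp add: eq)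
  hence dV: "disc_alg V" using V by (rule disc_algI)
  have V0: "V 0 = 0" using eq[of 0] by simp
  have "((\<lambda>z. \<i> * z * deriv G z) has_field_derivative \<i> * deriv G 0) (at 0)"
  proof -
    have "(deriv G has_field_derivative deriv (deriv G) 0) (at 0)"
      by (rule holomorphic_derivI[OF dG open_ball]) simp
    moreover have "((\<lambda>z. \<i> * z) has_field_derivative \<i>) (at 0)" by (auto intro!: derivative_eq_intros)
    ultimately show ?thesis using DERIV_mult[of "\<lambda>z. \<i> * z" \<i> 0 UNIV "deriv G"] by simp
  qed
  hence V1: "(V has_field_derivative \<i> * deriv G 0) (at 0)"
    by (rule has_field_derivative_transform_within_open[where S = "ball 0 1"]) (auto simp: eq)
  define E where "E z = diff_quot V 0 (\<i> * deriv G 0) z / \<i>" for z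
  have E: "disc_alg E"
    unfolding E_def
    by (intro disc_alg_divide disc_alg_intros disc_alg_diff_quot dV has_field_derivative_at_within[OF V1]) auto
  have "\<i> * z * (q / \<i>) = z * q" for z q by (simp add: complex_eq_iff)
  hence VE: "V z = \<i> * z * E z" for z
    using diff_quot_mult[of V z 0 "\<i> * deriv G 0"] V0 unfolding E_def by simp
  have Ein: "E z = deriv G z" if "z \<in> ball 0 1" for z
    using eq[OF that] V0 by (auto simp: E_def diff_quot_def)
  define r where "r n = 1 - 1 / real (Suc n)" for n
  have r: "0 \<le> r n" "r n < 1" "r n \<le> 1" for n by (auto simp: r_def field_simps)
  have rlim: "r \<longlonglongrightarrow> 1"
    unfolding r_def using tendsto_diff[OF tendsto_const LIMSEQ_inverse_real_of_nat, of 1]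
    by (simp add: inverse_eq_divide)
  have in_ball: "of_real (r n) * z \<in> ball 0 1" if "z \<in> cball 0 1" for n and z :: complex
  proof -
    have "cmod (of_real (r n) * z) \<le> r n * 1"
      unfolding norm_mult using r[of n] that by (intro mult_mono) auto
    thus ?thesis using r(2)[of n] by auto
  qed
  have uE: "uniformly_continuous_on (cball 0 1) E"
    by (intro compact_uniformly_continuous disc_alg_cont E) simp
  have "bounded (E ` cball 0 1)" by (intro compact_imp_bounded compact_continuous_image disc_alg_cont E) simp
  then obtain B where B: "0 < B" "\<And>z. z \<in> cball 0 1 \<Longrightarrow> cmod (E z) \<le> B" unfolding bounded_pos by auto
  have "\<exists>g. \<forall>z\<in>cball 0 1. (\<lambda>n. G (of_real (r n) * z)) \<longlonglongrightarrow> g z \<and>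
      (g has_field_derivative E z) (at z within cball 0 1)"
  proof (rule has_complex_derivative_sequence)
    fix n z assume z: "z \<in> cball (0::complex) 1"
    have "((\<lambda>z. G (of_real (r n) * z)) has_field_derivative deriv G (of_real (r n) * z) * of_real (r n)) (at z)"
    proof (rule DERIV_chain2[of G])
      show "(G has_field_derivative deriv G (of_real (r n) * z)) (at (of_real (r n) * z))"
        by (rule holomorphic_derivI[OF disc_alg_holo[OF G] open_ball in_ball[OF z]])
      show "((\<lambda>z. of_real (r n) * z) has_field_derivative of_real (r n)) (at z)"
        by (auto intro!: derivative_eq_intros)
    qed
    thus "((\<lambda>z. G (of_real (r n) * z)) has_field_derivative E (of_real (r n) * z) * of_real (r n)) (at z within cball 0 1)"
      using Ein[OF in_ball[OF z]] by (simp add: has_field_derivative_at_within)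
  next
    fix e :: real assume e: "0 < e"
    then obtain d where d: "0 < d"
      "\<And>x y. x \<in> cball 0 1 \<Longrightarrow> y \<in> cball 0 1 \<Longrightarrow> dist x y < d \<Longrightarrow> dist (E x) (E y) < e/2"
      using uE unfolding uniformly_continuous_on_def by (metis half_gt_zero)
    have "\<forall>\<^sub>F n in sequentially. 1 - min d (e / (2 * B)) < r n"
      using d e B by (intro order_tendstoD(1)[OF rlim]) simp
    then obtain N where N: "\<And>n. n \<ge> N \<Longrightarrow> 1 - min d (e / (2 * B)) < r n"
      unfolding eventually_sequentially by blast
    show "\<exists>N. \<forall>n x. n \<ge> N \<longrightarrow> x \<in> cball 0 1 \<longrightarrow> norm (E (of_real (r n) * x) * of_real (r n) - E x) \<le> e"
    proof (intro exI[of _ N] allI impI)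
      fix n and x :: complex assume n: "n \<ge> N" and x: "x \<in> cball 0 1"
      have "1 - r n < min d (e / (2 * B))" using N[OF n] by linarith
      hence "1 - r n < d" "1 - r n < e / (2 * B)" by auto
      hence rn: "1 - r n < d" "(1 - r n) * B < e/2"
        using B(1) by (simp_all add: pos_less_divide_eq mult_ac)
      have "of_real (r n) * x - x = - (of_real (1 - r n) * x)" by (simp add: algebra_simps)
      hence "cmod (of_real (r n) * x - x) = (1 - r n) * cmod x"
        using r[of n] by (simp only: norm_minus_cancel norm_mult norm_of_real abs_of_nonneg diff_ge_0_iff_ge)
      also have "\<dots> \<le> (1 - r n) * 1" using x r[of n] by (intro mult_left_mono) auto
      finally have "dist (of_real (r n) * x) x < d" using rn by (simp add: dist_norm)
      hence 1: "cmod (E (of_real (r n) * x) - E x) < e/2"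
        using d(2)[OF _ x, of "of_real (r n) * x"] in_ball[OF x, of n] by (simp add: dist_norm)
      have "E (of_real (r n) * x) * of_real (r n) - E x =
          (E (of_real (r n) * x) - E x) * of_real (r n) - of_real (1 - r n) * E x"
        by (simp add: algebra_simps)
      also have "cmod \<dots> \<le> cmod (E (of_real (r n) * x) - E x) * r n + (1 - r n) * cmod (E x)"
        using norm_triangle_ineq4[of "(E (of_real (r n) * x) - E x) * of_real (r n)" "of_real (1 - r n) * E x"] r[of n]
        by (simp add: norm_mult del: of_real_diff)
      also have "\<dots> \<le> (e/2) * 1 + (1 - r n) * B"
        using 1 r[of n] B(2)[OF x] e by (intro add_mono mult_mono) auto
      finally show "cmod (E (of_real (r n) * x) * of_real (r n) - E x) \<le> e" using rn by simp
    qed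
  next
    show "\<exists>x l. x \<in> cball 0 1 \<and> (\<lambda>n. G (of_real (r n) * x)) \<longlonglongrightarrow> l"
      by (rule exI[of _ 0]) auto
  qed simp
  then obtain g where g: "\<And>z. z \<in> cball 0 1 \<Longrightarrow> (\<lambda>n. G (of_real (r n) * z)) \<longlonglongrightarrow> g z"
    "\<And>z. z \<in> cball 0 1 \<Longrightarrow> (g has_field_derivative E z) (at z within cball 0 1)" by blast
  have gG: "g z = G z" if z: "z \<in> cball 0 1" for z
  proof -
    have "(\<lambda>n. of_real (r n) * z) \<longlonglongrightarrow> of_real 1 * z" by (intro tendsto_intros rlim)
    hence "(\<lambda>n. G (of_real (r n) * z)) \<longlonglongrightarrow> G z"
      by (intro continuous_on_tendsto_compose[OF disc_alg_cont[OF G]])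
         (use z in_ball[OF z] in \<open>auto intro!: always_eventually less_imp_le\<close>)
    thus ?thesis using g(1)[OF z] LIMSEQ_unique by blast
  qed
  show ?thesis
  proof (rule that[OF E])
    fix z :: complex assume z: "z \<in> cball 0 1"
    show "(G has_field_derivative E z) (at z within cball 0 1)"
      by (rule has_field_derivative_transform_within[OF g(2)[OF z] zero_less_one z]) (simp add: gG)
  qed (rule VE)
qed

lemma circle_chain:
  assumes "(G has_field_derivative D) (at (cis t) within cball 0 1)"
  shows "((\<lambda>t. G (cis t)) has_vector_derivative \<i> * cis t * D) (at t)"
proof -
  have "(G has_field_derivative D) (at (cis t) within cis ` UNIV)"
    by (rule DERIV_subset[OF assms]) auto
  from field_vector_diff_chain_within[OF has_vector_derivative_cis_at this]
  show ?thesis by (simp add: o_def)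
qed

lemma holder_extension:
  assumes v: "v holomorphic_on ball 0 1" and alpha: "0 < \<alpha>"
    and hol: "\<And>z w. z \<in> ball 0 1 \<Longrightarrow> w \<in> ball 0 1 \<Longrightarrow> cmod (v z - v w) \<le> C * cmod (z - w) powr \<alpha>"
  obtains V where "disc_alg V" "\<And>z. z \<in> ball 0 1 \<Longrightarrow> V z = v z"
    "\<And>z w. z \<in> cball 0 1 \<Longrightarrow> w \<in> cball 0 1 \<Longrightarrow> cmod (V z - V w) \<le> C * cmod (z - w) powr \<alpha>"
proof -
  have "uniformly_continuous_on (ball 0 1) v"
    unfolding uniformly_continuous_on_def
  proof (intro allI impI)
    fix e :: real assume e: "0 < e"
    define d where "d = (e / (\<bar>C\<bar> + 1)) powr (1/\<alpha>)"
    have d: "0 < d" "d powr \<alpha> = e / (\<bar>C\<bar> + 1)" using e alpha by (auto simp: d_def powr_powr)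
    show "\<exists>d>0. \<forall>x\<in>ball 0 1. \<forall>x'\<in>ball 0 1. dist x' x < d \<longrightarrow> dist (v x') (v x) < e"
    proof (intro exI[of _ d] conjI ballI impI d(1))
      fix x x' :: complex assume x: "x \<in> ball 0 1" "x' \<in> ball 0 1" "dist x' x < d"
      have "cmod (v x' - v x) \<le> C * cmod (x' - x) powr \<alpha>" by (rule hol[OF x(2,1)])
      also have "\<dots> \<le> \<bar>C\<bar> * d powr \<alpha>"
        using x alpha by (intro mult_mono powr_mono2) (auto simp: dist_norm)
      also have "\<dots> < (\<bar>C\<bar> + 1) * d powr \<alpha>" using d(1) by (simp add: algebra_simps)
      also have "\<dots> = e" using d(2) by simp
      finally show "dist (v x') (v x) < e" by (simp add: dist_norm)
    qed
  qed
  then obtain V where V: "uniformly_continuous_on (closure (ball 0 1)) V" "\<And>z. z \<in> ball 0 1 \<Longrightarrow> v z = V z"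
    using uniformly_continuous_on_extension_on_closure by metis
  have cV: "continuous_on (cball 0 1) V" using uniformly_continuous_imp_continuous[OF V(1)] by simp
  have "V holomorphic_on ball 0 1" by (rule holomorphic_transform[OF v]) (simp add: V(2))
  hence dV: "disc_alg V" using cV by (rule disc_algI)
  show ?thesis
  proof (rule that[OF dV])
    fix z w :: complex assume zw: "z \<in> cball 0 1" "w \<in> cball 0 1"
    define r where "r n = 1 - 1 / real (Suc n)" for n
    have r: "0 \<le> r n" "r n < 1" for n by (auto simp: r_def field_simps)
    have rlim: "r \<longlonglongrightarrow> 1"
      unfolding r_def using tendsto_diff[OF tendsto_const LIMSEQ_inverse_real_of_nat, of 1]
      by (simp add: inverse_eq_divide)
    have in_ball: "of_real (r n) * z \<in> ball 0 1" if "z \<in> cball 0 1" for n and z :: complex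
    proof -
      have "cmod (of_real (r n) * z) \<le> r n * 1"
        unfolding norm_mult using r[of n] that by (intro mult_mono) auto
      thus ?thesis using r(2)[of n] by auto
    qed
    have lim: "(\<lambda>n. V (of_real (r n) * z)) \<longlonglongrightarrow> V z" if z: "z \<in> cball 0 1" for z
    proof -
      have "(\<lambda>n. of_real (r n) * z) \<longlonglongrightarrow> of_real 1 * z" by (intro tendsto_intros rlim)
      thus ?thesis
        by (intro continuous_on_tendsto_compose[OF cV])
           (use z in_ball[OF z] in \<open>auto intro!: always_eventually less_imp_le\<close>)
    qed
    have "0 \<le> cmod (v 0 - v (1/2))" by simp
    also have "\<dots> \<le> C * cmod (0 - 1/2) powr \<alpha>" by (rule hol) (auto simp: norm_divide)
    finally have C: "0 \<le> C" by (simp add: norm_divide zero_le_mult_iff)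
    have "cmod (V (of_real (r n) * z) - V (of_real (r n) * w)) \<le> C * cmod (z - w) powr \<alpha>" for n
    proof -
      have "cmod (V (of_real (r n) * z) - V (of_real (r n) * w)) \<le>
          C * cmod (of_real (r n) * z - of_real (r n) * w) powr \<alpha>"
        using hol[OF in_ball[OF zw(1)] in_ball[OF zw(2)]] V(2) in_ball zw by metis
      also have "cmod (of_real (r n) * z - of_real (r n) * w) = r n * cmod (z - w)"
        using r[of n] by (simp add: norm_mult flip: right_diff_distrib)
      also have "C * (r n * cmod (z - w)) powr \<alpha> \<le> C * (1 * cmod (z - w)) powr \<alpha>"
        using r[of n] alpha C by (intro mult_left_mono powr_mono2 mult_right_mono) auto
      finally show ?thesis by simp
    qed
    moreover have "(\<lambda>n. cmod (V (of_real (r n) * z) - V (of_real (r n) * w))) \<longlonglongrightarrow> cmod (V z - V w)"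
      by (intro tendsto_intros lim zw)
    ultimately show "cmod (V z - V w) \<le> C * cmod (z - w) powr \<alpha>"
      by (intro LIMSEQ_le_const2) auto
  qed (simp add: V(2))
qed

section \<open>Regularity of solutions\<close>

lemma disc_alg_eq_closed:
  assumes "disc_alg \<phi>" "disc_alg \<psi>" "\<And>z. z \<in> ball 0 1 \<Longrightarrow> \<phi> z = \<psi> z" "z \<in> cball 0 1"
  shows "\<phi> z = \<psi> z"
proof -
  have "\<phi> z - \<psi> z = 0"
    by (rule continuous_constant_on_closure[of "ball 0 1" "\<lambda>z. \<phi> z - \<psi> z"])
       (use assms disc_alg_cont[OF disc_alg_diff[OF assms(1,2)]] in auto)
  thus ?thesis by simp
qed

lemma radial_point:
  obtains \<sigma> where "\<sigma> \<in> sphere 0 1" "a = of_real (cmod a) * \<sigma>"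
proof (cases "a = 0")
  case True
  thus ?thesis using that[of 1] by simp
next
  case False
  thus ?thesis using that[of "a / of_real (cmod a)"] by (simp add: norm_divide)
qed

lemma norm_vec_le_card_mult:
  fixes x :: "complex ^ 'n"
  assumes "\<And>i. cmod (x $ i) \<le> B"
  shows "norm x \<le> real CARD('n) * B"
proof -
  have "norm x \<le> (\<Sum>i\<in>UNIV. cmod (x $ i))"
    unfolding norm_vec_def by (rule L2_set_le_sum) simp
  also have "\<dots> \<le> (\<Sum>i\<in>(UNIV::'n set). B)" by (intro sum_mono assms)
  finally show ?thesis by simp
qed

text \<open>Rotating both points together keeps their chord fixed. The mean value inequality in the
  rotation angle therefore passes the Hoelder bound of \<open>G1\<close> to the difference quotient
  with the same constant for every step \<open>h\<close>.\<close>

lemma circle_quotient_bound: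
  fixes G :: "complex \<Rightarrow> 'a::real_normed_vector"
  assumes der: "\<And>t. ((\<lambda>t. G (cis t)) has_vector_derivative G1 (cis t)) (at t)"
    and hol: "\<And>\<zeta> \<eta>. \<zeta> \<in> sphere 0 1 \<Longrightarrow> \<eta> \<in> sphere 0 1 \<Longrightarrow> norm (G1 \<zeta> - G1 \<eta>) \<le> C * cmod (\<zeta> - \<eta>) powr \<alpha>"
    and h: "0 < h" and \<zeta>: "\<zeta> \<in> sphere 0 1" and \<eta>: "\<eta> \<in> sphere 0 1"
  shows "norm ((G (cis h * \<zeta>) - G \<zeta>) /\<^sub>R h - (G (cis h * \<eta>) - G \<eta>) /\<^sub>R h) \<le> C * cmod (\<zeta> - \<eta>) powr \<alpha>"
proof -
  obtain s where s: "\<zeta> = cis s" using circle_cisE[OF \<zeta>] by metis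
  obtain t where t: "\<eta> = cis t" using circle_cisE[OF \<eta>] by metis
  define q where "q \<tau> = G (cis (s + \<tau>)) - G (cis (t + \<tau>))" for \<tau>
  have dq: "(q has_vector_derivative (G1 (cis (s + \<tau>)) - G1 (cis (t + \<tau>)))) (at \<tau>)" for \<tau>
  proof -
    have sh: "((\<lambda>\<tau>. G (cis (c + \<tau>))) has_vector_derivative G1 (cis (c + \<tau>))) (at \<tau>)" for c
    proof -
      have "((\<lambda>t. c + t) has_vector_derivative 1) (at \<tau>)" by (auto intro!: derivative_eq_intros)
      from vector_diff_chain_at[OF this der] show ?thesis by (simp add: o_def)
    qed
    show ?thesis unfolding q_def by (intro has_vector_derivative_diff sh)
  qed
  have "norm (q h - q 0) \<le> C * cmod (\<zeta> - \<eta>) powr \<alpha> * \<bar>h - 0\<bar>"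
  proof (rule vector_derivative_bound[OF dq])
    fix \<tau>
    have "cmod (cis (s + \<tau>) - cis (t + \<tau>)) = cmod (\<zeta> - \<eta>)"
      by (simp add: s t norm_mult flip: cis_mult left_diff_distrib)
    thus "norm (G1 (cis (s + \<tau>)) - G1 (cis (t + \<tau>))) \<le> C * cmod (\<zeta> - \<eta>) powr \<alpha>"
      using hol[of "cis (s + \<tau>)" "cis (t + \<tau>)"] by simp
  qed
  moreover have "(G (cis h * \<zeta>) - G \<zeta>) /\<^sub>R h - (G (cis h * \<eta>) - G \<eta>) /\<^sub>R h = (q h - q 0) /\<^sub>R h"
    by (simp add: q_def s t cis_mult add.commute scaleR_diff_right)
  ultimately show ?thesis using h by (simp only: norm_scaleR) (simp add: field_simps)
qed

section \<open>Hoelder bounds up to the circle and the bootstrap\<close>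

context coercive_symbol
begin

text \<open>The derivative estimate of \<open>interior_bounds\<close> feeds Gronwall, which replaces
  the size of \<open>u a\<close> by that of \<open>u 0\<close>; the boundary estimate then profits
  from the same replacement.\<close>

lemma uniform_bounds:
  assumes alpha: "0 < \<alpha>" "\<alpha> < 1"
  obtains K where "0 < K"
    "\<And>u F f M a i. holder_solution \<alpha> M u F f \<Longrightarrow> a \<in> ball 0 1
     \<Longrightarrow> cmod (deriv (\<lambda>z. u z $ i) a) \<le> K * (M + norm (u 0)) * (1 - cmod a) powr (\<alpha> - 1)"
    "\<And>u F f M a \<sigma>. holder_solution \<alpha> M u F f \<Longrightarrow> a \<in> ball 0 1 \<Longrightarrow> \<sigma> \<in> sphere 0 1 \<Longrightarrow> a = of_real (cmod a) * \<sigma>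
     \<Longrightarrow> norm (F a - (f \<sigma> + A \<sigma> (u a))) \<le> K * (M + norm (u 0)) * (1 - cmod a) powr \<alpha>"
proof -
  obtain K where K: "0 < K" and
    der: "\<And>u F f a \<sigma> M i. a \<in> ball 0 1 \<Longrightarrow> \<sigma> \<in> sphere 0 1 \<Longrightarrow> a = of_real (cmod a) * \<sigma> \<Longrightarrow> holder_solution \<alpha> M u F f
     \<Longrightarrow> cmod (deriv (\<lambda>z. u z $ i) a) \<le> K * (M + norm (u a)) * (1 - cmod a) powr (\<alpha> - 1)" and
    bv: "\<And>u F f a \<sigma> M. a \<in> ball 0 1 \<Longrightarrow> \<sigma> \<in> sphere 0 1 \<Longrightarrow> a = of_real (cmod a) * \<sigma> \<Longrightarrow> holder_solution \<alpha> M u F f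
     \<Longrightarrow> norm (F a - (f \<sigma> + A \<sigma> (u a))) \<le> K * (M + norm (u a)) * (1 - cmod a) powr \<alpha>"
    using interior_bounds[OF alpha] by blast
  define E where "E = exp (2 * real CARD('n) * K / \<alpha>)"
  have E: "0 < E" by (simp add: E_def)
  have growth: "K * (M + norm (u a)) \<le> K * (1 + E) * (M + norm (u 0))"
    if sol: "holder_solution \<alpha> M u F f" and a: "a \<in> ball 0 1" for u F f M a
  proof -
    have u: "disc_alg_vec u" and M: "0 < M" using sol by (auto simp: holder_solution_def)
    have "norm (u a) \<le> E * (M + norm (u 0))"
      unfolding E_def
    proof (rule gronwall_radial[OF u M less_imp_le[OF K] alpha(1) _ a])
      fix b :: complex and i assume b: "b \<in> ball 0 1"
      obtain \<sigma> where "\<sigma> \<in> sphere 0 1" "b = of_real (cmod b) * \<sigma>" by (rule radial_point)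
      thus "cmod (deriv (\<lambda>z. u z $ i) b) \<le> K * (M + norm (u b)) * (1 - cmod b) powr (\<alpha> - 1)"
        using der[OF b _ _ sol] by blast
    qed
    hence "M + norm (u a) \<le> (1 + E) * (M + norm (u 0))"
      using norm_ge_zero[of "u 0"] unfolding distrib_right mult_1 by linarith
    thus ?thesis using K by (simp add: mult.assoc)
  qed
  show ?thesis
  proof (rule that[of "K * (1 + E)"])
    show "0 < K * (1 + E)" using K E by simp
  next
    fix u F f M and a :: complex and i
    assume sol: "holder_solution \<alpha> M u F f" and a: "a \<in> ball 0 1"
    obtain \<sigma> where \<sigma>: "\<sigma> \<in> sphere 0 1" "a = of_real (cmod a) * \<sigma>" by (rule radial_point)
    have "cmod (deriv (\<lambda>z. u z $ i) a) \<le> K * (M + norm (u a)) * (1 - cmod a) powr (\<alpha> - 1)"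
      by (rule der[OF a \<sigma> sol])
    also have "\<dots> \<le> K * (1 + E) * (M + norm (u 0)) * (1 - cmod a) powr (\<alpha> - 1)"
      by (intro mult_right_mono growth[OF sol a]) auto
    finally show "cmod (deriv (\<lambda>z. u z $ i) a) \<le> K * (1 + E) * (M + norm (u 0)) * (1 - cmod a) powr (\<alpha> - 1)" .
  next
    fix u F f M and a \<sigma> :: complex
    assume sol: "holder_solution \<alpha> M u F f" and a: "a \<in> ball 0 1"
      and \<sigma>: "\<sigma> \<in> sphere 0 1" "a = of_real (cmod a) * \<sigma>"
    have "norm (F a - (f \<sigma> + A \<sigma> (u a))) \<le> K * (M + norm (u a)) * (1 - cmod a) powr \<alpha>"
      by (rule bv[OF a \<sigma> sol])
    also have "\<dots> \<le> K * (1 + E) * (M + norm (u 0)) * (1 - cmod a) powr \<alpha>"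
      by (intro mult_right_mono growth[OF sol a]) auto
    finally show "norm (F a - (f \<sigma> + A \<sigma> (u a))) \<le> K * (1 + E) * (M + norm (u 0)) * (1 - cmod a) powr \<alpha>" .
  qed
qed

lemma holder_on_disc:
  assumes alpha: "0 < \<alpha>" "\<alpha> < 1"
  obtains K where "0 < K"
    "\<And>u F f M z w. holder_solution \<alpha> M u F f \<Longrightarrow> z \<in> cball 0 1 \<Longrightarrow> w \<in> cball 0 1
     \<Longrightarrow> norm (u z - u w) \<le> K * (M + norm (u 0)) * cmod (z - w) powr \<alpha>"
proof -
  obtain K where K: "0 < K" and
    der: "\<And>u F f M a i. holder_solution \<alpha> M u F f \<Longrightarrow> a \<in> ball 0 1
     \<Longrightarrow> cmod (deriv (\<lambda>z. u z $ i) a) \<le> K * (M + norm (u 0)) * (1 - cmod a) powr (\<alpha> - 1)"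
    using uniform_bounds[OF alpha] by metis
  show ?thesis
  proof (rule that[of "real CARD('n) * ((2 / \<alpha> + 1) * K)"])
    show "0 < real CARD('n) * ((2 / \<alpha> + 1) * K)"
      using K alpha by (intro mult_pos_pos add_pos_pos divide_pos_pos) auto
  next
    fix u F f M and z w :: complex
    assume sol: "holder_solution \<alpha> M u F f" and zw: "z \<in> cball 0 1" "w \<in> cball 0 1"
    have u: "disc_alg_vec u" and M: "0 < M" using sol by (auto simp: holder_solution_def)
    let ?K = "K * (M + norm (u 0))"
    have K0: "0 \<le> ?K" using K M by simp
    have "cmod (u z $ i - u w $ i) \<le> (2 / \<alpha> + 1) * ?K * cmod (z - w) powr \<alpha>" for i
    proof -
      have ui: "disc_alg (\<lambda>z. u z $ i)" using u by (rule disc_alg_vec_nth)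
      have hl: "cmod (u z $ i - u w $ i) \<le> (2 / \<alpha> + 1) * ?K * cmod (z - w) powr \<alpha>"
        if "z \<in> ball 0 1" "w \<in> ball 0 1" for z w
        using hardy_littlewood[OF disc_alg_holo[OF ui] alpha(1) less_imp_le[OF alpha(2)] K0 _ that]
          der[OF sol, of _ i] by simp
      obtain V where V: "disc_alg V" "\<And>z. z \<in> ball 0 1 \<Longrightarrow> V z = u z $ i"
        "\<And>z w. z \<in> cball 0 1 \<Longrightarrow> w \<in> cball 0 1 \<Longrightarrow> cmod (V z - V w) \<le> (2 / \<alpha> + 1) * ?K * cmod (z - w) powr \<alpha>"
        using holder_extension[OF disc_alg_holo[OF ui] alpha(1) hl] by blast
      have "V z = u z $ i" if "z \<in> cball 0 1" for z
        by (rule disc_alg_eq_closed[OF V(1) ui V(2) that])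
      thus ?thesis using V(3)[OF zw] zw by simp
    qed
    hence "norm (u z - u w) \<le> real CARD('n) * ((2 / \<alpha> + 1) * ?K * cmod (z - w) powr \<alpha>)"
      by (intro norm_vec_le_card_mult) simp
    thus "norm (u z - u w) \<le> real CARD('n) * ((2 / \<alpha> + 1) * K) * (M + norm (u 0)) * cmod (z - w) powr \<alpha>"
      by (simp only: mult.assoc)
  qed
qed

lemma regularity_0:
  assumes alpha: "0 < \<alpha>" "\<alpha> < 1" and u: "disc_alg_vec u" and F: "disc_alg_vec F"
    and eq: "\<And>\<zeta>. \<zeta> \<in> sphere 0 1 \<Longrightarrow> F \<zeta> = A \<zeta> (u \<zeta>) + f \<zeta>" and f: "holder_circle 0 \<alpha> f"
  obtains C where "0 < C"
    "\<And>z w. z \<in> cball 0 1 \<Longrightarrow> w \<in> cball 0 1 \<Longrightarrow> norm (u z - u w) \<le> C * cmod (z - w) powr \<alpha>"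
proof -
  obtain M where M: "0 < M"
    "\<And>\<zeta> \<eta>. \<zeta> \<in> sphere 0 1 \<Longrightarrow> \<eta> \<in> sphere 0 1 \<Longrightarrow> norm (f \<zeta> - f \<eta>) \<le> M * cmod (\<zeta> - \<eta>) powr \<alpha>"
    using holder_circle_0E[OF f] alpha by (metis less_imp_le)
  hence sol: "holder_solution \<alpha> M u F f" using u F eq by (simp add: holder_solution_def)
  obtain K where K: "0 < K" and
    hd: "\<And>u F f M z w. holder_solution \<alpha> M u F f \<Longrightarrow> z \<in> cball 0 1 \<Longrightarrow> w \<in> cball 0 1
     \<Longrightarrow> norm (u z - u w) \<le> K * (M + norm (u 0)) * cmod (z - w) powr \<alpha>"
    using holder_on_disc[OF alpha] by blast
  have "0 < M + norm (u 0)" using M(1) by (simp add: add_pos_nonneg)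
  thus ?thesis using that[of "K * (M + norm (u 0))"] K hd[OF sol] by simp
qed

text \<open>The rotation difference quotients \<open>Q h u\<close> solve an equation with the same
  symbol and data \<open>g h\<close>, and the Hoelder constant of \<open>g h\<close> does not depend
  on \<open>h\<close>. As \<open>Q h u\<close> vanishes at 0, \<open>holder_on_disc\<close> bounds
  it uniformly, and the limit \<open>v\<close> extends continuously to the circle.\<close>

lemma differentiated_solution:
  assumes alpha: "0 < \<alpha>" "\<alpha> < 1" and u: "disc_alg_vec u" and F: "disc_alg_vec F"
    and eq: "\<And>\<zeta>. \<zeta> \<in> sphere 0 1 \<Longrightarrow> F \<zeta> = A \<zeta> (u \<zeta>) + f \<zeta>"
    and df: "\<And>t. ((\<lambda>t. f (cis t)) has_vector_derivative f1 (cis t)) (at t)" and f1: "holder_circle 0 \<alpha> f1"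
    and dA: "\<And>t. ((\<lambda>t. A (cis t)) has_vector_derivative A1 (cis t)) (at t)" and A1: "holder_circle 0 \<alpha> A1"
  obtains V W where "disc_alg_vec V" "disc_alg_vec W"
    "\<And>t. ((\<lambda>t. u (cis t)) has_vector_derivative V (cis t)) (at t)"
    "\<And>\<zeta>. \<zeta> \<in> sphere 0 1 \<Longrightarrow> W \<zeta> = A \<zeta> (V \<zeta>) + (A1 \<zeta> (u \<zeta>) + f1 \<zeta>)"
proof -
  have al: "0 \<le> \<alpha>" "\<alpha> \<le> 1" using alpha by auto
  have cf1: "continuous_on (sphere 0 1) f1" and cA1: "continuous_on (sphere 0 1) A1"
    using holder_circle_continuous[OF _ alpha(1) al(2)] f1 A1 by blast+
  obtain Cf where Cf: "0 < Cf"
    "\<And>\<zeta> \<eta>. \<zeta> \<in> sphere 0 1 \<Longrightarrow> \<eta> \<in> sphere 0 1 \<Longrightarrow> norm (f1 \<zeta> - f1 \<eta>) \<le> Cf * cmod (\<zeta> - \<eta>) powr \<alpha>"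
    using holder_circle_0E[OF f1 al(1)] by metis
  obtain CA where CA: "0 < CA"
    "\<And>\<zeta> \<eta>. \<zeta> \<in> sphere 0 1 \<Longrightarrow> \<eta> \<in> sphere 0 1 \<Longrightarrow> norm (A1 \<zeta> - A1 \<eta>) \<le> CA * cmod (\<zeta> - \<eta>) powr \<alpha>"
    using holder_circle_0E[OF A1 al(1)] by metis
  obtain LA where LA: "0 < LA" "\<And>s t. norm (A (cis s) - A (cis t)) \<le> LA * \<bar>s - t\<bar>"
    using circle_lipschitz[OF dA cA1] by metis
  have "holder_circle (Suc 0) \<alpha> f" by (rule holder_circle_SucI[OF f1 df])
  hence f0: "holder_circle 0 \<alpha> f" by (rule holder_circle_Suc_lower[OF alpha(1) al(2)])
  obtain Cu where Cu: "0 < Cu"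
    "\<And>z w. z \<in> cball 0 1 \<Longrightarrow> w \<in> cball 0 1 \<Longrightarrow> norm (u z - u w) \<le> Cu * cmod (z - w) powr \<alpha>"
    using regularity_0[OF alpha u F eq f0] by blast
  have "bounded (u ` cball 0 1)" by (intro compact_imp_bounded compact_continuous_image disc_alg_vec_cont u) simp
  then obtain Bu where Bu: "0 < Bu" "\<And>z. z \<in> cball 0 1 \<Longrightarrow> norm (u z) \<le> Bu" unfolding bounded_pos by auto
  \<comment> \<open>The three contributions are the quotient of \<open>f\<close>, the variation of
    the quotient \<open>X h\<close> against the size of \<open>u\<close>, and the size of
    \<open>X h\<close> against the Hoelder constant of \<open>u\<close>. The last one is why
    \<open>regularity_0\<close> has to come first.\<close>
  define M where "M = Cf + (CA * Bu + LA * Cu)"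
  have M: "0 < M" unfolding M_def using Cf CA Bu LA Cu by (simp add: add_pos_pos)
  obtain K where K: "0 < K" and
    hd: "\<And>u F f M z w. holder_solution \<alpha> M u F f \<Longrightarrow> z \<in> cball 0 1 \<Longrightarrow> w \<in> cball 0 1
     \<Longrightarrow> norm (u z - u w) \<le> K * (M + norm (u 0)) * cmod (z - w) powr \<alpha>"
    using holder_on_disc[OF alpha] by blast
  define Q where "Q h v z = (v (cis h * z) - v z) /\<^sub>R h" for h and v :: "complex \<Rightarrow> complex ^ 'n" and z
  have Qdisc: "disc_alg_vec (Q h v)" if "disc_alg_vec v" for h v
  proof -
    have "disc_alg_vec (\<lambda>z. v (cis h * z))"
      using that unfolding disc_alg_vec_def by (auto intro: disc_alg_rotate)
    thus ?thesis unfolding Q_def by (intro disc_alg_vec_intros that)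
  qed
  define X where "X h \<zeta> = (A (cis h * \<zeta>) - A \<zeta>) /\<^sub>R h" for h \<zeta>
  \<comment> \<open>The discrete product rule: the symbol multiplying \<open>Q h u\<close> stays
    unrotated, so the rotated argument of \<open>u\<close> goes with the quotient of the
    symbol.\<close>
  define g where "g h \<zeta> = Q h f \<zeta> + X h \<zeta> (u (cis h * \<zeta>))" for h \<zeta>
  have rot: "cis h * \<zeta> \<in> sphere 0 1" if "\<zeta> \<in> sphere 0 1" for h \<zeta>
    using that by (simp add: norm_mult)
  have Qeq: "Q h F \<zeta> = A \<zeta> (Q h u \<zeta>) + g h \<zeta>" if \<zeta>: "\<zeta> \<in> sphere 0 1" for h \<zeta>
    unfolding Q_def g_def X_def eq[OF \<zeta>] eq[OF rot[OF \<zeta>]]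
    by (simp add: blinfun.diff_left blinfun.diff_right blinfun.scaleR_left blinfun.scaleR_right
        scaleR_diff_right scaleR_add_right algebra_simps)
  have ghol: "norm (g h \<zeta> - g h \<eta>) \<le> M * cmod (\<zeta> - \<eta>) powr \<alpha>"
    if h: "0 < h" and \<zeta>: "\<zeta> \<in> sphere 0 1" and \<eta>: "\<eta> \<in> sphere 0 1" for h \<zeta> \<eta>
  proof -
    let ?p = "cmod (\<zeta> - \<eta>) powr \<alpha>"
    have 1: "norm (Q h f \<zeta> - Q h f \<eta>) \<le> Cf * ?p"
      unfolding Q_def by (rule circle_quotient_bound[OF df Cf(2) h \<zeta> \<eta>])
    have 2: "norm (X h \<zeta> - X h \<eta>) \<le> CA * ?p"
      unfolding X_def by (rule circle_quotient_bound[OF dA CA(2) h \<zeta> \<eta>])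
    have 3: "norm (X h \<eta>) \<le> LA"
    proof -
      obtain t where t: "\<eta> = cis t" using circle_cisE[OF \<eta>] by metis
      have "norm (A (cis (h + t)) - A (cis t)) \<le> LA * \<bar>(h + t) - t\<bar>" by (rule LA)
      moreover have "X h \<eta> = (A (cis (h + t)) - A (cis t)) /\<^sub>R h" by (simp add: X_def t cis_mult)
      ultimately show ?thesis using h by (simp only: norm_scaleR) (simp add: field_simps)
    qed
    have 4: "norm (u (cis h * \<zeta>) - u (cis h * \<eta>)) \<le> Cu * ?p"
    proof -
      have "cmod (cis h * \<zeta> - cis h * \<eta>) = cmod (\<zeta> - \<eta>)"
        by (simp add: norm_mult flip: right_diff_distrib)
      thus ?thesis using Cu(2)[of "cis h * \<zeta>" "cis h * \<eta>"] rot[OF \<zeta>, of h] rot[OF \<eta>, of h] by simp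
    qed
    have "g h \<zeta> - g h \<eta> = (Q h f \<zeta> - Q h f \<eta>) +
        ((X h \<zeta> - X h \<eta>) (u (cis h * \<zeta>)) + X h \<eta> (u (cis h * \<zeta>) - u (cis h * \<eta>)))"
      by (simp add: g_def blinfun.diff_left blinfun.diff_right)
    also have "norm \<dots> \<le> norm (Q h f \<zeta> - Q h f \<eta>) +
        (norm (X h \<zeta> - X h \<eta>) * norm (u (cis h * \<zeta>)) + norm (X h \<eta>) * norm (u (cis h * \<zeta>) - u (cis h * \<eta>)))"
      by (intro norm_triangle_mono norm_blinfun order_refl)
    also have "\<dots> \<le> Cf * ?p + ((CA * ?p) * Bu + LA * (Cu * ?p))"
      using 1 2 3 4 CA LA Bu rot[OF \<zeta>, of h] by (intro add_mono mult_mono) auto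
    also have "\<dots> = M * ?p" by (simp add: M_def algebra_simps)
    finally show ?thesis .
  qed
  have Q0: "Q h u 0 = 0" for h by (simp add: Q_def)
  have Qhol: "cmod (Q h u z $ i - Q h u w $ i) \<le> K * M * cmod (z - w) powr \<alpha>"
    if h: "0 < h" and zw: "z \<in> cball 0 1" "w \<in> cball 0 1" for h z w i
  proof -
    have "holder_solution \<alpha> M (Q h u) (Q h F) (g h)"
      unfolding holder_solution_def using Qdisc[OF u] Qdisc[OF F] Qeq M ghol[OF h] by blast
    from hd[OF this zw] have "norm (Q h u z - Q h u w) \<le> K * M * cmod (z - w) powr \<alpha>"
      by (simp add: Q0)
    moreover have "cmod (Q h u z $ i - Q h u w $ i) \<le> norm (Q h u z - Q h u w)"
      using Finite_Cartesian_Product.norm_nth_le[of "Q h u z - Q h u w" i] by simp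
    ultimately show ?thesis by linarith
  qed
  define v where "v i z = \<i> * z * deriv (\<lambda>z. u z $ i) z" for i z
  have ui: "disc_alg (\<lambda>z. u z $ i)" for i using u by (rule disc_alg_vec_nth)
  have vholo: "v i holomorphic_on ball 0 1" for i
    unfolding v_def by (intro holomorphic_intros holomorphic_deriv disc_alg_holo ui open_ball)
  have vhol: "cmod (v i z - v i w) \<le> K * M * cmod (z - w) powr \<alpha>"
    if zw: "z \<in> ball 0 1" "w \<in> ball 0 1" for i z w
  proof -
    define h where "h n = 1 / real (Suc n)" for n
    have h: "h \<longlonglongrightarrow> 0" "\<And>n. 0 < h n"
      unfolding h_def using LIMSEQ_inverse_real_of_nat by (auto simp: inverse_eq_divide)
    have Ql: "(\<lambda>n. Q (h n) u z $ i) \<longlonglongrightarrow> v i z" if "z \<in> ball 0 1" for z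
    proof -
      have "(\<lambda>n. (u (cis (h n) * z) $ i - u z $ i) / of_real (h n)) \<longlonglongrightarrow> v i z"
        unfolding v_def using h(2)
        by (intro circle_difference_quotient[where G = "\<lambda>z. u z $ i"] disc_alg_holo ui that h(1))
           (simp add: less_imp_neq[symmetric])
      moreover have "(u (cis (h n) * z) $ i - u z $ i) / of_real (h n) = Q (h n) u z $ i" for n
        by (simp add: Q_def scaleR_conv_of_real[where 'a=complex] divide_inverse mult.commute)
      ultimately show ?thesis by simp
    qed
    have "(\<lambda>n. cmod (Q (h n) u z $ i - Q (h n) u w $ i)) \<longlonglongrightarrow> cmod (v i z - v i w)"
      by (intro tendsto_intros Ql zw)
    moreover have "cmod (Q (h n) u z $ i - Q (h n) u w $ i) \<le> K * M * cmod (z - w) powr \<alpha>" for n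
      by (rule Qhol[OF h(2)]) (use zw in auto)
    ultimately show ?thesis by (intro LIMSEQ_le_const2) auto
  qed
  have "\<exists>V. disc_alg V \<and> (\<forall>t. ((\<lambda>t. u (cis t) $ i) has_vector_derivative V (cis t)) (at t))" for i
  proof -
    obtain V where V: "disc_alg V" "\<And>z. z \<in> ball 0 1 \<Longrightarrow> V z = v i z"
      using holder_extension[OF vholo alpha(1) vhol] by metis
    obtain E where E: "\<And>z. z \<in> cball 0 1 \<Longrightarrow> ((\<lambda>z. u z $ i) has_field_derivative E z) (at z within cball 0 1)"
      "\<And>z. z \<in> cball 0 1 \<Longrightarrow> V z = \<i> * z * E z"
      using disc_alg_closed_disc_derivative[OF ui disc_alg_cont[OF V(1)]] V(2)
      unfolding v_def by metis
    have "((\<lambda>t. u (cis t) $ i) has_vector_derivative V (cis t)) (at t)" for t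
      using circle_chain[OF E(1)[of "cis t"]] E(2)[of "cis t"] by simp
    thus ?thesis using V(1) by blast
  qed
  then obtain V where V: "\<And>i. disc_alg (V i)"
    "\<And>i t. ((\<lambda>t. u (cis t) $ i) has_vector_derivative V i (cis t)) (at t)" by metis
  define V' where "V' z = (\<chi> i. V i z)" for z
  have V': "disc_alg_vec V'" using V(1) by (simp add: disc_alg_vec_def V'_def)
  have du: "((\<lambda>t. u (cis t)) has_vector_derivative V' (cis t)) (at t)" for t
    by (rule has_vector_derivative_vec) (simp add: V'_def V(2))
  define F1 where "F1 \<zeta> = A \<zeta> (V' \<zeta>) + (A1 \<zeta> (u \<zeta>) + f1 \<zeta>)" for \<zeta>
  have cF1: "continuous_on (sphere 0 1) F1"
    unfolding F1_def by (intro continuous_intros disc_alg_vec_cont_sphere u V' cf1 cA1)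
  have dF: "((\<lambda>t. F (cis t)) has_vector_derivative F1 (cis t)) (at t)" for t
  proof -
    have "((\<lambda>t. A (cis t) (u (cis t)) + f (cis t)) has_vector_derivative
        (A (cis t) (V' (cis t)) + A1 (cis t) (u (cis t))) + f1 (cis t)) (at t)"
      by (intro has_vector_derivative_add df bounded_bilinear.has_vector_derivative[OF bounded_bilinear_blinfun_apply] dA du)
    moreover have "(\<lambda>t. A (cis t) (u (cis t)) + f (cis t)) = (\<lambda>t. F (cis t))"
      by (rule ext) (simp add: eq)
    ultimately show ?thesis by (simp add: F1_def add.assoc)
  qed
  have "\<exists>W. disc_alg W \<and> (\<forall>\<zeta>\<in>sphere 0 1. W \<zeta> = F1 \<zeta> $ i)" for i
  proof -
    have "((\<lambda>t. F (cis t) $ i) has_vector_derivative F1 (cis t) $ i) (at t)" for t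
      by (rule bounded_linear.has_vector_derivative[OF bounded_linear_vec_nth dF])
    moreover have "continuous_on (sphere 0 1) (\<lambda>\<zeta>. F1 \<zeta> $ i)" by (intro continuous_intros cF1)
    ultimately show ?thesis
      using disc_alg_circle_derivative[OF disc_alg_vec_nth[OF F], of i "\<lambda>\<zeta>. F1 \<zeta> $ i"] by metis
  qed
  then obtain W where W: "\<And>i. disc_alg (W i)" "\<And>i \<zeta>. \<zeta> \<in> sphere 0 1 \<Longrightarrow> W i \<zeta> = F1 \<zeta> $ i" by metis
  show ?thesis
  proof (rule that[OF V' _ du])
    show "disc_alg_vec (\<lambda>z. \<chi> i. W i z)" using W(1) by (simp add: disc_alg_vec_def)
    show "(\<chi> i. W i \<zeta>) = A \<zeta> (V' \<zeta>) + (A1 \<zeta> (u \<zeta>) + f1 \<zeta>)" if "\<zeta> \<in> sphere 0 1" for \<zeta>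
      using W(2)[OF that] by (simp add: vec_eq_iff F1_def)
  qed
qed

text \<open>The induction hypothesis is used twice: for \<open>u\<close> itself, so that the
  differentiated data \<open>A1 \<zeta> (u \<zeta>) + f1 \<zeta>\<close> have order
  \<open>k\<close>, and then for the tangential derivative \<open>V\<close>.\<close>

lemma regularity:
  assumes alpha: "0 < \<alpha>" "\<alpha> < 1" and A: "holder_circle m \<alpha> A"
  shows "k \<le> m \<Longrightarrow> disc_alg_vec u \<Longrightarrow> disc_alg_vec F \<Longrightarrow> (\<And>\<zeta>. \<zeta> \<in> sphere 0 1 \<Longrightarrow> F \<zeta> = A \<zeta> (u \<zeta>) + f \<zeta>) \<Longrightarrow>
     holder_circle k \<alpha> f \<Longrightarrow> holder_circle k \<alpha> u"
proof (induction k arbitrary: u F f)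
  case 0
  obtain C where C: "0 < C"
    "\<And>z w. z \<in> cball 0 1 \<Longrightarrow> w \<in> cball 0 1 \<Longrightarrow> norm (u z - u w) \<le> C * cmod (z - w) powr \<alpha>"
    using regularity_0[OF alpha 0(2,3,4,5)] by blast
  show ?case by (rule holder_circle_0I[of _ C]) (use C alpha in auto)
next
  case (Suc k)
  have al: "0 < \<alpha>" "\<alpha> \<le> 1" using alpha by auto
  obtain f1 where f1: "holder_circle k \<alpha> f1"
    "\<And>\<theta>. ((\<lambda>t. f (cis t)) has_vector_derivative f1 (cis \<theta>)) (at \<theta>)"
    using Suc.prems holder_circle_SucE by blast
  have "holder_circle (Suc k) \<alpha> A" using holder_circle_mono[OF al _ A] Suc.prems by blast
  then obtain A1 where A1: "holder_circle k \<alpha> A1"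
    "\<And>\<theta>. ((\<lambda>t. A (cis t)) has_vector_derivative A1 (cis \<theta>)) (at \<theta>)"
    using holder_circle_SucE by blast
  have f10: "holder_circle 0 \<alpha> f1" and A10: "holder_circle 0 \<alpha> A1"
    using holder_circle_mono[OF al _ f1(1)] holder_circle_mono[OF al _ A1(1)] by simp_all
  obtain V W where VW: "disc_alg_vec V" "disc_alg_vec W"
    "\<And>t. ((\<lambda>t. u (cis t)) has_vector_derivative V (cis t)) (at t)"
    "\<And>\<zeta>. \<zeta> \<in> sphere 0 1 \<Longrightarrow> W \<zeta> = A \<zeta> (V \<zeta>) + (A1 \<zeta> (u \<zeta>) + f1 \<zeta>)"
    using differentiated_solution[OF alpha Suc.prems(2,3,4) f1(2) f10 A1(2) A10] by blast
  have "holder_circle k \<alpha> u"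
    using Suc.prems holder_circle_Suc_lower[OF al] by (intro Suc.IH[of u F f]) auto
  hence "holder_circle k \<alpha> (\<lambda>\<zeta>. A1 \<zeta> (u \<zeta>) + f1 \<zeta>)"
    by (intro holder_circle_add f1 holder_circle_bilinear[OF bounded_bilinear_blinfun_apply al] A1)
  hence "holder_circle k \<alpha> V"
    using Suc.prems(1) by (intro Suc.IH[OF _ VW(1,2,4)]) auto
  thus ?case using VW(3) by (rule holder_circle_SucI)
qed

end

section \<open>Functions without negative Fourier coefficients\<close>

text \<open>On the circle this is the de la Vallee Poussin kernel: with \<open>w = cis t\<close> it
  is a power of \<open>2 * cos (t/2)\<close>, normalised by the central binomial coefficient. It is
  nonnegative and a trigonometric polynomial, and its second moment is explicit.\<close>

definition fejer_type :: "nat \<Rightarrow> complex \<Rightarrow> real" where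
  "fejer_type n w = cmod (1 + w) ^ (2 * n) / real ((2 * n) choose n)"

lemma fejer_type_nonneg: "0 \<le> fejer_type n w"
  by (simp add: fejer_type_def)

text \<open>For \<open>w\<close> on the circle the squared modulus of \<open>1 + w\<close> is
  \<open>(1 + w)\<^sup>2 * cnj w\<close>, so the kernel is a binomial expansion shifted by
  \<open>n\<close>.\<close>

lemma fejer_type_expand:
  assumes w: "w * cnj w = 1"
  shows "of_real (fejer_type n w) =
    (\<Sum>j\<le>2*n. of_real (real ((2*n) choose j) / real ((2*n) choose n)) * (if j < n then cnj w ^ (n - j) else w ^ (j - n)))"
proof -
  have "of_real ((cmod (1 + w))\<^sup>2) = (1 + w) * (w * cnj w + cnj w)"
    by (simp only: complex_norm_square w complex_cnj_add complex_cnj_one)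
  also have "\<dots> = (1 + w)\<^sup>2 * cnj w" by (simp add: power2_eq_square algebra_simps)
  finally have sq: "of_real ((cmod (1 + w))\<^sup>2) = (1 + w)\<^sup>2 * cnj w" .
  have "of_real (cmod (1 + w) ^ (2 * n)) = ((1 + w)\<^sup>2 * cnj w) ^ n"
    unfolding sq[symmetric] by (simp add: power_mult)
  also have "\<dots> = (w + 1) ^ (2 * n) * cnj w ^ n"
    by (simp add: power_mult_distrib power_mult add.commute)
  also have "(w + 1) ^ (2 * n) = (\<Sum>j\<le>2*n. of_nat ((2*n) choose j) * w ^ j * 1 ^ (2*n - j))"
    by (rule binomial_ring)
  also have "\<dots> * cnj w ^ n = (\<Sum>j\<le>2*n. of_nat ((2*n) choose j) * (w ^ j * cnj w ^ n))"
    by (simp add: sum_distrib_right mult.assoc)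
  also have "\<dots> = (\<Sum>j\<le>2*n. of_nat ((2*n) choose j) * (if j < n then cnj w ^ (n - j) else w ^ (j - n)))"
  proof (rule sum.cong[OF refl])
    fix j
    have wc: "w ^ i * cnj w ^ i = 1" for i using w by (simp flip: power_mult_distrib)
    have "w ^ j * cnj w ^ n = (if j < n then cnj w ^ (n - j) else w ^ (j - n))"
    proof (cases "j < n")
      case True
      hence "cnj w ^ n = cnj w ^ j * cnj w ^ (n - j)" by (simp flip: power_add)
      thus ?thesis using True wc[of j] by (simp add: mult.assoc[symmetric])
    next
      case False
      hence "w ^ j = w ^ (j - n) * w ^ n" by (simp flip: power_add)
      thus ?thesis using False wc[of n] by (simp add: mult.assoc)
    qed
    thus "of_nat ((2*n) choose j) * (w ^ j * cnj w ^ n) =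
        of_nat ((2*n) choose j) * (if j < n then cnj w ^ (n - j) else w ^ (j - n))" by simp
  qed
  finally show ?thesis
    by (simp add: fejer_type_def sum_divide_distrib)
qed

lemma cmean_power_0: "0 < k \<Longrightarrow> cmean (\<lambda>\<zeta>. \<zeta> ^ k) = 0"
  using cmean_disc_alg[OF disc_alg_power[OF disc_alg_ident], of k] by simp

lemma cmean_cnj_power_0:
  assumes "0 < k"
  shows "cmean (\<lambda>\<zeta>. cnj \<zeta> ^ k) = 0"
proof -
  have "cmean (\<lambda>\<zeta>. cnj (\<zeta> ^ k)) = cnj (cmean (\<lambda>\<zeta>. \<zeta> ^ k))"
    by (intro cmean_cnj continuous_intros)
  thus ?thesis using cmean_power_0[OF assms] by simp
qed

text \<open>The hypothesis \<open>orth\<close> says that the Fourier coefficients of negative index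
  vanish. They are the ones that the terms with \<open>j < n\<close> pick out, so the convolution is
  a polynomial in \<open>z\<close>.\<close>

lemma fejer_type_conv:
  assumes \<phi>: "continuous_on (sphere 0 1) \<phi>" and orth: "\<And>k. 0 < k \<Longrightarrow> cmean (\<lambda>\<zeta>. \<zeta> ^ k * \<phi> \<zeta>) = 0"
    and z: "z \<in> sphere 0 1"
  shows "cmean (\<lambda>\<eta>. of_real (fejer_type n (z * cnj \<eta>)) * \<phi> \<eta>) =
    (\<Sum>j\<le>2*n. if j < n then 0 else
       of_real (real ((2*n) choose j) / real ((2*n) choose n)) * cmean (\<lambda>\<eta>. cnj \<eta> ^ (j - n) * \<phi> \<eta>) * z ^ (j - n))"
proof -
  define C where "C j = complex_of_real (real ((2*n) choose j) / real ((2*n) choose n))" for j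
  define T where "T j \<eta> = (if j < n then (C j * cnj z ^ (n - j)) * (\<eta> ^ (n - j) * \<phi> \<eta>)
      else (C j * z ^ (j - n)) * (cnj \<eta> ^ (j - n) * \<phi> \<eta>))" for j \<eta>
  have cT: "continuous_on (sphere 0 1) (T j)" for j
    unfolding T_def by (cases "j < n") (auto intro!: continuous_intros \<phi>)
  have "cmean (\<lambda>\<eta>. of_real (fejer_type n (z * cnj \<eta>)) * \<phi> \<eta>) = cmean (\<lambda>\<eta>. \<Sum>j\<le>2*n. T j \<eta>)"
  proof (rule cmean_cong)
    fix \<eta> :: complex assume \<eta>: "\<eta> \<in> sphere 0 1"
    have "z * cnj z = 1" "\<eta> * cnj \<eta> = 1" using z \<eta> by (simp_all add: complex_norm_square[symmetric])
    moreover have "(z * cnj \<eta>) * cnj (z * cnj \<eta>) = (z * cnj z) * (\<eta> * cnj \<eta>)" by (simp add: mult_ac)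
    ultimately have "(z * cnj \<eta>) * cnj (z * cnj \<eta>) = 1" by simp
    from fejer_type_expand[OF this, of n]
    show "of_real (fejer_type n (z * cnj \<eta>)) * \<phi> \<eta> = (\<Sum>j\<le>2*n. T j \<eta>)"
      by (simp only: sum_distrib_right) (auto intro!: sum.cong simp: T_def C_def power_mult_distrib)
  qed
  also have "\<dots> = (\<Sum>j\<le>2*n. cmean (T j))" by (intro cmean_sum cT) auto
  also have "\<dots> = (\<Sum>j\<le>2*n. if j < n then 0 else C j * cmean (\<lambda>\<eta>. cnj \<eta> ^ (j - n) * \<phi> \<eta>) * z ^ (j - n))"
  proof (rule sum.cong[OF refl])
    fix j
    show "cmean (T j) = (if j < n then 0 else C j * cmean (\<lambda>\<eta>. cnj \<eta> ^ (j - n) * \<phi> \<eta>) * z ^ (j - n))"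
    proof (cases "j < n")
      case True
      have "cmean (T j) = (C j * cnj z ^ (n - j)) * cmean (\<lambda>\<eta>. \<eta> ^ (n - j) * \<phi> \<eta>)"
        unfolding T_def using True by (simp only: if_True) (intro cmean_mult_left continuous_intros \<phi>)
      thus ?thesis using True orth[of "n - j"] by simp
    next
      case False
      have "cmean (T j) = (C j * z ^ (j - n)) * cmean (\<lambda>\<eta>. cnj \<eta> ^ (j - n) * \<phi> \<eta>)"
        unfolding T_def using False by (simp only: if_False) (intro cmean_mult_left continuous_intros \<phi>)
      thus ?thesis using False by simp
    qed
  qed
  finally show ?thesis by (simp only: C_def)
qed

lemma cmean_fejer_type:
  assumes z: "z \<in> sphere 0 1"
  shows "cmean (\<lambda>\<eta>. fejer_type n (z * cnj \<eta>)) = 1"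
proof -
  have c: "continuous_on (sphere 0 1) (\<lambda>\<eta>. fejer_type n (z * cnj \<eta>))"
    unfolding fejer_type_def by (intro continuous_intros) auto
  have "of_real (cmean (\<lambda>\<eta>. fejer_type n (z * cnj \<eta>))) = cmean (\<lambda>\<eta>. of_real (fejer_type n (z * cnj \<eta>)) * 1 :: complex)"
    by (simp add: cmean_of_real[OF c])
  also have "\<dots> = (\<Sum>j\<le>2*n. if j < n then 0 else
       of_real (real ((2*n) choose j) / real ((2*n) choose n)) * cmean (\<lambda>\<eta>. cnj \<eta> ^ (j - n) * 1) * z ^ (j - n))"
    by (rule fejer_type_conv[OF _ _ z]) (auto simp: cmean_power_0)
  also have "\<dots> = (\<Sum>j\<le>2*n. if j = n then 1 else 0)"
  proof (rule sum.cong[OF refl])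
    fix j assume "j \<in> {..2*n}"
    have "cmean (\<lambda>\<eta>. cnj \<eta> ^ (j - n)) = (0::complex)" if "n < j"
      using cmean_cnj_power_0[of "j - n"] that by simp
    thus "(if j < n then 0 else
       of_real (real ((2*n) choose j) / real ((2*n) choose n)) * cmean (\<lambda>\<eta>. cnj \<eta> ^ (j - n) * 1) * z ^ (j - n))
       = (if j = n then 1 else (0::complex))"
      by (cases j n rule: linorder_cases) auto
  qed
  also have "\<dots> = 1" by (simp add: sum.delta)
  finally show ?thesis using of_real_eq_1_iff by blast
qed

lemma central_binomial_Suc:
  "real ((2 * Suc n) choose Suc n) = (4 - 2 / real (Suc n)) * real ((2*n) choose n)"
proof -
  have f: "fact (2 * Suc n) = real (2 * n + 2) * real (2 * n + 1) * fact (2 * n)"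
    by (simp add: algebra_simps)
  have "real ((2 * Suc n) choose Suc n) = fact (2 * Suc n) / (fact (Suc n) * fact (2 * Suc n - Suc n))"
    by (rule binomial_fact) simp
  also have "2 * Suc n - Suc n = Suc n" by simp
  also have "fact (2 * Suc n) / (fact (Suc n) * fact (Suc n)) =
     (real (2 * n + 2) * real (2 * n + 1)) / (real (Suc n) * real (Suc n)) * (fact (2 * n) / (fact n * fact n))"
    unfolding f by (simp add: mult_ac)
  also have "(real (2 * n + 2) * real (2 * n + 1)) / (real (Suc n) * real (Suc n)) = 4 - 2 / real (Suc n)"
  proof -
    have "2 * x * (2 * x - 1) / (x * x) = 4 - 2 / x" if "0 < x" for x :: real
      using that by (simp add: field_simps)
    from this[of "real (Suc n)"] show ?thesis by (simp add: algebra_simps)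
  qed
  also have "fact (2 * n) / (fact n * fact n) = real ((2*n) choose n)"
    by (subst binomial_fact) simp_all
  finally show ?thesis .
qed

text \<open>By the parallelogram law the squared distance is 4 minus the squared modulus of
  \<open>1 + w\<close>, and multiplication by the latter raises the index of the kernel. The ratio
  of consecutive central binomial coefficients then gives the moment exactly.\<close>

lemma cmean_fejer_type_moment:
  assumes z: "z \<in> sphere 0 1"
  shows "cmean (\<lambda>\<eta>. fejer_type n (z * cnj \<eta>) * (cmod (\<eta> - z))\<^sup>2) = 2 / real (Suc n)"
proof -
  have c: "continuous_on (sphere 0 1) (\<lambda>\<eta>. fejer_type n (z * cnj \<eta>))" for n
    unfolding fejer_type_def by (intro continuous_intros) auto
  let ?c = "4 - 2 / real (Suc n)"
  have "cmean (\<lambda>\<eta>. fejer_type n (z * cnj \<eta>) * (cmod (\<eta> - z))\<^sup>2) =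
     cmean (\<lambda>\<eta>. 4 * fejer_type n (z * cnj \<eta>) - ?c * fejer_type (Suc n) (z * cnj \<eta>))"
  proof (rule cmean_cong)
    fix \<eta> :: complex assume \<eta>: "\<eta> \<in> sphere 0 1"
    let ?w = "z * cnj \<eta>"
    have \<eta>\<eta>: "\<eta> * cnj \<eta> = 1" using \<eta> by (simp add: complex_norm_square[symmetric])
    have "cmod (\<eta> - z) = cmod (\<eta> - z) * cmod (cnj \<eta>)" using \<eta> by simp
    also have "\<dots> = cmod (1 - ?w)" unfolding norm_mult[symmetric] left_diff_distrib \<eta>\<eta> ..
    finally have e1: "cmod (\<eta> - z) = cmod (1 - ?w)" .
    have w1: "cmod ?w = 1" using z \<eta> by (simp add: norm_mult)
    have "(cmod (1 - ?w))\<^sup>2 + (cmod (1 + ?w))\<^sup>2 = 2 + 2 * (cmod ?w)\<^sup>2"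
      unfolding cmod_power2 by (simp add: power2_eq_square algebra_simps)
    hence e2: "(cmod (\<eta> - z))\<^sup>2 = 4 - (cmod (1 + ?w))\<^sup>2" unfolding e1 w1 by simp
    have pos: "real ((2 * n) choose n) \<noteq> 0" "?c \<noteq> 0"
      by (auto simp: field_simps)
    have "?c * fejer_type (Suc n) ?w = (cmod (1 + ?w))\<^sup>2 * fejer_type n ?w"
      unfolding fejer_type_def central_binomial_Suc
      using pos by (simp add: power_add[symmetric] flip: power2_eq_square)
    thus "fejer_type n ?w * (cmod (\<eta> - z))\<^sup>2 = 4 * fejer_type n ?w - ?c * fejer_type (Suc n) ?w"
      unfolding e2 by (simp add: algebra_simps)
  qed
  also have "\<dots> = 4 * cmean (\<lambda>\<eta>. fejer_type n (z * cnj \<eta>)) - ?c * cmean (\<lambda>\<eta>. fejer_type (Suc n) (z * cnj \<eta>))"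
    by (subst cmean_diff; (intro continuous_intros c)?) (simp only: cmean_mult_left_real[OF c])
  also have "\<dots> = 2 / real (Suc n)" by (simp add: cmean_fejer_type[OF z])
  finally show ?thesis .
qed

text \<open>Korovkin's argument: a positive kernel of mean 1 with second moment tending to 0
  approximates continuous functions uniformly. Here the approximants \<open>Q n\<close> are
  polynomials, so their uniform limit on the circle extends holomorphically.\<close>

lemma disc_alg_extension:
  assumes \<phi>: "continuous_on (sphere 0 1) \<phi>" and orth: "\<And>k. 0 < k \<Longrightarrow> cmean (\<lambda>\<zeta>. \<zeta> ^ k * \<phi> \<zeta>) = 0"
  obtains G where "disc_alg G" "\<And>\<zeta>. \<zeta> \<in> sphere 0 1 \<Longrightarrow> G \<zeta> = \<phi> \<zeta>"
proof -
  have c: "continuous_on (sphere 0 1) (\<lambda>\<eta>. fejer_type n (z * cnj \<eta>))" for n z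
    unfolding fejer_type_def by (intro continuous_intros) auto
  define Q where "Q n z = (\<Sum>j\<le>2*n. if j < n then 0 else
       of_real (real ((2*n) choose j) / real ((2*n) choose n)) * cmean (\<lambda>\<eta>. cnj \<eta> ^ (j - n) * \<phi> \<eta>) * z ^ (j - n))" for n z
  have Q: "disc_alg (Q n)" for n
    unfolding Q_def
  proof (rule disc_alg_sum)
    fix j
    show "disc_alg (\<lambda>z. if j < n then 0 else
       of_real (real ((2*n) choose j) / real ((2*n) choose n)) * cmean (\<lambda>\<eta>. cnj \<eta> ^ (j - n) * \<phi> \<eta>) * z ^ (j - n))"
    proof (cases "j < n")
      case True
      thus ?thesis by simp
    next
      case False
      show ?thesis using False by (simp only: if_False) (intro disc_alg_intros)
    qed
  qed
  have app: "\<exists>N. \<forall>n\<ge>N. \<forall>z\<in>sphere 0 1. cmod (Q n z - \<phi> z) \<le> e" if e: "0 < e" for e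
  proof -
    have "uniformly_continuous_on (sphere 0 1) \<phi>" by (intro compact_uniformly_continuous \<phi>) simp
    then obtain d where d: "0 < d"
      "\<And>\<zeta> \<eta>. \<zeta> \<in> sphere 0 1 \<Longrightarrow> \<eta> \<in> sphere 0 1 \<Longrightarrow> dist \<eta> \<zeta> < d \<Longrightarrow> dist (\<phi> \<eta>) (\<phi> \<zeta>) < e/2"
      unfolding uniformly_continuous_on_def using e by (metis half_gt_zero)
    have "bounded (\<phi> ` sphere 0 1)" by (intro compact_imp_bounded compact_continuous_image \<phi>) simp
    then obtain B where B: "0 < B" "\<And>\<zeta>. \<zeta> \<in> sphere 0 1 \<Longrightarrow> cmod (\<phi> \<zeta>) \<le> B" unfolding bounded_pos by auto
    \<comment> \<open>Beyond distance \<open>d\<close> the quadratic term then exceeds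
      \<open>2 * B\<close>, the largest possible oscillation; within distance \<open>d\<close>
      uniform continuity is used.\<close>
    define K where "K = 2 * B / d\<^sup>2"
    have K: "0 < K" using B d by (simp add: K_def)
    have osc: "cmod (\<phi> \<eta> - \<phi> z) \<le> e/2 + K * (cmod (\<eta> - z))\<^sup>2" if "\<eta> \<in> sphere 0 1" "z \<in> sphere 0 1" for \<eta> z
    proof (cases "dist \<eta> z < d")
      case True
      have "0 \<le> K * (cmod (\<eta> - z))\<^sup>2" using K by simp
      thus ?thesis using d(2)[OF that(2,1) True] unfolding dist_norm by linarith
    next
      case False
      hence "d\<^sup>2 \<le> (cmod (\<eta> - z))\<^sup>2" using d(1) by (intro power_mono) (auto simp: dist_norm)
      hence "K * d\<^sup>2 \<le> K * (cmod (\<eta> - z))\<^sup>2" using K by simp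
      moreover have "cmod (\<phi> \<eta> - \<phi> z) \<le> 2 * B"
        using norm_triangle_ineq4[of "\<phi> \<eta>" "\<phi> z"] B(2)[OF that(1)] B(2)[OF that(2)] by linarith
      ultimately show ?thesis using e d by (simp add: K_def)
    qed
    obtain N where N: "4 * K / e < real N" using reals_Archimedean2 by blast
    show ?thesis
    proof (intro exI[of _ N] allI impI ballI)
      fix n and z :: complex assume n: "n \<ge> N" and z: "z \<in> sphere 0 1"
      have "Q n z - \<phi> z = cmean (\<lambda>\<eta>. of_real (fejer_type n (z * cnj \<eta>)) * (\<phi> \<eta> - \<phi> z))"
      proof -
        have "cmean (\<lambda>\<eta>. of_real (fejer_type n (z * cnj \<eta>)) * (\<phi> \<eta> - \<phi> z)) =
          cmean (\<lambda>\<eta>. of_real (fejer_type n (z * cnj \<eta>)) * \<phi> \<eta> - \<phi> z * of_real (fejer_type n (z * cnj \<eta>)))"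
          by (simp add: algebra_simps)
        also have "\<dots> = cmean (\<lambda>\<eta>. of_real (fejer_type n (z * cnj \<eta>)) * \<phi> \<eta>) -
            cmean (\<lambda>\<eta>. \<phi> z * of_real (fejer_type n (z * cnj \<eta>)))"
          by (intro cmean_diff continuous_intros c \<phi>)
        also have "cmean (\<lambda>\<eta>. \<phi> z * of_real (fejer_type n (z * cnj \<eta>))) = \<phi> z * of_real (cmean (\<lambda>\<eta>. fejer_type n (z * cnj \<eta>)))"
          by (subst cmean_mult_left, (intro continuous_intros c)+) (simp only: cmean_of_real[OF c])
        also have "cmean (\<lambda>\<eta>. of_real (fejer_type n (z * cnj \<eta>)) * \<phi> \<eta>) = Q n z"
          unfolding Q_def by (rule fejer_type_conv[OF \<phi> orth z])
        finally show ?thesis by (simp add: cmean_fejer_type[OF z])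
      qed
      also have "cmod \<dots> \<le> cmean (\<lambda>\<eta>. e/2 * fejer_type n (z * cnj \<eta>) + K * (fejer_type n (z * cnj \<eta>) * (cmod (\<eta> - z))\<^sup>2))"
      proof (rule norm_cmean_le)
        fix \<eta> :: complex assume \<eta>: "\<eta> \<in> sphere 0 1"
        have "fejer_type n (z * cnj \<eta>) * cmod (\<phi> \<eta> - \<phi> z) \<le> fejer_type n (z * cnj \<eta>) * (e/2 + K * (cmod (\<eta> - z))\<^sup>2)"
          by (intro mult_left_mono osc \<eta> z fejer_type_nonneg)
        moreover have "cmod (of_real (fejer_type n (z * cnj \<eta>)) * (\<phi> \<eta> - \<phi> z)) =
            fejer_type n (z * cnj \<eta>) * cmod (\<phi> \<eta> - \<phi> z)"
          using fejer_type_nonneg[of n "z * cnj \<eta>"] by (simp add: norm_mult)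
        ultimately show "cmod (of_real (fejer_type n (z * cnj \<eta>)) * (\<phi> \<eta> - \<phi> z)) \<le>
            e/2 * fejer_type n (z * cnj \<eta>) + K * (fejer_type n (z * cnj \<eta>) * (cmod (\<eta> - z))\<^sup>2)"
          by (simp only: distrib_left mult_ac)
      qed (intro continuous_intros c \<phi>)+
      also have "\<dots> = e/2 * cmean (\<lambda>\<eta>. fejer_type n (z * cnj \<eta>)) +
          K * cmean (\<lambda>\<eta>. fejer_type n (z * cnj \<eta>) * (cmod (\<eta> - z))\<^sup>2)"
        by (subst cmean_add cmean_mult_left_real, (intro continuous_intros c)+)+ (rule refl)
      also have "\<dots> = e/2 + K * (2 / real (Suc n))"
        by (simp add: cmean_fejer_type[OF z] cmean_fejer_type_moment[OF z])
      also have "K * (2 / real (Suc n)) \<le> e/2"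
      proof -
        have "4 * K / e < real (Suc n)" using N n by linarith
        thus ?thesis using e by (simp add: field_simps)
      qed
      finally show "cmod (Q n z - \<phi> z) \<le> e" by simp
    qed
  qed
  obtain G where G: "disc_alg G" "uniform_limit (cball 0 1) Q G sequentially"
  proof (rule disc_alg_uniform_limit[OF Q])
    fix e :: real assume "0 < e"
    then obtain N where N: "\<forall>n\<ge>N. \<forall>\<zeta>\<in>sphere 0 1. cmod (Q n \<zeta> - \<phi> \<zeta>) \<le> e/2"
      using app half_gt_zero by blast
    show "\<exists>N. \<forall>m n. m \<ge> N \<longrightarrow> n \<ge> N \<longrightarrow> (\<forall>\<zeta>\<in>sphere 0 1. cmod (Q m \<zeta> - Q n \<zeta>) \<le> e)"
    proof (intro exI[of _ N] allI impI ballI)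
      fix m n \<zeta> assume "m \<ge> N" "n \<ge> N" "\<zeta> \<in> sphere (0::complex) 1"
      thus "cmod (Q m \<zeta> - Q n \<zeta>) \<le> e"
        using N[rule_format, of m \<zeta>] N[rule_format, of n \<zeta>]
          norm_triangle_ineq4[of "Q m \<zeta> - \<phi> \<zeta>" "Q n \<zeta> - \<phi> \<zeta>"] by simp
    qed
  qed blast
  show ?thesis
  proof (rule that[OF G(1)])
    fix \<zeta> :: complex assume \<zeta>: "\<zeta> \<in> sphere 0 1"
    have "(\<lambda>n. Q n \<zeta>) \<longlonglongrightarrow> \<phi> \<zeta>"
    proof (rule LIMSEQ_I)
      fix r :: real assume r: "0 < r"
      then obtain N where "\<forall>n\<ge>N. \<forall>\<zeta>\<in>sphere 0 1. cmod (Q n \<zeta> - \<phi> \<zeta>) \<le> r/2" using app half_gt_zero by blast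
      thus "\<exists>N. \<forall>n\<ge>N. norm (Q n \<zeta> - \<phi> \<zeta>) < r"
        using \<zeta> r by (intro exI[of _ N]) fastforce
    qed
    moreover have "(\<lambda>n. Q n \<zeta>) \<longlonglongrightarrow> G \<zeta>" using tendsto_uniform_limitI[OF G(2), of \<zeta>] \<zeta> by simp
    ultimately show "G \<zeta> = \<phi> \<zeta>" using LIMSEQ_unique by blast
  qed
qed

text \<open>A Gaussian elimination step for a positive definite form that may fail to be symmetric.
  The vector \<open>e\<close> is the new basis vector corrected so that all equations indexed by
  \<open>I\<close> vanish on it. Its value \<open>s\<close> in the new equation is the quadratic
  form at \<open>e\<close>, hence positive, so a multiple of \<open>e\<close> repairs that equation
  without disturbing the others.\<close>

lemma posdef_solve:
  fixes b :: "'i \<Rightarrow> 'i \<Rightarrow> real"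
  assumes "finite I"
  shows "(\<And>r. (\<exists>i\<in>I. r i \<noteq> 0) \<Longrightarrow> 0 < (\<Sum>i\<in>I. \<Sum>j\<in>I. r i * r j * b j i)) \<Longrightarrow>
     \<exists>r. \<forall>i\<in>I. (\<Sum>j\<in>I. r j * b j i) = l i"
  using assms
proof (induction I arbitrary: l)
  case empty
  show ?case by simp
next
  case (insert x I)
  have ext: "(\<Sum>j\<in>I. (if j = x then y else r j) * c j) = (\<Sum>j\<in>I. r j * c j)" for y and r c :: "'i \<Rightarrow> real"
    by (intro sum.cong refl) (use insert.hyps in auto)
  have pd: "0 < (\<Sum>i\<in>I. \<Sum>j\<in>I. r i * r j * b j i)" if r: "\<exists>i\<in>I. r i \<noteq> 0" for r
  proof -
    define r' where "r' j = (if j = x then 0 else r j)" for j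
    have "\<exists>i\<in>insert x I. r' i \<noteq> 0" using r insert.hyps by (auto simp: r'_def)
    hence "0 < (\<Sum>i\<in>insert x I. \<Sum>j\<in>insert x I. r' i * r' j * b j i)" by (rule insert.prems)
    also have "\<dots> = (\<Sum>i\<in>I. \<Sum>j\<in>I. r' i * r' j * b j i)"
      using insert.hyps by (simp add: r'_def)
    also have "\<dots> = (\<Sum>i\<in>I. \<Sum>j\<in>I. r i * r j * b j i)"
      using insert.hyps by (intro sum.cong refl) (auto simp: r'_def)
    finally show ?thesis .
  qed
  obtain p where p: "\<forall>i\<in>I. (\<Sum>j\<in>I. p j * b j i) = b x i" using insert.IH[OF pd] by blast
  obtain q where q: "\<forall>i\<in>I. (\<Sum>j\<in>I. q j * b j i) = l i" using insert.IH[OF pd] by blast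
  define e where "e j = (if j = x then 1 else - p j)" for j
  define q' where "q' j = (if j = x then 0 else q j)" for j
  have e: "(\<Sum>j\<in>insert x I. e j * b j i) = b x i - (\<Sum>j\<in>I. p j * b j i)" for i
    using insert.hyps ext[of 1 "\<lambda>j. - p j" "\<lambda>j. b j i"] by (simp add: e_def sum_negf)
  have q': "(\<Sum>j\<in>insert x I. q' j * b j i) = (\<Sum>j\<in>I. q j * b j i)" for i
    using insert.hyps ext[of 0 q "\<lambda>j. b j i"] by (simp add: q'_def)
  define s where "s = (\<Sum>j\<in>insert x I. e j * b j x)"
  have "0 < (\<Sum>i\<in>insert x I. \<Sum>j\<in>insert x I. e i * e j * b j i)"
    by (rule insert.prems) (simp add: e_def)
  also have "\<dots> = (\<Sum>i\<in>insert x I. e i * (\<Sum>j\<in>insert x I. e j * b j i))"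
    by (simp only: sum_distrib_left mult.assoc)
  also have "\<dots> = e x * s + (\<Sum>i\<in>I. e i * (\<Sum>j\<in>insert x I. e j * b j i))"
    by (subst sum.insert[OF insert.hyps(1,2)]) (simp only: s_def)
  also have "(\<Sum>i\<in>I. e i * (\<Sum>j\<in>insert x I. e j * b j i)) = 0"
    unfolding e by (intro sum.neutral) (simp add: p)
  finally have s: "0 < s" by (simp add: e_def)
  define t where "t = (l x - (\<Sum>j\<in>I. q j * b j x)) / s"
  show ?case
  proof (intro exI[of _ "\<lambda>j. q' j + t * e j"] ballI)
    fix i assume i: "i \<in> insert x I"
    have "(\<Sum>j\<in>insert x I. (q' j + t * e j) * b j i) =
        (\<Sum>j\<in>insert x I. q' j * b j i) + t * (\<Sum>j\<in>insert x I. e j * b j i)"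
      by (simp only: distrib_right sum.distrib sum_distrib_left mult.assoc)
    also have "\<dots> = l i"
    proof (cases "i = x")
      case True
      thus ?thesis unfolding True q' s_def[symmetric] using s by (simp add: t_def)
    next
      case False
      hence "i \<in> I" using i by simp
      thus ?thesis unfolding q' e using p q by simp
    qed
    finally show "(\<Sum>j\<in>insert x I. (q' j + t * e j) * b j i) = l i" .
  qed
qed

section \<open>Galerkin approximation\<close>

text \<open>The sum starts at degree 1, which builds in the normalisation
  \<open>u 0 = 0\<close>.\<close>

definition vpoly :: "(nat \<Rightarrow> complex ^ 'n) \<Rightarrow> nat \<Rightarrow> complex \<Rightarrow> complex ^ 'n" where
  "vpoly c N z = (\<Sum>k=1..N. z ^ k *s c k)"

lemma vpoly_nth: "vpoly c N z $ i = (\<Sum>k=1..N. z ^ k * c k $ i)"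
  by (simp add: vpoly_def)

lemma disc_alg_vpoly: "disc_alg_vec (vpoly c N)"
  unfolding disc_alg_vec_def vpoly_nth by (intro allI disc_alg_intros)

lemma vpoly_0: "vpoly c N 0 = 0"
  by (auto simp: vec_eq_iff vpoly_nth intro!: sum.neutral)

lemma vpoly_circle_derivative:
  "((\<lambda>t. vpoly c N (cis t)) has_vector_derivative vpoly (\<lambda>k. (\<i> * of_nat k) *s c k) N (cis t)) (at t)"
proof (rule has_vector_derivative_vec)
  fix i
  have "((\<lambda>t. cis t ^ k) has_vector_derivative \<i> * of_nat k * cis t ^ k) (at t)" for k
  proof -
    have "((\<lambda>z::complex. z ^ k) has_field_derivative of_nat k * cis t ^ (k - 1)) (at (cis t))"
      by (auto intro!: derivative_eq_intros)
    from field_vector_diff_chain_at[OF has_vector_derivative_cis_at this]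
    have "((\<lambda>t. cis t ^ k) has_vector_derivative \<i> * cis t * (of_nat k * cis t ^ (k - 1))) (at t)"
      by (simp add: o_def)
    moreover have "\<i> * cis t * (of_nat k * cis t ^ (k - 1)) = \<i> * of_nat k * cis t ^ k"
      by (cases k) (simp_all add: mult_ac)
    ultimately show ?thesis by (simp only:)
  qed
  from bounded_linear.has_vector_derivative[OF bounded_linear_mult_left this]
  have "((\<lambda>t. cis t ^ k * c k $ i) has_vector_derivative (\<i> * of_nat k * cis t ^ k) * c k $ i) (at t)" for k .
  hence "((\<lambda>t. \<Sum>k=1..N. cis t ^ k * c k $ i) has_vector_derivative
      (\<Sum>k=1..N. (\<i> * of_nat k * cis t ^ k) * c k $ i)) (at t)"
    by (rule has_vector_derivative_sum)
  thus "((\<lambda>t. vpoly c N (cis t) $ i) has_vector_derivative vpoly (\<lambda>k. (\<i> * of_nat k) *s c k) N (cis t) $ i) (at t)"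
    by (simp add: vpoly_nth mult_ac)
qed

lemma cmean_vpoly_coeff:
  assumes "m \<in> {1..N}"
  shows "cmean (\<lambda>\<zeta>. cnj \<zeta> ^ m * vpoly c N \<zeta> $ i) = c m $ i"
proof -
  have t: "cmean (\<lambda>\<zeta>. cnj \<zeta> ^ m * (\<zeta> ^ k * c k $ i)) = (if k = m then c m $ i else 0)" for k
  proof -
    have "cmean (\<lambda>\<zeta>. cnj \<zeta> ^ m * (\<zeta> ^ k * c k $ i)) =
        cmean (\<lambda>\<zeta>. c k $ i * (if k < m then cnj \<zeta> ^ (m - k) else \<zeta> ^ (k - m)))"
    proof (rule cmean_cong)
      fix \<zeta> :: complex assume "\<zeta> \<in> sphere 0 1"
      hence 1: "\<zeta> * cnj \<zeta> = 1" by (simp add: complex_norm_square[symmetric])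
      have p: "\<zeta> ^ j * cnj \<zeta> ^ j = 1" for j using 1 by (simp flip: power_mult_distrib)
      have "cnj \<zeta> ^ m * \<zeta> ^ k = (if k < m then cnj \<zeta> ^ (m - k) else \<zeta> ^ (k - m))"
      proof (cases "k < m")
        case True
        hence "cnj \<zeta> ^ m = cnj \<zeta> ^ (m - k) * cnj \<zeta> ^ k" by (simp flip: power_add)
        thus ?thesis using True p[of k] by (simp add: mult_ac)
      next
        case False
        hence "\<zeta> ^ k = \<zeta> ^ m * \<zeta> ^ (k - m)" by (simp flip: power_add)
        thus ?thesis using False p[of m] by (simp add: mult.assoc[symmetric] mult.commute[of "cnj \<zeta> ^ m"])
      qed
      thus "cnj \<zeta> ^ m * (\<zeta> ^ k * c k $ i) = c k $ i * (if k < m then cnj \<zeta> ^ (m - k) else \<zeta> ^ (k - m))"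
        by (simp add: mult.assoc[symmetric] mult.commute)
    qed
    also have "\<dots> = c k $ i * cmean (\<lambda>\<zeta>. if k < m then cnj \<zeta> ^ (m - k) else \<zeta> ^ (k - m))"
      by (rule cmean_mult_left) (cases "k < m"; auto intro!: continuous_intros)
    also have "cmean (\<lambda>\<zeta>. if k < m then cnj \<zeta> ^ (m - k) else \<zeta> ^ (k - m)) = (if k = m then 1 else 0)"
      by (cases k m rule: linorder_cases) (simp_all add: cmean_power_0 cmean_cnj_power_0)
    finally show ?thesis by simp
  qed
  have "cmean (\<lambda>\<zeta>. cnj \<zeta> ^ m * vpoly c N \<zeta> $ i) = cmean (\<lambda>\<zeta>. \<Sum>k=1..N. cnj \<zeta> ^ m * (\<zeta> ^ k * c k $ i))"
    by (simp add: vpoly_nth sum_distrib_left)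
  also have "\<dots> = (\<Sum>k=1..N. cmean (\<lambda>\<zeta>. cnj \<zeta> ^ m * (\<zeta> ^ k * c k $ i)))"
    by (intro cmean_sum continuous_intros) auto
  also have "\<dots> = (\<Sum>k=1..N. if k = m then c m $ i else 0)" by (simp only: t)
  also have "\<dots> = c m $ i" using assms by (simp add: sum.delta)
  finally show ?thesis .
qed

context coercive_symbol
begin

text \<open>The problem is only real linear, so each monomial enters with the two coefficients 1 and
  \<open>\<i>\<close>. Testing with both gives the real and the imaginary part of every moment;
  coercivity makes the real system positive definite.\<close>

lemma galerkin:
  assumes f: "continuous_on (sphere 0 1) f"
  shows "\<exists>c. \<forall>k\<in>{1..N}. \<forall>i. cmean (\<lambda>\<zeta>. \<zeta> ^ k * (A \<zeta> (vpoly c N \<zeta>) + f \<zeta>) $ i) = 0"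
proof -
  define I where "I = {1..N} \<times> (UNIV :: 'n set) \<times> (UNIV :: bool set)"
  have fin: "finite I" by (simp add: I_def)
  define e :: "nat \<times> 'n \<times> bool \<Rightarrow> complex \<Rightarrow> complex ^ 'n" where
    "e p \<zeta> = \<zeta> ^ fst p *s axis (fst (snd p)) (if snd (snd p) then 1 else \<i>)" for p \<zeta>
  define Cf where "Cf r k = (\<chi> i. Complex (r (k, i, True)) (r (k, i, False)))" for r :: "nat \<times> 'n \<times> bool \<Rightarrow> real" and k
  have ce: "continuous_on (sphere 0 1) (e p)" for p
    unfolding e_def
    by (rule disc_alg_vec_cont_sphere, rule disc_alg_vec_cmult) (auto intro: disc_alg_intros disc_alg_vec_const)
  have cp: "continuous_on (sphere 0 1) (vpoly c N)" for c
    by (rule disc_alg_vec_cont_sphere[OF disc_alg_vpoly])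
  have U: "(\<Sum>p\<in>I. r p *\<^sub>R e p \<zeta>) = vpoly (Cf r) N \<zeta>" for r \<zeta>
  proof -
    have "(\<Sum>p\<in>I. r p *\<^sub>R e p \<zeta>) $ i' = vpoly (Cf r) N \<zeta> $ i'" for i'
    proof -
      have "(\<Sum>p\<in>I. r p *\<^sub>R e p \<zeta>) $ i' = (\<Sum>k=1..N. \<Sum>i\<in>UNIV. \<Sum>s\<in>UNIV. r (k, i, s) *\<^sub>R e (k, i, s) \<zeta> $ i')"
        unfolding I_def by (simp add: sum.cartesian_product' split_beta del: UNIV_Times_UNIV)
      also have "\<dots> = (\<Sum>k=1..N. \<zeta> ^ k * Cf r k $ i')"
      proof (rule sum.cong[OF refl])
        fix k
        have "(\<Sum>i\<in>UNIV. \<Sum>s\<in>UNIV. r (k, i, s) *\<^sub>R e (k, i, s) \<zeta> $ i') =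
            (\<Sum>i\<in>UNIV. if i = i' then \<zeta> ^ k * Cf r k $ i' else 0)"
        proof (rule sum.cong[OF refl])
          fix i
          show "(\<Sum>s\<in>UNIV. r (k, i, s) *\<^sub>R e (k, i, s) \<zeta> $ i') = (if i = i' then \<zeta> ^ k * Cf r k $ i' else 0)"
          proof (cases "i = i'")
            case True
            have "(\<Sum>s\<in>UNIV. r (k, i', s) *\<^sub>R e (k, i', s) \<zeta> $ i') =
                r (k, i', True) *\<^sub>R (\<zeta> ^ k) + r (k, i', False) *\<^sub>R (\<zeta> ^ k * \<i>)"
              by (simp add: e_def axis_def UNIV_bool)
            also have "\<dots> = \<zeta> ^ k * Cf r k $ i'"
              by (simp add: Cf_def Complex_eq scaleR_conv_of_real algebra_simps)
            finally show ?thesis using True by simp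
          qed (simp add: e_def axis_def)
        qed
        thus "(\<Sum>i\<in>UNIV. \<Sum>s\<in>UNIV. r (k, i, s) *\<^sub>R e (k, i, s) \<zeta> $ i') = \<zeta> ^ k * Cf r k $ i'" by simp
      qed
      finally show ?thesis by (simp add: vpoly_nth)
    qed
    thus ?thesis by (simp add: vec_eq_iff)
  qed
  \<comment> \<open>The first index is the trial function and the second the test function, in the
    order expected by \<open>posdef_solve\<close>.\<close>
  define b where "b j i = cmean (\<lambda>\<zeta>. Re (cdot (e i \<zeta>) (A \<zeta> (e j \<zeta>))))" for i j
  define l where "l i = - cmean (\<lambda>\<zeta>. Re (cdot (e i \<zeta>) (f \<zeta>)))" for i
  have lin: "(\<Sum>j\<in>I. r j * b j i) = cmean (\<lambda>\<zeta>. Re (cdot (e i \<zeta>) (A \<zeta> (vpoly (Cf r) N \<zeta>))))" for r i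
  proof -
    have "(\<Sum>j\<in>I. r j * b j i) = (\<Sum>j\<in>I. cmean (\<lambda>\<zeta>. r j * Re (cdot (e i \<zeta>) (A \<zeta> (e j \<zeta>)))))"
      unfolding b_def by (intro sum.cong refl cmean_mult_left_real[symmetric] continuous_intros ce)
    also have "\<dots> = cmean (\<lambda>\<zeta>. \<Sum>j\<in>I. r j * Re (cdot (e i \<zeta>) (A \<zeta> (e j \<zeta>))))"
      by (intro cmean_sum[symmetric] fin continuous_intros ce)
    also have "\<dots> = cmean (\<lambda>\<zeta>. Re (cdot (e i \<zeta>) (A \<zeta> (\<Sum>j\<in>I. r j *\<^sub>R e j \<zeta>))))"
      by (simp add: blinfun.sum_right blinfun.scaleR_right bounded_bilinear.sum_right[OF bounded_bilinear_cdot]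
          bounded_bilinear.scaleR_right[OF bounded_bilinear_cdot])
    finally show ?thesis by (simp only: U)
  qed
  have quad: "(\<Sum>i\<in>I. \<Sum>j\<in>I. r i * r j * b j i) = cmean (\<lambda>\<zeta>. Re (cdot (vpoly (Cf r) N \<zeta>) (A \<zeta> (vpoly (Cf r) N \<zeta>))))" for r
  proof -
    have "(\<Sum>i\<in>I. \<Sum>j\<in>I. r i * r j * b j i) = (\<Sum>i\<in>I. r i * (\<Sum>j\<in>I. r j * b j i))"
      by (simp only: sum_distrib_left mult.assoc)
    also have "\<dots> = (\<Sum>i\<in>I. cmean (\<lambda>\<zeta>. r i * Re (cdot (e i \<zeta>) (A \<zeta> (vpoly (Cf r) N \<zeta>)))))"
      unfolding lin by (intro sum.cong refl cmean_mult_left_real[symmetric] continuous_intros ce cp)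
    also have "\<dots> = cmean (\<lambda>\<zeta>. \<Sum>i\<in>I. r i * Re (cdot (e i \<zeta>) (A \<zeta> (vpoly (Cf r) N \<zeta>))))"
      by (intro cmean_sum[symmetric] fin continuous_intros ce cp)
    also have "\<dots> = cmean (\<lambda>\<zeta>. Re (cdot (\<Sum>i\<in>I. r i *\<^sub>R e i \<zeta>) (A \<zeta> (vpoly (Cf r) N \<zeta>))))"
      by (simp add: bounded_bilinear.sum_left[OF bounded_bilinear_cdot] bounded_bilinear.scaleR_left[OF bounded_bilinear_cdot])
    finally show ?thesis by (simp only: U)
  qed
  have pd: "0 < (\<Sum>i\<in>I. \<Sum>j\<in>I. r i * r j * b j i)" if r: "\<exists>i\<in>I. r i \<noteq> 0" for r
  proof (rule ccontr)
    let ?u = "vpoly (Cf r) N"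
    assume "\<not> ?thesis"
    moreover have "\<epsilon> * cmean (\<lambda>\<zeta>. (norm (?u \<zeta>))\<^sup>2) \<le> cmean (\<lambda>\<zeta>. Re (cdot (?u \<zeta>) (A \<zeta> (?u \<zeta>))))"
    proof -
      have "\<epsilon> * cmean (\<lambda>\<zeta>. (norm (?u \<zeta>))\<^sup>2) = cmean (\<lambda>\<zeta>. \<epsilon> * (norm (?u \<zeta>))\<^sup>2)"
        by (intro cmean_mult_left_real[symmetric] continuous_intros cp)
      also have "\<dots> \<le> cmean (\<lambda>\<zeta>. Re (cdot (?u \<zeta>) (A \<zeta> (?u \<zeta>))))"
        by (intro cmean_mono continuous_intros cp coercive)
      finally show ?thesis .
    qed
    ultimately have "\<epsilon> * cmean (\<lambda>\<zeta>. (norm (?u \<zeta>))\<^sup>2) \<le> 0" unfolding quad by linarith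
    hence "cmean (\<lambda>\<zeta>. (norm (?u \<zeta>))\<^sup>2) \<le> 0" using eps_pos by (simp add: mult_le_0_iff)
    moreover have "0 \<le> cmean (\<lambda>\<zeta>. (norm (?u \<zeta>))\<^sup>2)" by (intro cmean_nonneg continuous_intros cp) auto
    ultimately have "cmean (\<lambda>\<zeta>. (norm (?u \<zeta>))\<^sup>2) = 0" by linarith
    hence z: "(norm (?u \<zeta>))\<^sup>2 = 0" if "\<zeta> \<in> sphere 0 1" for \<zeta>
      by (rule cmean_eq_0_imp[rotated 2, OF _ that]) (auto intro!: continuous_intros cp)
    \<comment> \<open>The coefficients are Fourier coefficients of the polynomial, so a polynomial
      vanishing on the circle has none.\<close>
    have "Cf r k $ i = 0" if "k \<in> {1..N}" for k i
    proof -
      have "Cf r k $ i = cmean (\<lambda>\<zeta>. cnj \<zeta> ^ k * ?u \<zeta> $ i)" by (rule cmean_vpoly_coeff[OF that, symmetric])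
      also have "\<dots> = cmean (\<lambda>\<zeta>. 0)" by (rule cmean_cong) (use z in simp)
      finally show ?thesis by simp
    qed
    hence "r (k, i, s) = 0" if "k \<in> {1..N}" for k i s
      using that by (cases s) (auto simp: Cf_def complex_eq_iff)
    thus False using r by (auto simp: I_def)
  qed
  obtain r where r: "\<forall>i\<in>I. (\<Sum>j\<in>I. r j * b j i) = l i"
    using posdef_solve[OF fin, of b l] pd by blast
  let ?F = "\<lambda>\<zeta>. A \<zeta> (vpoly (Cf r) N \<zeta>) + f \<zeta>"
  have cF: "continuous_on (sphere 0 1) ?F" by (intro continuous_intros cp f)
  have re: "Re (cmean (\<lambda>\<zeta>. cdot (e p \<zeta>) (?F \<zeta>))) = 0" if "p \<in> I" for p
  proof -
    have "Re (cmean (\<lambda>\<zeta>. cdot (e p \<zeta>) (?F \<zeta>))) = cmean (\<lambda>\<zeta>. Re (cdot (e p \<zeta>) (?F \<zeta>)))"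
      by (rule cmean_Re[symmetric]) (intro continuous_intros ce cp f)
    also have "\<dots> = cmean (\<lambda>\<zeta>. Re (cdot (e p \<zeta>) (A \<zeta> (vpoly (Cf r) N \<zeta>))) + Re (cdot (e p \<zeta>) (f \<zeta>)))"
      by (simp add: cdot_add_right)
    also have "\<dots> = (\<Sum>j\<in>I. r j * b j p) - l p"
    proof -
      have "cmean (\<lambda>\<zeta>. Re (cdot (e p \<zeta>) (A \<zeta> (vpoly (Cf r) N \<zeta>))) + Re (cdot (e p \<zeta>) (f \<zeta>))) =
          cmean (\<lambda>\<zeta>. Re (cdot (e p \<zeta>) (A \<zeta> (vpoly (Cf r) N \<zeta>)))) + cmean (\<lambda>\<zeta>. Re (cdot (e p \<zeta>) (f \<zeta>)))"
        by (intro cmean_add continuous_intros ce cp f)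
      thus ?thesis unfolding lin l_def by simp
    qed
    finally show ?thesis using r that by simp
  qed
  have ed: "cdot (e (k, i, s) \<zeta>) v = (if s then 1 else \<i>) * (\<zeta> ^ k * v $ i)" for k i s \<zeta> v
  proof -
    have "cdot (e (k, i, s) \<zeta>) v = (\<Sum>j\<in>UNIV. if j = i then (if s then 1 else \<i>) * (\<zeta> ^ k * v $ i) else 0)"
      unfolding cdot_def by (intro sum.cong refl) (auto simp: e_def axis_def)
    thus ?thesis by simp
  qed
  show ?thesis
  proof (intro exI[of _ "Cf r"] ballI allI)
    fix k i assume k: "k \<in> {1..N}"
    let ?m = "cmean (\<lambda>\<zeta>. \<zeta> ^ k * ?F \<zeta> $ i)"
    have "(k, i, s) \<in> I" for s using k by (simp add: I_def)
    note rek = re[OF this, unfolded ed]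
    have "Re ?m = 0" using rek[of True] by (simp only: if_True mult_1)
    moreover have "cmean (\<lambda>\<zeta>. \<i> * (\<zeta> ^ k * ?F \<zeta> $ i)) = \<i> * ?m"
      by (rule cmean_mult_left) (intro continuous_intros cF)
    hence "Im ?m = 0" using rek[of False] by (simp only: if_False Re_i_times neg_equal_0_iff_equal)
    ultimately show "?m = 0" by (rule complex_eqI[of ?m 0, unfolded zero_complex.simps])
  qed
qed

text \<open>The polynomial space is closed under tangential differentiation. Hence
  \<open>u2\<close>, the derivative of \<open>u1\<close>, is admissible as a test function, and
  integration by parts gives the energy identity for \<open>u1\<close> with \<open>F1\<close>, the
  derivative of \<open>F\<close>. The bound \<open>D\<close> does not depend on the degree.\<close>

lemma galerkin_bound:
  assumes f: "continuous_on (sphere 0 1) f" and f1: "continuous_on (sphere 0 1) f1"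
    and df: "\<And>t. ((\<lambda>t. f (cis t)) has_vector_derivative f1 (cis t)) (at t)"
    and A1: "continuous_on (sphere 0 1) A1"
    and dA: "\<And>t. ((\<lambda>t. A (cis t)) has_vector_derivative A1 (cis t)) (at t)"
  shows "\<exists>D. \<forall>N. \<exists>c. (\<forall>k\<in>{1..N}. \<forall>i. cmean (\<lambda>\<zeta>. \<zeta> ^ k * (A \<zeta> (vpoly c N \<zeta>) + f \<zeta>) $ i) = 0) \<and>
        cmean (\<lambda>\<zeta>. (norm (vpoly (\<lambda>k. (\<i> * of_nat k) *s c k) N \<zeta>))\<^sup>2) \<le> D"
proof -
  have "bounded (A1 ` sphere 0 1)" "bounded (f1 ` sphere 0 1)"
    by (intro compact_imp_bounded compact_continuous_image A1 f1; simp)+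
  then obtain B B' where B: "0 < B" "\<And>\<zeta>. \<zeta> \<in> sphere 0 1 \<Longrightarrow> norm (A1 \<zeta>) \<le> B"
    and B': "0 < B'" "\<And>\<zeta>. \<zeta> \<in> sphere 0 1 \<Longrightarrow> norm (f1 \<zeta>) \<le> B'"
    unfolding bounded_pos by auto
  define D0 where "D0 = cmean (\<lambda>\<zeta>. (norm (f \<zeta>))\<^sup>2) / \<epsilon>\<^sup>2"
  define D where "D = (2 * B\<^sup>2 * D0 + 2 * B'\<^sup>2) / \<epsilon>\<^sup>2"
  show ?thesis
  proof (intro exI[of _ D] allI)
    fix N
    obtain c where c: "\<And>k i. k \<in> {1..N} \<Longrightarrow> cmean (\<lambda>\<zeta>. \<zeta> ^ k * (A \<zeta> (vpoly c N \<zeta>) + f \<zeta>) $ i) = 0"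
      using galerkin[OF f] by blast
    define u where "u = vpoly c N"
    define u1 where "u1 = vpoly (\<lambda>k. (\<i> * of_nat k) *s c k) N"
    define u2 where "u2 = vpoly (\<lambda>k. (\<i> * of_nat k) *s ((\<i> * of_nat k) *s c k)) N"
    define F where "F \<zeta> = A \<zeta> (u \<zeta>) + f \<zeta>" for \<zeta>
    have cu: "continuous_on (sphere 0 1) u" "continuous_on (sphere 0 1) u1" "continuous_on (sphere 0 1) u2"
      unfolding u_def u1_def u2_def by (intro disc_alg_vec_cont_sphere disc_alg_vpoly)+
    have cF: "continuous_on (sphere 0 1) F" unfolding F_def by (intro continuous_intros cu f)
    have orth: "cmean (\<lambda>\<zeta>. cdot (vpoly d N \<zeta>) (F \<zeta>)) = 0" for d
    proof -
      have "cmean (\<lambda>\<zeta>. cdot (vpoly d N \<zeta>) (F \<zeta>)) =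
          cmean (\<lambda>\<zeta>. \<Sum>i\<in>UNIV. \<Sum>k=1..N. d k $ i * (\<zeta> ^ k * F \<zeta> $ i))"
      proof (rule cmean_cong)
        fix \<zeta>
        have "(\<Sum>k=1..N. \<zeta> ^ k * d k $ i) * F \<zeta> $ i = (\<Sum>k=1..N. d k $ i * (\<zeta> ^ k * F \<zeta> $ i))" for i
          unfolding sum_distrib_right by (intro sum.cong refl) simp
        thus "cdot (vpoly d N \<zeta>) (F \<zeta>) = (\<Sum>i\<in>UNIV. \<Sum>k=1..N. d k $ i * (\<zeta> ^ k * F \<zeta> $ i))"
          by (simp only: cdot_def vpoly_nth)
      qed
      also have "\<dots> = (\<Sum>i\<in>UNIV. \<Sum>k=1..N. d k $ i * cmean (\<lambda>\<zeta>. \<zeta> ^ k * F \<zeta> $ i))"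
      proof -
        have "cmean (\<lambda>\<zeta>. \<Sum>i\<in>UNIV. \<Sum>k=1..N. d k $ i * (\<zeta> ^ k * F \<zeta> $ i)) =
            (\<Sum>i\<in>UNIV. cmean (\<lambda>\<zeta>. \<Sum>k=1..N. d k $ i * (\<zeta> ^ k * F \<zeta> $ i)))"
          by (intro cmean_sum finite_class.finite_UNIV continuous_intros cF)
        also have "\<dots> = (\<Sum>i\<in>UNIV. \<Sum>k=1..N. cmean (\<lambda>\<zeta>. d k $ i * (\<zeta> ^ k * F \<zeta> $ i)))"
          by (intro sum.cong refl cmean_sum finite_atLeastAtMost continuous_intros cF)
        also have "\<dots> = (\<Sum>i\<in>UNIV. \<Sum>k=1..N. d k $ i * cmean (\<lambda>\<zeta>. \<zeta> ^ k * F \<zeta> $ i))"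
          by (intro sum.cong refl cmean_mult_left continuous_intros cF)
        finally show ?thesis .
      qed
      also have "\<dots> = 0" using c by (auto intro!: sum.neutral simp: F_def u_def)
      finally show ?thesis .
    qed
    have du: "((\<lambda>t. u (cis t)) has_vector_derivative u1 (cis t)) (at t)" for t
      unfolding u_def u1_def by (rule vpoly_circle_derivative)
    have du1: "((\<lambda>t. u1 (cis t)) has_vector_derivative u2 (cis t)) (at t)" for t
      unfolding u1_def u2_def by (rule vpoly_circle_derivative)
    define F1 where "F1 \<zeta> = A \<zeta> (u1 \<zeta>) + (A1 \<zeta> (u \<zeta>) + f1 \<zeta>)" for \<zeta>
    have cF1: "continuous_on (sphere 0 1) F1" unfolding F1_def by (intro continuous_intros cu f1 A1)
    have dF: "((\<lambda>t. F (cis t)) has_vector_derivative F1 (cis t)) (at t)" for t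
    proof -
      have "((\<lambda>t. A (cis t) (u (cis t)) + f (cis t)) has_vector_derivative
          (A (cis t) (u1 (cis t)) + A1 (cis t) (u (cis t))) + f1 (cis t)) (at t)"
        by (intro has_vector_derivative_add df bounded_bilinear.has_vector_derivative[OF bounded_bilinear_blinfun_apply] dA du)
      thus ?thesis by (simp add: F_def[abs_def] F1_def add.assoc)
    qed
    have L2: "cmean (\<lambda>\<zeta>. (norm (u \<zeta>))\<^sup>2) \<le> D0"
    proof -
      have "\<epsilon>\<^sup>2 * cmean (\<lambda>\<zeta>. 1 * (norm (u \<zeta>))\<^sup>2) \<le> cmean (\<lambda>\<zeta>. 1 * (norm (f \<zeta>))\<^sup>2)"
        by (rule energy) (use orth[of c, folded u_def] in \<open>auto intro!: continuous_intros cu f simp: F_def\<close>)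
      thus ?thesis using eps_pos by (simp add: D0_def field_simps)
    qed
    \<comment> \<open>Integration by parts: the integrand is the angular derivative of
      \<open>cdot (u1 \<zeta>) (F \<zeta>)\<close>.\<close>
    have "cmean (\<lambda>\<zeta>. cdot (u1 \<zeta>) (F1 \<zeta>) + cdot (u2 \<zeta>) (F \<zeta>)) = 0"
      by (rule cmean_circle_derivative[where \<phi> = "\<lambda>\<zeta>. cdot (u1 \<zeta>) (F \<zeta>)"])
         (rule bounded_bilinear.has_vector_derivative[OF bounded_bilinear_cdot du1 dF])
    also have "cmean (\<lambda>\<zeta>. cdot (u1 \<zeta>) (F1 \<zeta>) + cdot (u2 \<zeta>) (F \<zeta>)) =
        cmean (\<lambda>\<zeta>. cdot (u1 \<zeta>) (F1 \<zeta>)) + cmean (\<lambda>\<zeta>. cdot (u2 \<zeta>) (F \<zeta>))"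
      by (intro cmean_add continuous_intros cu cF cF1)
    also have "cmean (\<lambda>\<zeta>. cdot (u2 \<zeta>) (F \<zeta>)) = 0" unfolding u2_def by (rule orth)
    finally have o1: "cmean (\<lambda>\<zeta>. cdot (u1 \<zeta>) (F1 \<zeta>)) = 0" by simp
    have "\<epsilon>\<^sup>2 * cmean (\<lambda>\<zeta>. 1 * (norm (u1 \<zeta>))\<^sup>2) \<le> cmean (\<lambda>\<zeta>. 1 * (norm (A1 \<zeta> (u \<zeta>) + f1 \<zeta>))\<^sup>2)"
      by (rule energy) (use o1 in \<open>auto intro!: continuous_intros cu f1 A1 simp: F1_def\<close>)
    also have "\<dots> \<le> cmean (\<lambda>\<zeta>. 2 * B\<^sup>2 * (norm (u \<zeta>))\<^sup>2 + 2 * B'\<^sup>2)"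
    proof (rule cmean_mono)
      fix \<zeta> :: complex assume \<zeta>: "\<zeta> \<in> sphere 0 1"
      have "norm (A1 \<zeta> (u \<zeta>) + f1 \<zeta>) \<le> B * norm (u \<zeta>) + B'"
        using B(2)[OF \<zeta>] B'(2)[OF \<zeta>] norm_blinfun[of "A1 \<zeta>" "u \<zeta>"]
          mult_right_mono[OF B(2)[OF \<zeta>], of "norm (u \<zeta>)"]
        by (intro order_trans[OF norm_triangle_ineq add_mono]) auto
      hence "(norm (A1 \<zeta> (u \<zeta>) + f1 \<zeta>))\<^sup>2 \<le> (B * norm (u \<zeta>) + B')\<^sup>2" by (rule power_mono) simp
      also have "\<dots> \<le> 2 * B\<^sup>2 * (norm (u \<zeta>))\<^sup>2 + 2 * B'\<^sup>2"
      proof -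
        have "0 \<le> (B * norm (u \<zeta>) - B')\<^sup>2" by simp
        thus ?thesis by (simp add: power2_eq_square algebra_simps)
      qed
      finally show "1 * (norm (A1 \<zeta> (u \<zeta>) + f1 \<zeta>))\<^sup>2 \<le> 2 * B\<^sup>2 * (norm (u \<zeta>))\<^sup>2 + 2 * B'\<^sup>2" by simp
    qed (intro continuous_intros cu f1 A1)+
    also have "\<dots> = 2 * B\<^sup>2 * cmean (\<lambda>\<zeta>. (norm (u \<zeta>))\<^sup>2) + 2 * B'\<^sup>2"
      by (subst cmean_add, (intro continuous_intros cu)+, subst cmean_mult_left_real, (intro continuous_intros cu)+)
         simp
    also have "\<dots> \<le> 2 * B\<^sup>2 * D0 + 2 * B'\<^sup>2" using L2 by (simp add: mult_left_mono)
    finally have "cmean (\<lambda>\<zeta>. (norm (u1 \<zeta>))\<^sup>2) \<le> D"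
      using eps_pos by (simp add: D_def field_simps)
    thus "\<exists>c. (\<forall>k\<in>{1..N}. \<forall>i. cmean (\<lambda>\<zeta>. \<zeta> ^ k * (A \<zeta> (vpoly c N \<zeta>) + f \<zeta>) $ i) = 0) \<and>
        cmean (\<lambda>\<zeta>. (norm (vpoly (\<lambda>k. (\<i> * of_nat k) *s c k) N \<zeta>))\<^sup>2) \<le> D"
      using c unfolding u1_def by blast
  qed
qed

end

text \<open>The one-dimensional Sobolev embedding, with Young's inequality at parameter
  \<open>r = sqrt (s - t)\<close> in the role of Cauchy-Schwarz.\<close>

lemma sqrt_modulus_of_energy:
  fixes u u1 :: "complex \<Rightarrow> complex ^ 'n"
  assumes du: "\<And>t. ((\<lambda>t. u (cis t)) has_vector_derivative u1 (cis t)) (at t)"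
    and u1: "continuous_on (sphere 0 1) u1" and D: "cmean (\<lambda>\<zeta>. (norm (u1 \<zeta>))\<^sup>2) \<le> D"
    and st: "0 \<le> t" "t \<le> s" "s \<le> 2 * pi"
  shows "norm (u (cis s) - u (cis t)) \<le> (pi * D + 1) * sqrt (s - t)"
proof (cases "s = t")
  case False
  define r where "r = sqrt (s - t)"
  have r: "0 < r" "r * r = s - t" using st False by (auto simp: r_def)
  have c2: "continuous_on (sphere 0 1) (\<lambda>\<zeta>. (norm (u1 \<zeta>))\<^sup>2)" by (intro continuous_intros u1)
  note int2 = integrable_circle_cis[OF c2]
  have "((\<lambda>\<tau>. u1 (cis \<tau>)) has_integral (u (cis s) - u (cis t))) {t..s}"
    using st du by (intro fundamental_theorem_of_calculus) (auto intro: has_vector_derivative_at_within)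
  hence "u (cis s) - u (cis t) = integral {t..s} (\<lambda>\<tau>. u1 (cis \<tau>))" by (simp add: integral_unique)
  also have "norm \<dots> \<le> integral {t..s} (\<lambda>\<tau>. r/2 * (norm (u1 (cis \<tau>)))\<^sup>2 + 1 / (2*r))"
  proof (rule integral_norm_bound_integral)
    show "(\<lambda>\<tau>. u1 (cis \<tau>)) integrable_on {t..s}" by (rule integrable_circle_cis[OF u1])
    show "(\<lambda>\<tau>. r/2 * (norm (u1 (cis \<tau>)))\<^sup>2 + 1 / (2*r)) integrable_on {t..s}"
      by (intro integrable_add integrable_on_mult_right int2 integrable_const_ivl)
    fix \<tau>
    show "norm (u1 (cis \<tau>)) \<le> r/2 * (norm (u1 (cis \<tau>)))\<^sup>2 + 1 / (2*r)"
      using young_mult[OF r(1), of "norm (u1 (cis \<tau>))" 1] by (simp add: field_simps)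
  qed
  also have "\<dots> = r/2 * integral {t..s} (\<lambda>\<tau>. (norm (u1 (cis \<tau>)))\<^sup>2) + (s - t) * (1 / (2*r))"
    using st by (subst integral_add) (auto intro!: integrable_on_mult_right int2)
  also have "integral {t..s} (\<lambda>\<tau>. (norm (u1 (cis \<tau>)))\<^sup>2) \<le> integral {0..2*pi} (\<lambda>\<tau>. (norm (u1 (cis \<tau>)))\<^sup>2)"
    using st by (intro integral_subset_le int2) auto
  also have "\<dots> = 2 * pi * cmean (\<lambda>\<zeta>. (norm (u1 \<zeta>))\<^sup>2)" by (simp add: cmean_def)
  also have "\<dots> \<le> 2 * pi * D" using D by simp
  finally have "norm (u (cis s) - u (cis t)) \<le> r/2 * (2 * pi * D) + (s - t) * (1 / (2*r))"
    using r by simp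
  also have "\<dots> = (pi * D + 1/2) * r" unfolding r(2)[symmetric] using r(1) by (simp add: field_simps)
  also have "\<dots> \<le> (pi * D + 1) * r" using r(1) by (intro mult_right_mono) auto
  finally show ?thesis by (simp add: r_def)
qed simp

section \<open>Existence and zeros of solutions\<close>

lemma disc_alg_vec_zero:
  assumes "disc_alg_vec u" "\<And>\<zeta>. \<zeta> \<in> sphere 0 1 \<Longrightarrow> u \<zeta> = 0" "z \<in> cball 0 1"
  shows "u z = 0"
proof -
  have "cmod (u z $ i) \<le> 0" for i
    by (rule disc_alg_max[OF disc_alg_vec_nth[OF assms(1)] _ assms(3)]) (simp add: assms(2))
  thus ?thesis by (simp add: vec_eq_iff)
qed

lemma disc_alg_vec_uniform_limit:
  fixes U :: "nat \<Rightarrow> complex \<Rightarrow> complex ^ 'n"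
  assumes U: "\<And>n. disc_alg_vec (U n)"
    and cau: "\<And>e. e > 0 \<Longrightarrow> \<exists>N. \<forall>m n. m \<ge> N \<longrightarrow> n \<ge> N \<longrightarrow> (\<forall>\<zeta>\<in>sphere 0 1. norm (U m \<zeta> - U n \<zeta>) \<le> e)"
  obtains u where "disc_alg_vec u"
    "\<And>e. e > 0 \<Longrightarrow> \<exists>N. \<forall>n\<ge>N. \<forall>z\<in>cball 0 1. norm (U n z - u z) \<le> e"
proof -
  have "\<exists>\<phi>. disc_alg \<phi> \<and> uniform_limit (cball 0 1) (\<lambda>n z. U n z $ i) \<phi> sequentially" for i
  proof -
    obtain \<phi> where "disc_alg \<phi>" "uniform_limit (cball 0 1) (\<lambda>n z. U n z $ i) \<phi> sequentially"
    proof (rule disc_alg_uniform_limit[of "\<lambda>n z. U n z $ i"])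
      show "disc_alg (\<lambda>z. U n z $ i)" for n by (rule disc_alg_vec_nth[OF U])
      fix e :: real assume "0 < e"
      then obtain N where N: "\<forall>m n. m \<ge> N \<longrightarrow> n \<ge> N \<longrightarrow> (\<forall>\<zeta>\<in>sphere 0 1. norm (U m \<zeta> - U n \<zeta>) \<le> e)"
        using cau by blast
      have "cmod (U m \<zeta> $ i - U n \<zeta> $ i) \<le> norm (U m \<zeta> - U n \<zeta>)" for m n \<zeta>
        using Finite_Cartesian_Product.norm_nth_le[of "U m \<zeta> - U n \<zeta>" i] by simp
      thus "\<exists>N. \<forall>m n. m \<ge> N \<longrightarrow> n \<ge> N \<longrightarrow> (\<forall>\<zeta>\<in>sphere 0 1. cmod (U m \<zeta> $ i - U n \<zeta> $ i) \<le> e)"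
        using N by (meson order_trans)
    qed blast
    thus ?thesis by blast
  qed
  then obtain \<phi> where \<phi>: "\<And>i. disc_alg (\<phi> i)"
    "\<And>i. uniform_limit (cball 0 1) (\<lambda>n z. U n z $ i) (\<phi> i) sequentially" by metis
  show ?thesis
  proof (rule that[of "\<lambda>z. \<chi> i. \<phi> i z"])
    show "disc_alg_vec (\<lambda>z. \<chi> i. \<phi> i z)" using \<phi>(1) by (simp add: disc_alg_vec_def)
    fix e :: real assume e: "0 < e"
    define e' where "e' = e / real CARD('n)"
    have e': "0 < e'" using e by (simp add: e'_def)
    have "\<forall>\<^sub>F n in sequentially. \<forall>i. \<forall>z\<in>cball 0 1. dist (U n z $ i) (\<phi> i z) < e'"
      by (intro eventually_all_finite uniform_limitD[OF \<phi>(2) e'])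
    then obtain N where N: "\<And>n i z. n \<ge> N \<Longrightarrow> z \<in> cball 0 1 \<Longrightarrow> dist (U n z $ i) (\<phi> i z) < e'"
      unfolding eventually_sequentially by blast
    show "\<exists>N. \<forall>n\<ge>N. \<forall>z\<in>cball 0 1. norm (U n z - (\<chi> i. \<phi> i z)) \<le> e"
    proof (intro exI[of _ N] allI impI ballI)
      fix n and z :: complex assume nz: "n \<ge> N" "z \<in> cball 0 1"
      have "norm (U n z - (\<chi> i. \<phi> i z)) \<le> real CARD('n) * e'"
        by (rule norm_vec_le_card_mult) (use N[OF nz] in \<open>simp add: dist_norm less_imp_le\<close>)
      thus "norm (U n z - (\<chi> i. \<phi> i z)) \<le> e" by (simp add: e'_def)
    qed
  qed
qed

context coercive_symbol
begin

lemma solution_exists: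
  assumes f: "continuous_on (sphere 0 1) f" and f1: "continuous_on (sphere 0 1) f1"
    and df: "\<And>t. ((\<lambda>t. f (cis t)) has_vector_derivative f1 (cis t)) (at t)"
    and A1: "continuous_on (sphere 0 1) A1"
    and dA: "\<And>t. ((\<lambda>t. A (cis t)) has_vector_derivative A1 (cis t)) (at t)"
  obtains u F where "disc_alg_vec u" "disc_alg_vec F" "u 0 = 0"
    "\<And>\<zeta>. \<zeta> \<in> sphere 0 1 \<Longrightarrow> F \<zeta> = A \<zeta> (u \<zeta>) + f \<zeta>"
proof -
  obtain D c where c: "\<And>N k i. k \<in> {1..N} \<Longrightarrow> cmean (\<lambda>\<zeta>. \<zeta> ^ k * (A \<zeta> (vpoly (c N) N \<zeta>) + f \<zeta>) $ i) = 0"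
    and D: "\<And>N. cmean (\<lambda>\<zeta>. (norm (vpoly (\<lambda>k. (\<i> * of_nat k) *s c N k) N \<zeta>))\<^sup>2) \<le> D"
  proof -
    obtain D where D: "\<forall>N. \<exists>c. (\<forall>k\<in>{1..N}. \<forall>i. cmean (\<lambda>\<zeta>. \<zeta> ^ k * (A \<zeta> (vpoly c N \<zeta>) + f \<zeta>) $ i) = 0) \<and>
        cmean (\<lambda>\<zeta>. (norm (vpoly (\<lambda>k. (\<i> * of_nat k) *s c k) N \<zeta>))\<^sup>2) \<le> D"
      using galerkin_bound[OF f f1 df A1 dA] by (rule exE)
    from choice[OF D] obtain c where c: "\<forall>N. (\<forall>k\<in>{1..N}. \<forall>i. cmean (\<lambda>\<zeta>. \<zeta> ^ k * (A \<zeta> (vpoly (c N) N \<zeta>) + f \<zeta>) $ i) = 0) \<and>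
        cmean (\<lambda>\<zeta>. (norm (vpoly (\<lambda>k. (\<i> * of_nat k) *s c N k) N \<zeta>))\<^sup>2) \<le> D"
      by (rule exE)
    show ?thesis
      by (rule that[of c D]) (use c in simp_all)
  qed
  define U where "U N = vpoly (c N) N" for N
  have U: "disc_alg_vec (U N)" for N unfolding U_def by (rule disc_alg_vpoly)
  define K where "K = pi * D + 1"
  \<comment> \<open>The instance of degree 0 shows that \<open>D\<close> is nonnegative, so that
    \<open>K\<close> is positive.\<close>
  have "0 \<le> cmean (\<lambda>\<zeta>. (norm (vpoly (\<lambda>k. (\<i> * of_nat k) *s c 0 k) 0 \<zeta>))\<^sup>2)"
    by (intro cmean_nonneg continuous_intros disc_alg_vec_cont_sphere disc_alg_vpoly) simp
  also have "\<dots> \<le> D" by (rule D)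
  finally have K: "0 < K" unfolding K_def by (simp add: add_nonneg_pos)
  have osc: "norm (U N (cis s) - U N (cis t)) \<le> K * sqrt \<bar>s - t\<bar>"
    if "s \<in> {0..2*pi}" "t \<in> {0..2*pi}" for N s t
  proof -
    have *: "norm (U N (cis s) - U N (cis t)) \<le> K * sqrt (s - t)" if "0 \<le> t" "t \<le> s" "s \<le> 2 * pi" for s t
      unfolding U_def K_def
      by (rule sqrt_modulus_of_energy[OF vpoly_circle_derivative _ D that])
         (rule disc_alg_vec_cont_sphere[OF disc_alg_vpoly])
    show ?thesis
      using *[of t s] *[of s t] that by (cases "t \<le> s") (auto simp: norm_minus_commute)
  qed
  \<comment> \<open>The approximants vanish at 0 and so have mean 0 on the circle; their size is
    therefore bounded by their oscillation.\<close>
  have bd: "norm (U N (cis t)) \<le> K * sqrt (2 * pi)" if t: "t \<in> {0..2*pi}" for N t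
  proof -
    have cU: "continuous_on (sphere 0 1) (U N)" by (rule disc_alg_vec_cont_sphere[OF U])
    have "cmean (U N) $ i = 0" for i
      unfolding cmean_nth[OF cU, symmetric]
      by (subst cmean_disc_alg[OF disc_alg_vec_nth[OF U]]) (simp add: U_def vpoly_0)
    hence "cmean (U N) = 0" by (simp add: vec_eq_iff)
    hence "U N (cis t) = cmean (\<lambda>\<zeta>. U N (cis t) - U N \<zeta>)"
      by (simp add: cmean_diff cU)
    also have "norm \<dots> \<le> cmean (\<lambda>\<zeta>. K * sqrt (2 * pi))"
    proof (rule norm_cmean_le)
      fix \<zeta> :: complex assume "\<zeta> \<in> sphere 0 1"
      then obtain s where s: "s \<in> {0..2*pi}" "\<zeta> = cis s" by (rule circle_cisE)
      have "norm (U N (cis t) - U N \<zeta>) \<le> K * sqrt \<bar>t - s\<bar>" unfolding s(2) by (rule osc[OF t s(1)])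
      also have "\<dots> \<le> K * sqrt (2 * pi)" using K s t by (intro mult_left_mono) (auto simp: abs_if)
      finally show "norm (U N (cis t) - U N \<zeta>) \<le> K * sqrt (2 * pi)" .
    qed (intro continuous_intros cU)+
    finally show ?thesis by simp
  qed
  \<comment> \<open>The limit \<open>p\<close> depends on the angle and serves only to make the
    subsequence uniformly Cauchy; the holomorphic limit \<open>u\<close> is then supplied by the
    maximum principle.\<close>
  obtain p and \<kappa> :: "nat \<Rightarrow> nat" where \<kappa>: "strict_mono \<kappa>"
    and conv: "\<And>e. 0 < e \<Longrightarrow> \<exists>N. \<forall>n t. n \<ge> N \<and> t \<in> {0..2*pi} \<longrightarrow> norm (U (\<kappa> n) (cis t) - p t) < e"
  proof (rule Arzela_Ascoli[of "{0..2*pi}" "\<lambda>N t. U N (cis t)" "K * sqrt (2 * pi)"])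
    show "compact {0..2*pi}" by simp
    show "norm (U n (cis x)) \<le> K * sqrt (2 * pi)" if "x \<in> {0..2*pi}" for n x by (rule bd[OF that])
    fix x e :: real assume x: "x \<in> {0..2*pi}" and e: "0 < e"
    show "\<exists>d>0. \<forall>n y. y \<in> {0..2*pi} \<and> norm (x - y) < d \<longrightarrow> norm (U n (cis x) - U n (cis y)) < e"
    proof (intro exI[of _ "(e/K)\<^sup>2"] conjI allI impI)
      show "0 < (e/K)\<^sup>2" using e K by simp
      fix n y assume y: "y \<in> {0..2*pi} \<and> norm (x - y) < (e/K)\<^sup>2"
      have "norm (U n (cis x) - U n (cis y)) \<le> K * sqrt \<bar>x - y\<bar>" using osc[OF x, of y n] y by simp
      also have "sqrt \<bar>x - y\<bar> < e / K" using y e K by (intro real_less_lsqrt) auto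
      hence "K * sqrt \<bar>x - y\<bar> < e" using K by (simp add: field_simps)
      finally show "norm (U n (cis x) - U n (cis y)) < e" .
    qed
  qed blast
  obtain u where u: "disc_alg_vec u"
    and ulim: "\<And>e. e > 0 \<Longrightarrow> \<exists>N. \<forall>n\<ge>N. \<forall>z\<in>cball 0 1. norm (U (\<kappa> n) z - u z) \<le> e"
  proof (rule disc_alg_vec_uniform_limit[of "\<lambda>n. U (\<kappa> n)"])
    show "disc_alg_vec (U (\<kappa> n))" for n by (rule U)
    fix e :: real assume "0 < e"
    then obtain N where N: "\<And>n t. n \<ge> N \<Longrightarrow> t \<in> {0..2*pi} \<Longrightarrow> norm (U (\<kappa> n) (cis t) - p t) < e/2"
      using conv[of "e/2"] by (meson half_gt_zero)
    show "\<exists>N. \<forall>m n. m \<ge> N \<longrightarrow> n \<ge> N \<longrightarrow> (\<forall>\<zeta>\<in>sphere 0 1. norm (U (\<kappa> m) \<zeta> - U (\<kappa> n) \<zeta>) \<le> e)"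
    proof (intro exI[of _ N] allI impI ballI)
      fix m n and \<zeta> :: complex assume mn: "m \<ge> N" "n \<ge> N" and "\<zeta> \<in> sphere 0 1"
      then obtain t where t: "t \<in> {0..2*pi}" "\<zeta> = cis t" using circle_cisE by metis
      show "norm (U (\<kappa> m) \<zeta> - U (\<kappa> n) \<zeta>) \<le> e"
        using N[OF mn(1) t(1)] N[OF mn(2) t(1)] t(2)
          norm_triangle_ineq4[of "U (\<kappa> m) (cis t) - p t" "U (\<kappa> n) (cis t) - p t"] by simp
    qed
  qed blast
  have cu: "continuous_on (sphere 0 1) u" by (rule disc_alg_vec_cont_sphere[OF u])
  have "norm (u 0) \<le> e" if e: "0 < e" for e
  proof -
    obtain N where "\<forall>n\<ge>N. \<forall>z\<in>cball 0 1. norm (U (\<kappa> n) z - u z) \<le> e" using ulim[OF e] by blast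
    hence "norm (U (\<kappa> N) 0 - u 0) \<le> e" by simp
    thus ?thesis by (simp add: U_def vpoly_0)
  qed
  hence "norm (u 0) \<le> 0" by (rule field_le_epsilon) simp
  hence u0: "u 0 = 0" by simp
  define F where "F \<zeta> = A \<zeta> (u \<zeta>) + f \<zeta>" for \<zeta>
  have cF: "continuous_on (sphere 0 1) F" unfolding F_def by (intro continuous_intros cu f)
  have "bounded (A ` sphere 0 1)" by (intro compact_imp_bounded compact_continuous_image continuous_on_symbol) simp
  then obtain B where B: "0 < B" "\<And>\<zeta>. \<zeta> \<in> sphere 0 1 \<Longrightarrow> norm (A \<zeta>) \<le> B" unfolding bounded_pos by auto
  have orth: "cmean (\<lambda>\<zeta>. \<zeta> ^ j * F \<zeta> $ i) = 0" if j: "0 < j" for j i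
  proof -
    have "cmod (cmean (\<lambda>\<zeta>. \<zeta> ^ j * F \<zeta> $ i)) \<le> e" if e: "0 < e" for e
    proof -
      obtain N where N: "\<forall>n\<ge>N. \<forall>z\<in>cball 0 1. norm (U (\<kappa> n) z - u z) \<le> e / B"
        using ulim[of "e / B"] e B by auto
      \<comment> \<open>Since \<open>\<kappa> n\<close> is at least \<open>n\<close>, the degree of
        the approximant reaches \<open>j\<close>, and its moment of index \<open>j\<close>
        vanishes.\<close>
      define n where "n = max N j"
      have nj: "j \<in> {1..\<kappa> n}"
        using j seq_suble[OF \<kappa>, of n] by (auto simp: n_def)
      define G where "G \<zeta> = A \<zeta> (U (\<kappa> n) \<zeta>) + f \<zeta>" for \<zeta>
      have cG: "continuous_on (sphere 0 1) G"
        unfolding G_def by (intro continuous_intros disc_alg_vec_cont_sphere U f)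
      have "cmean (\<lambda>\<zeta>. \<zeta> ^ j * G \<zeta> $ i) = 0" using c[OF nj, of i] by (simp add: G_def U_def)
      hence "cmean (\<lambda>\<zeta>. \<zeta> ^ j * F \<zeta> $ i) = cmean (\<lambda>\<zeta>. \<zeta> ^ j * F \<zeta> $ i - \<zeta> ^ j * G \<zeta> $ i)"
        by (subst cmean_diff) (intro continuous_intros cF cG | simp)+
      also have "cmod \<dots> \<le> cmean (\<lambda>\<zeta>. e)"
      proof (rule norm_cmean_le)
        fix \<zeta> :: complex assume \<zeta>: "\<zeta> \<in> sphere 0 1"
        have "norm (u \<zeta> - U (\<kappa> n) \<zeta>) \<le> e / B"
          using N[rule_format, of n \<zeta>] \<zeta> by (simp add: n_def norm_minus_commute)
        have "\<zeta> ^ j * F \<zeta> $ i - \<zeta> ^ j * G \<zeta> $ i = \<zeta> ^ j * (A \<zeta> (u \<zeta> - U (\<kappa> n) \<zeta>) $ i)"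
          by (simp add: F_def G_def blinfun.diff_right algebra_simps)
        also have "cmod \<dots> \<le> norm (A \<zeta> (u \<zeta> - U (\<kappa> n) \<zeta>))"
          using \<zeta> Finite_Cartesian_Product.norm_nth_le[of "A \<zeta> (u \<zeta> - U (\<kappa> n) \<zeta>)" i]
          by (simp add: norm_mult norm_power)
        also have "\<dots> \<le> norm (A \<zeta>) * norm (u \<zeta> - U (\<kappa> n) \<zeta>)" by (rule norm_blinfun)
        also have "\<dots> \<le> B * (e / B)"
          using B(2)[OF \<zeta>] \<open>norm (u \<zeta> - U (\<kappa> n) \<zeta>) \<le> e / B\<close> B(1) by (intro mult_mono) auto
        finally show "cmod (\<zeta> ^ j * F \<zeta> $ i - \<zeta> ^ j * G \<zeta> $ i) \<le> e" using B(1) by simp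
      qed (intro continuous_intros cF cG)+
      finally show ?thesis by simp
    qed
    hence "cmod (cmean (\<lambda>\<zeta>. \<zeta> ^ j * F \<zeta> $ i)) \<le> 0" by (rule field_le_epsilon) simp
    thus ?thesis by simp
  qed
  have "\<exists>G. disc_alg G \<and> (\<forall>\<zeta>\<in>sphere 0 1. G \<zeta> = F \<zeta> $ i)" for i
  proof -
    have "continuous_on (sphere 0 1) (\<lambda>\<zeta>. F \<zeta> $ i)" by (intro continuous_intros cF)
    then obtain G where "disc_alg G" "\<And>\<zeta>. \<zeta> \<in> sphere 0 1 \<Longrightarrow> G \<zeta> = F \<zeta> $ i"
      using disc_alg_extension[OF _ orth] by blast
    thus ?thesis by blast
  qed
  then obtain G where G: "\<And>i. disc_alg (G i)" "\<And>i \<zeta>. \<zeta> \<in> sphere 0 1 \<Longrightarrow> G i \<zeta> = F \<zeta> $ i" by metis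
  show ?thesis
  proof (rule that[OF u _ u0])
    show "disc_alg_vec (\<lambda>z. \<chi> i. G i z)" using G(1) by (simp add: disc_alg_vec_def)
    show "(\<chi> i. G i \<zeta>) = A \<zeta> (u \<zeta>) + f \<zeta>" if "\<zeta> \<in> sphere 0 1" for \<zeta>
      using G(2)[OF that] by (simp add: vec_eq_iff F_def)
  qed
qed

section \<open>Vanishing of homogeneous solutions with prescribed zeros\<close>

lemma cdot_mean_zero_imp:
  assumes u: "disc_alg_vec u" and m: "cmean (\<lambda>\<zeta>. W \<zeta> * Re (cdot (u \<zeta>) (A \<zeta> (u \<zeta>)))) \<le> 0"
    and W: "continuous_on (sphere 0 1) W" "\<And>\<zeta>. \<zeta> \<in> sphere 0 1 \<Longrightarrow> 0 < W \<zeta>" and z: "z \<in> cball 0 1"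
  shows "u z = 0"
proof (rule disc_alg_vec_zero[OF u _ z])
  fix \<zeta> :: complex assume \<zeta>: "\<zeta> \<in> sphere 0 1"
  have cu: "continuous_on (sphere 0 1) u" by (rule disc_alg_vec_cont_sphere[OF u])
  let ?q = "\<lambda>\<zeta>. W \<zeta> * Re (cdot (u \<zeta>) (A \<zeta> (u \<zeta>)))"
  have cq: "continuous_on (sphere 0 1) ?q" by (intro continuous_intros W cu)
  have re: "0 \<le> Re (cdot (u \<zeta>) (A \<zeta> (u \<zeta>)))" if "\<zeta> \<in> sphere 0 1" for \<zeta>
    using coercive[OF that, of "u \<zeta>"] eps_pos by (meson order_trans mult_nonneg_nonneg less_imp_le zero_le_power2)
  have nn: "0 \<le> ?q \<zeta>" if "\<zeta> \<in> sphere 0 1" for \<zeta>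
    using re[OF that] W(2)[OF that] by simp
  have "0 \<le> cmean ?q" by (rule cmean_nonneg[OF cq nn])
  hence "cmean ?q = 0" using m by linarith
  hence "?q \<zeta> = 0" using cmean_eq_0_imp[OF cq nn _ \<zeta>] by blast
  hence "Re (cdot (u \<zeta>) (A \<zeta> (u \<zeta>))) = 0" using W(2)[OF \<zeta>] by simp
  hence "\<epsilon> * (norm (u \<zeta>))\<^sup>2 \<le> 0" using coercive[OF \<zeta>, of "u \<zeta>"] by simp
  thus "u \<zeta> = 0" using eps_pos by (simp add: mult_le_0_iff)
qed

text \<open>Near a boundary zero of \<^term>\<open>u\<close> the function \<^term>\<open>cdot (u z) (F z)\<close> is radially of order \<open>3/2\<close> by the
  Hoelder estimates, whereas its real part, nonnegative on the circle, decays at most linearly by Harnack's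
  inequality unless it vanishes identically.\<close>

lemma boundary_zero:
  assumes u: "disc_alg_vec u" and F: "disc_alg_vec F"
    and eq: "\<And>\<zeta>. \<zeta> \<in> sphere 0 1 \<Longrightarrow> F \<zeta> = A \<zeta> (u \<zeta>)"
    and \<sigma>: "\<sigma> \<in> sphere 0 1" and u0: "u \<sigma> = 0" and z: "z \<in> cball 0 1"
  shows "u z = 0"
proof -
  \<comment> \<open>Zero data are Hoelder for every exponent, so the estimates may be used with an
    exponent of choice. Any value above \<open>1/2\<close> makes the product of the two bounds decay
    faster than \<open>1 - r\<close>.\<close>
  let ?\<alpha> = "3/4 :: real"
  have al: "0 < ?\<alpha>" "?\<alpha> < 1" by auto
  have sol: "holder_solution ?\<alpha> 1 u F (\<lambda>_. 0)"
    using u F eq by (simp add: holder_solution_def)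
  obtain K1 where K1: "0 < K1" "\<And>u F f M a \<sigma>. holder_solution ?\<alpha> M u F f \<Longrightarrow> a \<in> ball 0 1 \<Longrightarrow> \<sigma> \<in> sphere 0 1 \<Longrightarrow> a = of_real (cmod a) * \<sigma>
     \<Longrightarrow> norm (F a - (f \<sigma> + A \<sigma> (u a))) \<le> K1 * (M + norm (u 0)) * (1 - cmod a) powr ?\<alpha>"
    using uniform_bounds[OF al] by metis
  obtain K2 where K2: "0 < K2" "\<And>u F f M z w. holder_solution ?\<alpha> M u F f \<Longrightarrow> z \<in> cball 0 1 \<Longrightarrow> w \<in> cball 0 1
     \<Longrightarrow> norm (u z - u w) \<le> K2 * (M + norm (u 0)) * cmod (z - w) powr ?\<alpha>"
    using holder_on_disc[OF al] by metis
  define C2 where "C2 = K2 * (1 + norm (u 0))"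
  define C1 where "C1 = K1 * (1 + norm (u 0)) + norm (A \<sigma>) * C2"
  have C: "0 \<le> C2" "0 \<le> C1" unfolding C1_def C2_def using K1(1) K2(1) by auto
  define \<phi> where "\<phi> z = cdot (u z) (F z)" for z
  have \<phi>: "disc_alg \<phi>" unfolding \<phi>_def by (rule disc_alg_cdot[OF u F])
  have c\<phi>: "continuous_on (sphere 0 1) \<phi>" by (rule disc_alg_cont_sphere[OF \<phi>])
  have re: "0 \<le> Re (\<phi> \<zeta>)" if "\<zeta> \<in> sphere 0 1" for \<zeta>
    unfolding \<phi>_def eq[OF that]
    using coercive[OF that, of "u \<zeta>"] eps_pos by (meson order_trans mult_nonneg_nonneg less_imp_le zero_le_power2)
  let ?m = "cmean (\<lambda>\<zeta>. Re (\<phi> \<zeta>))"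
  have bound: "?m \<le> 2 * (C2 * C1) * (1 - r) powr (1/2)" if r: "0 \<le> r" "r < 1" for r
  proof -
    define a where "a = of_real r * \<sigma>"
    have ca: "cmod a = r" using \<sigma> r by (simp add: a_def norm_mult)
    have a: "a \<in> ball 0 1" "a = of_real (cmod a) * \<sigma>" unfolding ca using r ca by (simp_all add: a_def)
    have "a - \<sigma> = - (of_real (1 - r) * \<sigma>)" by (simp add: a_def algebra_simps)
    hence "cmod (a - \<sigma>) = 1 - r"
      using \<sigma> r by (simp only: norm_minus_cancel norm_mult norm_of_real) simp
    hence 1: "norm (u a) \<le> C2 * (1 - r) powr ?\<alpha>"
      using K2(2)[OF sol, of a \<sigma>] a \<sigma> by (simp add: u0 C2_def)
    have "norm (F a - A \<sigma> (u a)) \<le> K1 * (1 + norm (u 0)) * (1 - r) powr ?\<alpha>"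
      using K1(2)[OF sol a(1) \<sigma> a(2)] by (simp add: ca)
    moreover have "norm (A \<sigma> (u a)) \<le> norm (A \<sigma>) * (C2 * (1 - r) powr ?\<alpha>)"
      using norm_blinfun[of "A \<sigma>" "u a"] mult_left_mono[OF 1, of "norm (A \<sigma>)"] by simp
    ultimately have 2: "norm (F a) \<le> C1 * (1 - r) powr ?\<alpha>"
      using norm_triangle_ineq[of "F a - A \<sigma> (u a)" "A \<sigma> (u a)"] by (simp add: C1_def algebra_simps)
    have "(1 - r) / 2 * ?m = cmean (\<lambda>\<zeta>. (1 - r) / 2 * Re (\<phi> \<zeta>))"
      by (intro cmean_mult_left_real[symmetric] continuous_intros c\<phi>)
    also have "\<dots> \<le> cmean (\<lambda>\<zeta>. Re (of_real (poisson a \<zeta>) * \<phi> \<zeta>))"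
    proof (rule cmean_mono)
      fix \<zeta> :: complex assume \<zeta>: "\<zeta> \<in> sphere 0 1"
      \<comment> \<open>The lower Harnack bound \<open>(1 - r) / (1 + r)\<close>, weakened. It shows
        that the nonnegative real part of \<open>\<phi>\<close> on the circle cannot average to a
        small value at \<open>a\<close> unless its mean is small.\<close>
      have "(1 - r) / 2 \<le> poisson a \<zeta>"
      proof -
        have "cmod (\<zeta> - a) \<le> 1 + r" using norm_triangle_ineq4[of \<zeta> a] \<zeta> ca by simp
        hence "(cmod (\<zeta> - a))\<^sup>2 \<le> (1 + r)\<^sup>2" by (rule power_mono) simp
        hence "(1 - r\<^sup>2) / (1 + r)\<^sup>2 \<le> poisson a \<zeta>"
        proof -
          have "\<zeta> \<noteq> a" using \<zeta> a(1) by auto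
          hence "0 < (1 + r)\<^sup>2 * (cmod (\<zeta> - a))\<^sup>2" using r by simp
          thus ?thesis
            unfolding poisson_def ca using r \<open>(cmod (\<zeta> - a))\<^sup>2 \<le> (1 + r)\<^sup>2\<close>
            by (intro divide_left_mono) (auto simp: power_le_one)
        qed
        moreover have "(1 - r\<^sup>2) / (1 + r)\<^sup>2 = (1 - r) / (1 + r)"
        proof -
          have "1 - r\<^sup>2 = (1 - r) * (1 + r)" by (simp add: power2_eq_square algebra_simps)
          thus ?thesis using r by (simp add: power2_eq_square)
        qed
        moreover have "(1 - r) / 2 \<le> (1 - r) / (1 + r)" using r by (intro divide_left_mono) auto
        ultimately show ?thesis by linarith
      qed
      hence "(1 - r) / 2 * Re (\<phi> \<zeta>) \<le> poisson a \<zeta> * Re (\<phi> \<zeta>)" using re[OF \<zeta>] by (rule mult_right_mono)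
      thus "(1 - r) / 2 * Re (\<phi> \<zeta>) \<le> Re (of_real (poisson a \<zeta>) * \<phi> \<zeta>)" by simp
    qed (intro continuous_intros c\<phi> continuous_on_poisson a)+
    also have "\<dots> = Re (\<phi> a)"
      using cmean_poisson_disc_alg[OF a(1) \<phi>]
      by (subst cmean_Re) (auto intro!: continuous_intros c\<phi> continuous_on_poisson a)
    also have "\<dots> \<le> norm (u a) * norm (F a)"
      using complex_Re_le_cmod[of "\<phi> a"] norm_cdot_le[of "u a" "F a"] by (simp add: \<phi>_def)
    also have "\<dots> \<le> (C2 * (1 - r) powr ?\<alpha>) * (C1 * (1 - r) powr ?\<alpha>)"
      using 1 2 C by (intro mult_mono) auto
    also have "\<dots> = (C2 * C1) * (1 - r) powr (1/2) * (1 - r)"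
    proof -
      have "(1 - r) powr ?\<alpha> * (1 - r) powr ?\<alpha> = (1 - r) powr (1/2) * (1 - r) powr 1"
        by (simp only: powr_add[symmetric]) simp
      thus ?thesis using r by (simp add: mult_ac)
    qed
    finally have "(1 - r) * ?m \<le> (1 - r) * (2 * (C2 * C1) * (1 - r) powr (1/2))" by (simp add: mult_ac)
    thus ?thesis using r by simp
  qed
  have bd: "?m \<le> 2 * (C2 * C1) * s powr (1/2)" if "0 < s" "s < 1" for s
    using bound[of "1 - s"] that by simp
  have "?m \<le> 0"
  proof (rule ccontr)
    assume "\<not> ?m \<le> 0"
    hence m: "0 < ?m" by simp
    define c where "c = 2 * (C2 * C1)"
    have c: "0 \<le> c" using C by (simp add: c_def)
    define t where "t = ?m / (2 * (c + 1))"
    have t: "0 < t" using m c by (simp add: t_def)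
    define s where "s = min (1/2) (t\<^sup>2)"
    have s: "0 < s" "s < 1" "s \<le> t\<^sup>2" using t by (auto simp: s_def)
    have "sqrt s \<le> t" using s t by (intro real_le_lsqrt) auto
    hence "s powr (1/2) \<le> t" using s by (simp add: powr_half_sqrt)
    hence "c * s powr (1/2) \<le> c * t" using c by (rule mult_left_mono)
    moreover have "c * (x / (2 * (c + 1))) < x" if "0 < x" for x :: real
    proof -
      have "0 \<le> c * x" using that c by simp
      thus ?thesis using that c by (simp add: field_simps add_nonneg_pos)
    qed
    from this[OF m] have "c * t < ?m" by (simp only: t_def)
    moreover have "?m \<le> c * s powr (1/2)" using bd[OF s(1,2)] by (simp only: c_def)
    ultimately show False by linarith
  qed
  moreover have "?m = cmean (\<lambda>\<zeta>. 1 * Re (cdot (u \<zeta>) (A \<zeta> (u \<zeta>))))"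
    by (rule cmean_cong) (simp only: \<phi>_def eq mult_1)
  ultimately have "cmean (\<lambda>\<zeta>. 1 * Re (cdot (u \<zeta>) (A \<zeta> (u \<zeta>)))) \<le> 0" by (simp only:)
  thus ?thesis by (rule cdot_mean_zero_imp[OF u _ continuous_on_const _ z]) simp
qed

text \<open>On the circle the weight \<open>W\<close> turns \<open>(\<zeta> - a)\<^sup>2\<close>
  into \<open>\<zeta>\<^sup>2\<close> over the square of \<open>1 - cnj a * \<zeta>\<close>. One of
  the two factors \<open>\<zeta>\<close> cancels the \<open>cnj \<zeta>\<close> in front of
  \<open>g\<close>; the other survives in \<open>\<phi>\<close>, so that
  \<open>\<phi> 0 = 0\<close>. A simple zero would be too little for this cancellation.\<close>

lemma interior_double_zero:
  fixes g F :: "complex \<Rightarrow> complex ^ 'n"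
  assumes g: "disc_alg_vec g" and F: "disc_alg_vec F"
    and eq: "\<And>\<zeta>. \<zeta> \<in> sphere 0 1 \<Longrightarrow> F \<zeta> = A \<zeta> (cnj \<zeta> *s g \<zeta>)"
    and a: "a \<in> ball 0 1" and g0: "g a = 0" "\<And>i. deriv (\<lambda>z. g z $ i) a = 0" and z: "z \<in> cball 0 1"
  shows "g z = 0"
proof (rule disc_alg_vec_zero[OF g _ z])
  fix \<zeta>' :: complex assume \<zeta>': "\<zeta>' \<in> sphere 0 1"
  have gi: "disc_alg (\<lambda>z. g z $ i)" for i using g by (rule disc_alg_vec_nth)
  define k1 where "k1 i = diff_quot (\<lambda>z. g z $ i) a 0" for i
  have k1: "disc_alg (k1 i)" for i
    unfolding k1_def using disc_alg_deriv_within[OF gi a, of i] a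
    by (intro disc_alg_diff_quot gi) (auto simp: g0)
  have k1a: "k1 i a = 0" for i by (simp add: k1_def diff_quot_def)
  define k2 where "k2 i = diff_quot (k1 i) a (deriv (k1 i) a)" for i
  have k2: "disc_alg (k2 i)" for i
    unfolding k2_def using a by (intro disc_alg_diff_quot k1 disc_alg_deriv_within) auto
  have gk: "g z $ i = (z - a)\<^sup>2 * k2 i z" for z i
    using diff_quot_mult[of "\<lambda>z. g z $ i" z a 0] diff_quot_mult[of "k1 i" z a "deriv (k1 i) a"]
    by (simp add: k1_def[symmetric] k2_def[symmetric] k1a g0 power2_eq_square mult.assoc)
  define \<phi> where "\<phi> z = (\<Sum>i\<in>UNIV. z * k2 i z * F z $ i) / (1 - cnj a * z)\<^sup>2" for z
  have \<phi>: "disc_alg \<phi>"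
    unfolding \<phi>_def using one_minus_nonzero[OF a]
    by (intro disc_alg_divide disc_alg_intros k2 disc_alg_vec_nth F) auto
  define w where "w \<zeta> = cnj \<zeta> *s g \<zeta>" for \<zeta>
  define W where "W \<zeta> = 1 / (cmod (\<zeta> - a)) ^ 4" for \<zeta>
  have \<phi>eq: "\<phi> \<zeta> = of_real (W \<zeta>) * cdot (w \<zeta>) (A \<zeta> (w \<zeta>))" if \<zeta>: "\<zeta> \<in> sphere 0 1" for \<zeta>
  proof -
    have za: "\<zeta> \<noteq> a" "\<zeta> \<noteq> 0" using \<zeta> a by auto
    have 1: "\<zeta> * cnj \<zeta> = 1" using \<zeta> by (simp add: complex_norm_square[symmetric])
    let ?n = "complex_of_real ((cmod (\<zeta> - a))\<^sup>2)"
    have nz: "?n \<noteq> 0" using za by simp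
    have nm: "1 - cnj a * \<zeta> \<noteq> 0" using one_minus_nonzero[OF a, of \<zeta>] \<zeta> by simp
    have "(?n * \<zeta>)\<^sup>2 = ((\<zeta> - a) * (1 - cnj a * \<zeta>))\<^sup>2" by (simp only: circle_norm_diff[OF \<zeta>])
    hence sq: "?n\<^sup>2 * \<zeta>\<^sup>2 = (\<zeta> - a)\<^sup>2 * (1 - cnj a * \<zeta>)\<^sup>2" by (simp only: power_mult_distrib)
    have "\<zeta> * k2 i \<zeta> * F \<zeta> $ i / (1 - cnj a * \<zeta>)\<^sup>2 = cnj \<zeta> * g \<zeta> $ i * F \<zeta> $ i / ?n\<^sup>2" for i
    proof -
      have "cnj \<zeta> * g \<zeta> $ i * (1 - cnj a * \<zeta>)\<^sup>2 = cnj \<zeta> * k2 i \<zeta> * ((\<zeta> - a)\<^sup>2 * (1 - cnj a * \<zeta>)\<^sup>2)"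
        by (simp add: gk mult_ac)
      also have "\<dots> = (\<zeta> * cnj \<zeta>) * \<zeta> * k2 i \<zeta> * ?n\<^sup>2"
        unfolding sq[symmetric] by (simp add: power2_eq_square mult_ac)
      finally have "\<zeta> * k2 i \<zeta> * ?n\<^sup>2 = cnj \<zeta> * g \<zeta> $ i * (1 - cnj a * \<zeta>)\<^sup>2" by (simp only: 1 mult_1)
      hence "\<zeta> * k2 i \<zeta> / (1 - cnj a * \<zeta>)\<^sup>2 = cnj \<zeta> * g \<zeta> $ i / ?n\<^sup>2"
        using nz nm by (subst frac_eq_eq) (simp_all only: power_not_zero not_False_eq_True)
      thus ?thesis by (metis times_divide_eq_left)
    qed
    hence "\<phi> \<zeta> = (\<Sum>i\<in>UNIV. cnj \<zeta> * g \<zeta> $ i * F \<zeta> $ i) / ?n\<^sup>2"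
      by (simp only: \<phi>_def sum_divide_distrib)
    also have "\<dots> = of_real (W \<zeta>) * cdot (w \<zeta>) (F \<zeta>)"
      by (simp add: W_def cdot_def w_def power_mult[symmetric] flip: of_real_power)
    finally show ?thesis by (simp add: eq[OF \<zeta>] w_def)
  qed
  have cW: "continuous_on (sphere 0 1) W" unfolding W_def using a by (intro continuous_intros) auto
  have cg: "continuous_on (sphere 0 1) w"
    unfolding w_def vector_scalar_mult_def
    by (intro continuous_on_vec_lambda continuous_intros disc_alg_cont_sphere gi)
  have W: "0 < W \<zeta>" if "\<zeta> \<in> sphere 0 1" for \<zeta> using that a by (auto simp: W_def)
  let ?q = "\<lambda>\<zeta>. W \<zeta> * Re (cdot (w \<zeta>) (A \<zeta> (w \<zeta>)))"
  have cq: "continuous_on (sphere 0 1) ?q" by (intro continuous_intros cW cg)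
  have re: "0 \<le> Re (cdot (w \<zeta>) (A \<zeta> (w \<zeta>)))" if "\<zeta> \<in> sphere 0 1" for \<zeta>
    using coercive[OF that, of "w \<zeta>"] eps_pos by (meson order_trans mult_nonneg_nonneg less_imp_le zero_le_power2)
  have nn: "0 \<le> ?q \<zeta>" if "\<zeta> \<in> sphere 0 1" for \<zeta>
    using re[OF that] W[OF that] by simp
  have "cmean ?q = cmean (\<lambda>\<zeta>. Re (\<phi> \<zeta>))" by (rule cmean_cong) (simp add: \<phi>eq)
  also have "\<dots> = Re (\<phi> 0)"
    by (subst cmean_Re[OF disc_alg_cont_sphere[OF \<phi>]]) (simp add: cmean_disc_alg[OF \<phi>])
  also have "\<dots> = 0" by (simp add: \<phi>_def)
  finally have "?q \<zeta>' = 0" using cmean_eq_0_imp[OF cq nn _ \<zeta>'] by blast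
  hence "Re (cdot (w \<zeta>') (A \<zeta>' (w \<zeta>'))) = 0" using W[OF \<zeta>'] by simp
  hence "\<epsilon> * (norm (w \<zeta>'))\<^sup>2 \<le> 0" using coercive[OF \<zeta>', of "w \<zeta>'"] by simp
  hence "w \<zeta>' = 0" using eps_pos by (simp add: mult_le_0_iff)
  thus "g \<zeta>' = 0" using \<zeta>' by (auto simp: w_def vec_eq_iff)
qed

end

section \<open>The boundary value problem\<close>

lemma hol_disc_iff: "hol_disc m \<alpha> g \<longleftrightarrow> holder_circle m \<alpha> g \<and> disc_alg_vec g"
  by (auto simp: hol_disc_def disc_alg_vec_def disc_alg_def)

lemma bounded_bilinear_scalar_mult: "bounded_bilinear (\<lambda>(c::complex) (v::complex ^ 'n). c *s v)"
proof -
  have "bilinear (\<lambda>(c::complex) (v::complex ^ 'n). c *s v)"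
    unfolding bilinear_def by (auto intro!: linearI simp: vec_eq_iff algebra_simps)
  thus ?thesis by (simp add: bilinear_conv_bounded_bilinear)
qed

lemma holder_circle_cnj:
  assumes "0 < \<alpha>" "\<alpha> \<le> 1"
  shows "holder_circle k \<alpha> (\<lambda>\<zeta>. cnj \<zeta>)"
  using holder_circle_linear[OF bounded_linear_cnj holder_circle_ident[OF assms, of k 1]] by simp

lemma disc_deriv_at_add:
  "disc_deriv_at g p v \<Longrightarrow> disc_deriv_at h p w \<Longrightarrow> disc_deriv_at (\<lambda>z. g z + h z) p (v + w)"
  unfolding disc_deriv_at_def by (auto intro!: derivative_intros)

lemma disc_deriv_at_diff:
  "disc_deriv_at g p v \<Longrightarrow> disc_deriv_at h p w \<Longrightarrow> disc_deriv_at (\<lambda>z. g z - h z) p (v - w)"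
  unfolding disc_deriv_at_def by (auto intro!: derivative_intros)

lemma disc_deriv_at_scaleR:
  "disc_deriv_at g p v \<Longrightarrow> disc_deriv_at (\<lambda>z. r *\<^sub>R g z) p (r *\<^sub>R v)"
  unfolding disc_deriv_at_def by (auto simp: scaleR_conv_of_real[where 'a=complex] intro!: DERIV_cmult)

lemma disc_deriv_at_sum:
  "finite B \<Longrightarrow> (\<And>b. b \<in> B \<Longrightarrow> disc_deriv_at (G b) p (E b)) \<Longrightarrow>
    disc_deriv_at (\<lambda>z. \<Sum>b\<in>B. G b z) p (\<Sum>b\<in>B. E b)"
proof (induction B rule: finite_induct)
  case empty
  show ?case by (simp add: disc_deriv_at_def)
next
  case (insert b B)
  thus ?case by (simp add: disc_deriv_at_add)
qed

lemma disc_deriv_at_unique_interior: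
  assumes "disc_deriv_at g p v" "disc_deriv_at g p w" "p \<in> ball 0 1"
  shows "v = w"
proof -
  have "at p within cball 0 1 = at p"
    using assms(3) by (intro at_within_interior) (simp add: interior_cball)
  hence "v $ i = w $ i" for i
    using assms(1,2) unfolding disc_deriv_at_def by (metis DERIV_unique)
  thus ?thesis by (simp add: vec_eq_iff)
qed

lemma disc_deriv_at_cong:
  assumes "disc_deriv_at g p v" "\<And>z. z \<in> cball 0 1 \<Longrightarrow> g z = h z" "p \<in> cball 0 1"
  shows "disc_deriv_at h p v"
  unfolding disc_deriv_at_def
proof
  fix i
  have "((\<lambda>z. g z $ i) has_field_derivative v $ i) (at p within cball 0 1)"
    using assms(1) by (simp add: disc_deriv_at_def)
  thus "((\<lambda>z. h z $ i) has_field_derivative v $ i) (at p within cball 0 1)"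
    by (rule has_field_derivative_transform_within[OF _ zero_less_one assms(3)]) (simp add: assms(2))
qed

text \<open>One continuous tangential derivative is enough: its holomorphic extension is
  \<open>\<i> * z\<close> times the complex derivative, which thereby extends to the closed disc.
  This gives a meaning to derivative data at boundary points.\<close>

lemma hol_disc_differentiable:
  assumes g: "hol_disc m \<alpha> g" and m: "1 \<le> m" and alpha: "0 < \<alpha>" "\<alpha> \<le> 1" and p: "p \<in> cball 0 1"
  obtains v where "disc_deriv_at g p v"
proof -
  obtain k where k: "m = Suc k" using m by (cases m) auto
  have hg: "holder_circle (Suc k) \<alpha> g" and dg: "disc_alg_vec g" using g by (simp_all add: hol_disc_iff k)
  obtain g1 where g1: "holder_circle k \<alpha> g1"
    "\<And>\<theta>. ((\<lambda>t. g (cis t)) has_vector_derivative g1 (cis \<theta>)) (at \<theta>)"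
    using holder_circle_SucE[OF hg] by blast
  have c1: "continuous_on (sphere 0 1) g1" by (rule holder_circle_continuous[OF g1(1) alpha])
  have "\<exists>w. ((\<lambda>z. g z $ i) has_field_derivative w) (at p within cball 0 1)" for i
  proof -
    have gi: "disc_alg (\<lambda>z. g z $ i)" using dg by (rule disc_alg_vec_nth)
    have d1: "((\<lambda>t. g (cis t) $ i) has_vector_derivative g1 (cis \<theta>) $ i) (at \<theta>)" for \<theta>
      by (rule bounded_linear.has_vector_derivative[OF bounded_linear_vec_nth g1(2)])
    have "continuous_on (sphere 0 1) (\<lambda>\<zeta>. g1 \<zeta> $ i)" by (intro continuous_intros c1)
    then obtain V where V: "disc_alg V" "\<And>z. z \<in> ball 0 1 \<Longrightarrow> V z = \<i> * z * deriv (\<lambda>z. g z $ i) z"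
      using disc_alg_circle_derivative[OF gi, of "\<lambda>\<zeta>. g1 \<zeta> $ i"] d1 by metis
    obtain E where "\<And>z. z \<in> cball 0 1 \<Longrightarrow> ((\<lambda>z. g z $ i) has_field_derivative E z) (at z within cball 0 1)"
      using disc_alg_closed_disc_derivative[OF gi disc_alg_cont[OF V(1)] V(2)] by metis
    thus ?thesis using p by blast
  qed
  then obtain w where "\<And>i. ((\<lambda>z. g z $ i) has_field_derivative w i) (at p within cball 0 1)" by metis
  thus ?thesis using that[of "\<chi> i. w i"] by (simp add: disc_deriv_at_def)
qed

section \<open>Solution spaces and transport of initial data\<close>

locale disc_problem = coercive_symbol A \<epsilon> \<Lambda>
  for A :: "complex \<Rightarrow> (complex ^ 'n) \<Rightarrow>\<^sub>L (complex ^ 'n)" and \<epsilon> \<Lambda> +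
  fixes m :: nat and \<alpha> :: real
  assumes m: "1 \<le> m" and alpha: "0 < \<alpha>" "\<alpha> < 1" and A_holder: "holder_circle m \<alpha> A"
begin

lemma al: "0 < \<alpha>" "\<alpha> \<le> 1" using alpha by auto

lemmas holder_circle_apply = holder_circle_bilinear[OF bounded_bilinear_blinfun_apply al]
lemmas holder_circle_smult = holder_circle_bilinear[OF bounded_bilinear_scalar_mult al]

text \<open>The quotient by the identity is written as \<open>cnj \<zeta> *s g \<zeta>\<close>, its
  equal on the circle, so that no division occurs and the regularity of products applies
  directly.\<close>

definition sol :: "(complex \<Rightarrow> complex ^ 'n) \<Rightarrow> (complex \<Rightarrow> complex ^ 'n) \<Rightarrow> bool" where
  "sol f g \<longleftrightarrow> hol_disc m \<alpha> g \<and>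
     (\<exists>F. hol_disc m \<alpha> F \<and> (\<forall>\<zeta>\<in>sphere 0 1. F \<zeta> = A \<zeta> (cnj \<zeta> *s g \<zeta>) + f \<zeta>))"

lemma sol_add:
  assumes "sol f g" "sol f' g'"
  shows "sol (\<lambda>\<zeta>. f \<zeta> + f' \<zeta>) (\<lambda>\<zeta>. g \<zeta> + g' \<zeta>)"
proof -
  obtain F F' where "hol_disc m \<alpha> F" "hol_disc m \<alpha> F'"
    "\<And>\<zeta>. \<zeta> \<in> sphere 0 1 \<Longrightarrow> F \<zeta> = A \<zeta> (cnj \<zeta> *s g \<zeta>) + f \<zeta>"
    "\<And>\<zeta>. \<zeta> \<in> sphere 0 1 \<Longrightarrow> F' \<zeta> = A \<zeta> (cnj \<zeta> *s g' \<zeta>) + f' \<zeta>"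
    using assms unfolding sol_def by blast
  thus ?thesis
    using assms unfolding sol_def hol_disc_iff
    by (auto intro!: exI[of _ "\<lambda>z. F z + F' z"] holder_circle_add disc_alg_vec_add
        simp: vector_add_ldistrib blinfun.add_right)
qed

lemma sol_scaleR:
  assumes "sol f g"
  shows "sol (\<lambda>\<zeta>. r *\<^sub>R f \<zeta>) (\<lambda>\<zeta>. r *\<^sub>R g \<zeta>)"
proof -
  obtain F where "hol_disc m \<alpha> F" "\<And>\<zeta>. \<zeta> \<in> sphere 0 1 \<Longrightarrow> F \<zeta> = A \<zeta> (cnj \<zeta> *s g \<zeta>) + f \<zeta>"
    using assms unfolding sol_def by blast
  moreover have "c *s (r *\<^sub>R v) = r *\<^sub>R (c *s v)" for c and v :: "complex ^ 'n"
    by (simp add: vec_eq_iff)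
  ultimately show ?thesis
    using assms unfolding sol_def hol_disc_iff
    by (auto intro!: exI[of _ "\<lambda>z. r *\<^sub>R F z"] holder_circle_linear[OF bounded_linear_scaleR_right] disc_alg_vec_scaleR
        simp: blinfun.scaleR_right scaleR_add_right)
qed

lemma sol_diff: "sol f g \<Longrightarrow> sol f g' \<Longrightarrow> sol (\<lambda>_. 0) (\<lambda>\<zeta>. g \<zeta> - g' \<zeta>)"
  using sol_add[OF _ sol_scaleR[of f g' "-1"], of f g] by simp

lemma sol_sum:
  "finite B \<Longrightarrow> (\<And>b. b \<in> B \<Longrightarrow> sol (\<lambda>_. 0) (G b)) \<Longrightarrow> sol (\<lambda>_. 0) (\<lambda>z. \<Sum>b\<in>B. G b z)"
proof (induction B rule: finite_induct)
  case empty
  have "hol_disc m \<alpha> (\<lambda>_. 0 :: complex ^ 'n)"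
    by (simp add: hol_disc_iff holder_circle_const disc_alg_vec_const)
  thus ?case unfolding sol_def by (auto intro!: exI[of _ "\<lambda>_. 0"] simp: blinfun.zero_right)
next
  case (insert b B)
  thus ?case using sol_add[of "\<lambda>_. 0" "G b" "\<lambda>_. 0" "\<lambda>z. \<Sum>b\<in>B. G b z"] by simp
qed

text \<open>In the ansatz \<open>z + (\<zeta> *s v + \<zeta> *s u \<zeta>)\<close> the prescribed
  data enter \<open>cnj \<zeta> *s g \<zeta>\<close> as the known term \<open>h\<close>, which is
  moved into the inhomogeneity \<open>f'\<close>. The condition \<open>u 0 = 0\<close> keeps the
  derivative at 0 equal to \<open>v\<close>.\<close>

lemma sol_at_origin:
  assumes f: "holder_circle m \<alpha> f"
  obtains g where "sol f g" "g 0 = z" "disc_deriv_at g 0 v"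
proof -
  obtain k where k: "m = Suc k" using m by (cases m) auto
  define h where "h \<zeta> = cnj \<zeta> *s z + v" for \<zeta>
  have hh: "holder_circle m \<alpha> h"
    unfolding h_def by (intro holder_circle_add holder_circle_smult holder_circle_cnj holder_circle_const al)
  define f' where "f' \<zeta> = A \<zeta> (h \<zeta>) + f \<zeta>" for \<zeta>
  have hf': "holder_circle m \<alpha> f'"
    unfolding f'_def by (intro holder_circle_add holder_circle_apply A_holder hh f)
  obtain f1 where f1: "holder_circle k \<alpha> f1" "\<And>\<theta>. ((\<lambda>t. f' (cis t)) has_vector_derivative f1 (cis \<theta>)) (at \<theta>)"
    using holder_circle_SucE[OF hf'[unfolded k]] by blast
  obtain A1 where A1: "holder_circle k \<alpha> A1" "\<And>\<theta>. ((\<lambda>t. A (cis t)) has_vector_derivative A1 (cis \<theta>)) (at \<theta>)"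
    using holder_circle_SucE[OF A_holder[unfolded k]] by blast
  obtain u F where u: "disc_alg_vec u" and F: "disc_alg_vec F" and u0: "u 0 = 0"
    and eq: "\<And>\<zeta>. \<zeta> \<in> sphere 0 1 \<Longrightarrow> F \<zeta> = A \<zeta> (u \<zeta>) + f' \<zeta>"
    using solution_exists[OF holder_circle_continuous[OF hf' al] holder_circle_continuous[OF f1(1) al] f1(2)
        holder_circle_continuous[OF A1(1) al] A1(2)] by metis
  have hu: "holder_circle m \<alpha> u"
    by (rule regularity[OF alpha A_holder order_refl u F eq hf'])
  have hF: "holder_circle m \<alpha> F"
    by (rule holder_circle_cong[of m \<alpha> "\<lambda>\<zeta>. A \<zeta> (u \<zeta>) + f' \<zeta>"])
       (intro holder_circle_add holder_circle_apply A_holder hu hf', simp add: eq)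
  define g where "g \<zeta> = z + (\<zeta> *s v + \<zeta> *s u \<zeta>)" for \<zeta>
  have id: "holder_circle m \<alpha> (\<lambda>\<zeta>::complex. \<zeta>)" using holder_circle_ident[OF al, of m 1] by simp
  have "hol_disc m \<alpha> g"
    unfolding hol_disc_iff g_def
    by (intro conjI holder_circle_add holder_circle_smult holder_circle_const id hu
        disc_alg_vec_intros disc_alg_ident u)
  moreover have "F \<zeta> = A \<zeta> (cnj \<zeta> *s g \<zeta>) + f \<zeta>" if \<zeta>: "\<zeta> \<in> sphere 0 1" for \<zeta>
  proof -
    have 1: "cnj \<zeta> * \<zeta> = 1" using \<zeta> by (simp add: complex_norm_square[symmetric] mult.commute)
    have "cnj \<zeta> *s g \<zeta> = cnj \<zeta> *s z + ((cnj \<zeta> * \<zeta>) *s v + (cnj \<zeta> * \<zeta>) *s u \<zeta>)"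
      by (simp add: g_def vec_eq_iff algebra_simps)
    also have "\<dots> = u \<zeta> + h \<zeta>" unfolding 1 h_def by (simp add: vec_eq_iff)
    finally show ?thesis by (simp add: eq[OF \<zeta>] f'_def blinfun.add_right)
  qed
  ultimately have "sol f g" unfolding sol_def hol_disc_iff using hF F by blast
  moreover have "g 0 = z" by (simp add: g_def vec_eq_iff)
  moreover have "disc_deriv_at g 0 v"
    unfolding disc_deriv_at_def
  proof
    fix i
    have "((\<lambda>z. u z $ i) has_field_derivative deriv (\<lambda>z. u z $ i) 0) (at 0 within cball 0 1)"
      by (rule disc_alg_deriv_within[OF disc_alg_vec_nth[OF u]]) simp
    hence "((\<lambda>\<zeta>. z $ i + (\<zeta> * v $ i + \<zeta> * u \<zeta> $ i)) has_field_derivative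
        (0 + (v $ i + (1 * u 0 $ i + deriv (\<lambda>z. u z $ i) 0 * 0)))) (at 0 within cball 0 1)"
      by (intro DERIV_add DERIV_const DERIV_mult DERIV_ident) (auto intro!: derivative_eq_intros)
    thus "((\<lambda>\<zeta>. g \<zeta> $ i) has_field_derivative v $ i) (at 0 within cball 0 1)"
      by (simp add: g_def u0)
  qed
  ultimately show ?thesis using that by blast
qed

lemma unique_interior:
  assumes g: "sol (\<lambda>_. 0) g" and a: "a \<in> ball 0 1" and g0: "g a = 0" "disc_deriv_at g a 0" and z: "z \<in> cball 0 1"
  shows "g z = 0"
proof -
  obtain F where F: "hol_disc m \<alpha> F" "\<And>\<zeta>. \<zeta> \<in> sphere 0 1 \<Longrightarrow> F \<zeta> = A \<zeta> (cnj \<zeta> *s g \<zeta>)"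
    using g unfolding sol_def by auto
  have gd: "disc_alg_vec g" and Fd: "disc_alg_vec F" using g F by (simp_all add: sol_def hol_disc_iff)
  have "deriv (\<lambda>z. g z $ i) a = 0" for i
  proof -
    have "at a within cball 0 1 = at a"
      using a by (intro at_within_interior) (simp add: interior_cball)
    thus ?thesis using g0(2) by (auto simp: disc_deriv_at_def intro!: DERIV_imp_deriv)
  qed
  thus ?thesis using interior_double_zero[OF gd Fd F(2) a g0(1) _ z] by blast
qed

text \<open>Homogeneous solutions are parametrised linearly by their data at 0. Passing to the data
  at \<open>p\<close> is a linear endomorphism of a finite-dimensional space; uniqueness at
  \<open>p\<close> makes it injective, hence surjective, and a homogeneous correction of
  \<open>g0\<close> attains any prescribed data.\<close>

lemma solution_by_dimension:
  assumes unique: "\<forall>g. sol (\<lambda>_. 0) g \<and> g p = 0 \<and> disc_deriv_at g p 0 \<longrightarrow> (\<forall>z\<in>cball 0 1. g z = 0)"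
    and p: "p \<in> cball 0 1" and f: "holder_circle m \<alpha> f"
  shows "\<exists>g. (sol f g \<and> g p = z0 \<and> disc_deriv_at g p v0) \<and>
    (\<forall>g'. sol f g' \<and> g' p = z0 \<and> disc_deriv_at g' p v0 \<longrightarrow> (\<forall>z\<in>cball 0 1. g' z = g z))"
proof -
  have uniq: "\<And>g z. sol (\<lambda>_. 0) g \<Longrightarrow> g p = 0 \<Longrightarrow> disc_deriv_at g p 0 \<Longrightarrow> z \<in> cball 0 1 \<Longrightarrow> g z = 0"
    using unique by blast
  let ?B = "Basis :: ((complex ^ 'n) \<times> (complex ^ 'n)) set"
  have "\<exists>G. sol (\<lambda>_. 0) G \<and> G 0 = fst b \<and> disc_deriv_at G 0 (snd b)" for b
    using sol_at_origin[OF holder_circle_const] by metis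
  then obtain G where G: "\<And>b. sol (\<lambda>_. 0) (G b)" "\<And>b. G b 0 = fst b" "\<And>b. disc_deriv_at (G b) 0 (snd b)"
    by metis
  have hG: "hol_disc m \<alpha> (G b)" for b using G(1) by (simp add: sol_def)
  have "\<exists>v. disc_deriv_at (G b) p v" for b
    using hol_disc_differentiable[OF hG m al p] by metis
  \<comment> \<open>One derivative is chosen for each basis solution and extended by linearity, so
    the second component of \<open>L\<close> is linear by construction.\<close>
  then obtain E where E: "\<And>b. disc_deriv_at (G b) p (E b)" by metis
  obtain g0 where g0: "sol f g0" using sol_at_origin[OF f] by metis
  then have "hol_disc m \<alpha> g0" by (simp add: sol_def)
  then obtain e0 where e0: "disc_deriv_at g0 p e0" using hol_disc_differentiable[OF _ m al p] by metis
  define gx where "gx x \<zeta> = (\<Sum>b\<in>?B. (x \<bullet> b) *\<^sub>R G b \<zeta>)" for x \<zeta>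
  have gx: "sol (\<lambda>_. 0) (gx x)" for x
    unfolding gx_def by (intro sol_sum finite_Basis) (use sol_scaleR[OF G(1)] in simp)
  have dgx: "disc_deriv_at (gx x) p (\<Sum>b\<in>?B. (x \<bullet> b) *\<^sub>R E b)" for x
    unfolding gx_def by (intro disc_deriv_at_sum finite_Basis disc_deriv_at_scaleR E)
  have gx0: "gx x 0 = fst x" "disc_deriv_at (gx x) 0 (snd x)" for x
  proof -
    have "(\<Sum>b\<in>?B. (x \<bullet> b) *\<^sub>R b) = x" by (rule euclidean_representation)
    hence "fst (\<Sum>b\<in>?B. (x \<bullet> b) *\<^sub>R b) = fst x" "snd (\<Sum>b\<in>?B. (x \<bullet> b) *\<^sub>R b) = snd x" by simp_all
    hence s: "(\<Sum>b\<in>?B. (x \<bullet> b) *\<^sub>R fst b) = fst x" "(\<Sum>b\<in>?B. (x \<bullet> b) *\<^sub>R snd b) = snd x"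
      by (simp_all add: fst_sum snd_sum)
    show "gx x 0 = fst x" by (simp add: gx_def G(2) s)
    show "disc_deriv_at (gx x) 0 (snd x)"
      unfolding gx_def s(2)[symmetric] by (intro disc_deriv_at_sum finite_Basis disc_deriv_at_scaleR G)
  qed
  define L where "L x = (gx x p, \<Sum>b\<in>?B. (x \<bullet> b) *\<^sub>R E b)" for x
  have linL: "linear L"
    by (rule linearI) (simp_all add: L_def gx_def inner_add_left scaleR_add_left sum.distrib scaleR_sum_right)
  have "x = 0" if "L x = 0" for x
  proof -
    have "gx x p = 0" "disc_deriv_at (gx x) p 0" using that dgx[of x] by (auto simp: L_def zero_prod_def)
    hence z: "gx x z = 0" if "z \<in> cball 0 1" for z using uniq[OF gx _ _ that] by blast
    \<comment> \<open>A combination that vanishes on the disc has zero data at the origin, and these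
      data are \<open>x\<close>.\<close>
    have "disc_deriv_at (\<lambda>_. 0) 0 (snd x)" by (rule disc_deriv_at_cong[OF gx0(2)]) (simp_all add: z)
    moreover have "disc_deriv_at (\<lambda>_. 0 :: complex ^ 'n) 0 0" by (simp add: disc_deriv_at_def)
    ultimately have "snd x = 0" by (rule disc_deriv_at_unique_interior) simp
    moreover have "fst x = 0" using gx0(1)[of x] z[of 0] by simp
    ultimately show ?thesis by (simp add: prod_eq_iff)
  qed
  hence "inj L" using linear_injective_0[OF linL] by blast
  hence "surj L" by (rule linear_injective_imp_surjective[OF linL]) (rule refl)
  then obtain x where x: "L x = (z0 - g0 p, v0 - e0)" by (metis surjD)
  define g where "g \<zeta> = g0 \<zeta> + gx x \<zeta>" for \<zeta>
  have sg: "sol f g" using sol_add[OF g0 gx[of x]] by (simp add: g_def[abs_def])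
  have gp: "g p = z0" using x by (simp add: L_def g_def)
  have dg: "disc_deriv_at g p v0"
    using disc_deriv_at_add[OF e0 dgx[of x]] x by (simp add: L_def g_def[abs_def])
  show ?thesis
  proof (intro exI[of _ g] conjI allI impI ballI sg gp dg)
    fix g' z assume g'_all: "sol f g' \<and> g' p = z0 \<and> disc_deriv_at g' p v0" and z: "z \<in> cball (0::complex) 1"
    hence g': "sol f g'" "g' p = z0" "disc_deriv_at g' p v0" by auto
    have "g' z - g z = 0"
      by (rule uniq[OF sol_diff[OF g'(1) sg] _ _ z])
         (use gp g' disc_deriv_at_diff[OF g'(3) dg] in simp_all)
    thus "g' z = g z" by simp
  qed
qed

end

section \<open>The symbol attached to the pair of matrix functions\<close>

definition cnj_vec :: "complex ^ 'n \<Rightarrow> complex ^ 'n" where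
  "cnj_vec v = (\<chi> i. cnj (v $ i))"

text \<open>The two parts are wrapped separately because each is then a bounded linear image of its
  matrix, and the Hoelder regularity of \<open>H\<close> and \<open>S\<close> passes to the
  symbol.\<close>

definition symbol :: "(complex \<Rightarrow> complex ^ 'n ^ 'n) \<Rightarrow> (complex \<Rightarrow> complex ^ 'n ^ 'n) \<Rightarrow>
    complex \<Rightarrow> (complex ^ 'n) \<Rightarrow>\<^sub>L (complex ^ 'n)" where
  "symbol H S \<zeta> = Blinfun (\<lambda>v. H \<zeta> *v cnj_vec v) + Blinfun (\<lambda>v. S \<zeta> *v v)"

lemma bounded_bilinear_symbol_parts:
  "bounded_bilinear (\<lambda>(M :: complex ^ 'n ^ 'n) v. M *v cnj_vec v)"
  "bounded_bilinear (\<lambda>(M :: complex ^ 'n ^ 'n) v. M *v v)"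
proof -
  have "bilinear (\<lambda>(M :: complex ^ 'n ^ 'n) v. M *v cnj_vec v)"
    "bilinear (\<lambda>(M :: complex ^ 'n ^ 'n) v. M *v v)"
    unfolding bilinear_def
    by (auto intro!: linearI simp: vec_eq_iff matrix_vector_mult_def cnj_vec_def algebra_simps
        sum.distrib scaleR_sum_right)
  thus "bounded_bilinear (\<lambda>(M :: complex ^ 'n ^ 'n) v. M *v cnj_vec v)"
    "bounded_bilinear (\<lambda>(M :: complex ^ 'n ^ 'n) v. M *v v)"
    by (simp_all add: bilinear_conv_bounded_bilinear)
qed

lemma bounded_linear_Blinfun:
  assumes "bounded_bilinear p"
  shows "bounded_linear (\<lambda>x. Blinfun (p x))" "blinfun_apply (Blinfun (p x)) = p x"
proof -
  interpret bounded_bilinear p by fact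
  have app: "blinfun_apply (Blinfun (p x)) = p x" for x
    by (rule bounded_linear_Blinfun_apply[OF bounded_linear_right])
  obtain K where K: "0 \<le> K" "\<And>a b. norm (p a b) \<le> norm a * norm b * K" using nonneg_bounded by blast
  show "bounded_linear (\<lambda>x. Blinfun (p x))"
  proof (rule bounded_linear_intro[where K = K])
    fix x
    show "norm (Blinfun (p x)) \<le> norm x * K"
      by (rule norm_blinfun_bound) (use K in \<open>auto simp: app mult_ac\<close>)
  qed (auto intro!: blinfun_eqI simp: app add_left scaleR_left blinfun.add_left blinfun.scaleR_left)
  show "blinfun_apply (Blinfun (p x)) = p x" by (rule app)
qed

lemmas symbol_part_linear = bounded_linear_Blinfun(1)[OF bounded_bilinear_symbol_parts(1)]
  bounded_linear_Blinfun(1)[OF bounded_bilinear_symbol_parts(2)]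

lemma symbol_apply: "symbol H S \<zeta> v = H \<zeta> *v cnj_vec v + S \<zeta> *v v"
  unfolding symbol_def
  by (simp add: blinfun.add_left bounded_linear_Blinfun(2)[OF bounded_bilinear_symbol_parts(1)]
      bounded_linear_Blinfun(2)[OF bounded_bilinear_symbol_parts(2)])

lemma cdot_symbol:
  "cdot v (symbol H S \<zeta> v) =
    (\<Sum>i\<in>UNIV. \<Sum>j\<in>UNIV. v $ i * H \<zeta> $ i $ j * cnj (v $ j)) +
    (\<Sum>i\<in>UNIV. \<Sum>j\<in>UNIV. v $ i * S \<zeta> $ i $ j * v $ j)"
  by (simp add: symbol_apply cdot_def matrix_vector_mult_def cnj_vec_def distrib_left sum.distrib
      sum_distrib_left mult.assoc)

text \<open>The quadratic form \<open>q\<close> is positive and continuous on the compact product of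
  the circle with the unit sphere, so its minimum there is a coercivity constant; real homogeneity
  of degree two extends the bound to all vectors.\<close>

lemma disc_problem_symbol:
  fixes H S :: "complex \<Rightarrow> complex ^ 'n ^ 'n"
  assumes m: "1 \<le> m" and alpha: "0 < \<alpha>" "\<alpha> < 1"
    and HS: "holder_circle m \<alpha> H" "holder_circle m \<alpha> S"
    and pos: "\<And>\<zeta> v. \<zeta> \<in> sphere 0 1 \<Longrightarrow> v \<noteq> 0 \<Longrightarrow>
               cmod (\<Sum>i\<in>UNIV. \<Sum>j\<in>UNIV. v $ i * S \<zeta> $ i $ j * v $ j)
                 < Re (\<Sum>i\<in>UNIV. \<Sum>j\<in>UNIV. v $ i * H \<zeta> $ i $ j * cnj (v $ j))"
  obtains \<epsilon> \<Lambda> where "disc_problem (symbol H S) \<epsilon> \<Lambda> m \<alpha>"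
proof -
  let ?A = "symbol H S"
  have al: "0 < \<alpha>" "\<alpha> \<le> 1" using alpha by auto
  have hA: "holder_circle m \<alpha> ?A"
    unfolding symbol_def by (intro holder_circle_add holder_circle_linear[OF symbol_part_linear(1)]
        holder_circle_linear[OF symbol_part_linear(2)] HS)
  have cA: "continuous_on (sphere 0 1) ?A" by (rule holder_circle_continuous[OF hA al])
  obtain k where k: "m = Suc k" using m by (cases m) auto
  obtain A1 where A1: "holder_circle k \<alpha> A1" "\<And>\<theta>. ((\<lambda>t. ?A (cis t)) has_vector_derivative A1 (cis \<theta>)) (at \<theta>)"
    using holder_circle_SucE[OF hA[unfolded k]] by blast
  obtain \<Lambda> where \<Lambda>: "\<And>\<zeta> \<eta>. \<zeta> \<in> sphere 0 1 \<Longrightarrow> \<eta> \<in> sphere 0 1 \<Longrightarrow> norm (?A \<zeta> - ?A \<eta>) \<le> \<Lambda> * cmod (\<zeta> - \<eta>)"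
    using circle_lipschitz[OF A1(2) holder_circle_continuous[OF A1(1) al]] by metis
  let ?K = "sphere (0::complex) 1 \<times> sphere (0 :: complex ^ 'n) 1"
  define q where "q = (\<lambda>x. Re (cdot (snd x) (?A (fst x) (snd x))))"
  have qpos: "0 < Re (cdot v (?A \<zeta> v))" if \<zeta>: "\<zeta> \<in> sphere 0 1" and v: "v \<noteq> 0" for \<zeta> v
    using pos[OF \<zeta> v] abs_Re_le_cmod[of "\<Sum>i\<in>UNIV. \<Sum>j\<in>UNIV. v $ i * S \<zeta> $ i $ j * v $ j"]
    unfolding cdot_symbol by simp
  have "continuous_on ?K (\<lambda>x. ?A (fst x))"
    by (rule continuous_on_compose2[OF cA]) (auto intro!: continuous_intros)
  hence "continuous_on ?K q" unfolding q_def by (intro continuous_intros)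
  moreover have "compact ?K" by (intro compact_Times compact_sphere)
  moreover have "?K \<noteq> {}"
  proof -
    have "norm (axis undefined 1 :: complex ^ 'n) = 1" by (simp add: norm_axis_1)
    hence "(1, axis undefined 1) \<in> ?K" by simp
    thus ?thesis by blast
  qed
  ultimately obtain x where x: "x \<in> ?K" "\<And>y. y \<in> ?K \<Longrightarrow> q x \<le> q y"
    using continuous_attains_inf[of ?K q] by blast
  define \<epsilon> where "\<epsilon> = q x"
  have "0 < \<epsilon>" unfolding \<epsilon>_def q_def by (rule qpos) (use x(1) in \<open>auto simp: mem_Times_iff\<close>)
  moreover have "\<epsilon> * (norm v)\<^sup>2 \<le> Re (cdot v (?A \<zeta> v))" if \<zeta>: "\<zeta> \<in> sphere 0 1" for \<zeta> v
  proof (cases "v = 0")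
    case False
    define w where "w = v /\<^sub>R norm v"
    have w: "norm w = 1" "v = norm v *\<^sub>R w" using False by (simp_all add: w_def)
    have "\<epsilon> \<le> q (\<zeta>, w)" unfolding \<epsilon>_def by (rule x(2)) (use \<zeta> w in simp)
    hence "\<epsilon> * (norm v)\<^sup>2 \<le> Re (cdot w (?A \<zeta> w)) * (norm v)\<^sup>2" by (simp add: q_def mult_right_mono)
    also have "\<dots> = Re (cdot (norm v *\<^sub>R w) (?A \<zeta> (norm v *\<^sub>R w)))"
      by (simp add: blinfun.scaleR_right bounded_bilinear.scaleR_left[OF bounded_bilinear_cdot]
          bounded_bilinear.scaleR_right[OF bounded_bilinear_cdot] power2_eq_square)
    finally show ?thesis using w(2) by simp
  qed (simp add: cdot_zero_left)
  ultimately have "disc_problem ?A \<epsilon> \<Lambda> m \<alpha>"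
    by unfold_locales (use \<Lambda> m alpha hA in auto)
  thus ?thesis using that by blast
qed

section \<open>Zeros on the circle and the main theorem\<close>

text \<open>Along the circle the product rule gives \<open>F\<close> zero derivative at
  \<open>p\<close>: the term with the derivative of \<open>A\<close> multiplies
  \<open>g p = 0\<close>, and the others contain the vanishing value or derivative of
  \<open>g\<close>. The tangential derivative is \<open>\<i> * p\<close> times the complex
  one.\<close>

lemma (in disc_problem) boundary_double_zero_image:
  assumes p: "p \<in> sphere 0 1" and g0: "g p = 0" "disc_deriv_at g p 0"
    and eq: "\<And>\<zeta>. \<zeta> \<in> sphere 0 1 \<Longrightarrow> F \<zeta> = A \<zeta> (cnj \<zeta> *s g \<zeta>)" and w: "disc_deriv_at F p w"
  shows "w = 0"
proof -
  obtain t where t: "p = cis t" using circle_cisE[OF p] by metis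
  obtain k where k: "m = Suc k" using m by (cases m) auto
  obtain A1 where A1: "\<And>\<theta>. ((\<lambda>t. A (cis t)) has_vector_derivative A1 (cis \<theta>)) (at \<theta>)"
    using holder_circle_SucE[OF A_holder[unfolded k]] by metis
  have "((\<lambda>t. g (cis t)) has_vector_derivative 0) (at t)"
  proof (rule has_vector_derivative_vec)
    fix i
    have "((\<lambda>z. g z $ i) has_field_derivative 0) (at (cis t) within cball 0 1)"
      using g0(2) by (simp add: disc_deriv_at_def t)
    thus "((\<lambda>t. g (cis t) $ i) has_vector_derivative 0 $ i) (at t)"
      using circle_chain[of "\<lambda>z. g z $ i" 0 t] by simp
  qed
  from bounded_bilinear.has_vector_derivative[OF bounded_bilinear_scalar_mult
      bounded_linear.has_vector_derivative[OF bounded_linear_cnj has_vector_derivative_cis_at] this]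
  have "((\<lambda>t. cnj (cis t) *s g (cis t)) has_vector_derivative 0) (at t)"
    using g0(1) by (simp add: t)
  from bounded_bilinear.has_vector_derivative[OF bounded_bilinear_blinfun_apply A1 this]
  have "((\<lambda>t. A (cis t) (cnj (cis t) *s g (cis t))) has_vector_derivative 0) (at t)"
    using g0(1) by (simp add: t blinfun.zero_right)
  moreover have "(\<lambda>t. A (cis t) (cnj (cis t) *s g (cis t))) = (\<lambda>t. F (cis t))"
    by (rule ext) (simp add: eq)
  ultimately have dF: "((\<lambda>t. F (cis t)) has_vector_derivative 0) (at t)" by (simp only:)
  have "w $ i = 0" for i
  proof -
    have "((\<lambda>t. F (cis t) $ i) has_vector_derivative 0) (at t)"
      using bounded_linear.has_vector_derivative[OF bounded_linear_vec_nth dF, of i] by simp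
    moreover have "((\<lambda>t. F (cis t) $ i) has_vector_derivative \<i> * cis t * w $ i) (at t)"
      by (rule circle_chain) (use w in \<open>simp add: disc_deriv_at_def t\<close>)
    ultimately have "0 = \<i> * cis t * w $ i" by (rule vector_derivative_unique_at)
    thus ?thesis by simp
  qed
  thus ?thesis by (simp add: vec_eq_iff)
qed

definition rotate_matrix :: "complex \<Rightarrow> complex ^ 'n ^ 'n \<Rightarrow> complex ^ 'n ^ 'n" where
  "rotate_matrix c M = (\<chi> i j. c * M $ i $ j)"

lemma bounded_bilinear_rotate_matrix:
  "bounded_bilinear (rotate_matrix :: complex \<Rightarrow> complex ^ 'n ^ 'n \<Rightarrow> complex ^ 'n ^ 'n)"
proof -
  have "bilinear (rotate_matrix :: complex \<Rightarrow> complex ^ 'n ^ 'n \<Rightarrow> complex ^ 'n ^ 'n)"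
    unfolding bilinear_def rotate_matrix_def
    by (auto intro!: linearI simp: vec_eq_iff algebra_simps)
  thus ?thesis by (simp add: bilinear_conv_bounded_bilinear)
qed

lemma rotate_matrix_mult: "rotate_matrix c M *v v = c *s (M *v v)"
  by (simp add: rotate_matrix_def matrix_vector_mult_def vec_eq_iff sum_distrib_left mult.assoc)

lemma matrix_vector_smult: "M *v (c *s v) = c *s (M *v v)" for M :: "complex ^ 'n ^ 'n"
  by (simp add: matrix_vector_mult_def vec_eq_iff sum_distrib_left mult_ac)

lemma cnj_vec_smult: "cnj_vec (c *s v) = cnj c *s cnj_vec v"
  by (simp add: cnj_vec_def vec_eq_iff)

text \<open>Dividing by the simple zero turns the pair \<^term>\<open>(H, S)\<close> into \<^term>\<open>(H, - p * cnj \<zeta> * S)\<close>, because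
  \<^term>\<open>cnj (\<zeta> - p)\<close> and \<^term>\<open>\<zeta> - p\<close> differ on the circle by the factor \<^term>\<open>- cnj p * cnj \<zeta>\<close>; the
  modulus of the symmetric part is unchanged, so the positivity hypothesis survives.\<close>

lemma unique_boundary:
  fixes H S :: "complex \<Rightarrow> complex ^ 'n ^ 'n"
  assumes prob: "disc_problem (symbol H S) \<epsilon> \<Lambda> m \<alpha>"
    and HS: "holder_circle m \<alpha> H" "holder_circle m \<alpha> S"
    and pos: "\<And>\<zeta> v. \<zeta> \<in> sphere 0 1 \<Longrightarrow> v \<noteq> 0 \<Longrightarrow>
               cmod (\<Sum>i\<in>UNIV. \<Sum>j\<in>UNIV. v $ i * S \<zeta> $ i $ j * v $ j)
                 < Re (\<Sum>i\<in>UNIV. \<Sum>j\<in>UNIV. v $ i * H \<zeta> $ i $ j * cnj (v $ j))"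
    and g: "disc_problem.sol (symbol H S) m \<alpha> (\<lambda>_. 0) g"
    and p: "p \<in> sphere 0 1" and g0: "g p = 0" "disc_deriv_at g p 0" and z: "z \<in> cball 0 1"
  shows "g z = 0"
proof -
  interpret P: disc_problem "symbol H S" \<epsilon> \<Lambda> m \<alpha> by fact
  have pc: "p \<in> cball 0 1" using p by simp
  obtain F where F: "hol_disc m \<alpha> F" "\<And>\<zeta>. \<zeta> \<in> sphere 0 1 \<Longrightarrow> F \<zeta> = symbol H S \<zeta> (cnj \<zeta> *s g \<zeta>)"
    using g unfolding P.sol_def by auto
  have gd: "disc_alg_vec g" and Fd: "disc_alg_vec F" using g F by (simp_all add: P.sol_def hol_disc_iff)
  obtain w where w: "disc_deriv_at F p w" using hol_disc_differentiable[OF F(1) P.m P.al pc] .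
  have "w = 0" by (rule P.boundary_double_zero_image[OF p g0 F(2) w])
  hence dF: "disc_deriv_at F p 0" using w by simp
  have Fp: "F p = 0" using F(2)[OF p] g0(1) by (simp add: blinfun.zero_right)
  define g1 where "g1 z = (\<chi> i. diff_quot (\<lambda>z. g z $ i) p 0 z)" for z
  define F1 where "F1 z = (\<chi> i. diff_quot (\<lambda>z. F z $ i) p 0 z)" for z
  have g1: "disc_alg_vec g1" and F1: "disc_alg_vec F1"
    unfolding disc_alg_vec_def g1_def F1_def
    using gd Fd g0(2) dF pc by (auto intro!: disc_alg_diff_quot disc_alg_vec_nth simp: disc_deriv_at_def)
  have gz: "g z = (z - p) *s g1 z" and Fz: "F z = (z - p) *s F1 z" for z
    using diff_quot_mult[of "\<lambda>z. g z $ _" z p 0] diff_quot_mult[of "\<lambda>z. F z $ _" z p 0]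
    by (auto simp: vec_eq_iff g1_def F1_def g0 Fp algebra_simps)
  have at_p: "g1 p = 0" "F1 p = 0" by (simp_all add: g1_def F1_def diff_quot_def vec_eq_iff)
  define S' where "S' \<zeta> = rotate_matrix (- p * cnj \<zeta>) (S \<zeta>)" for \<zeta>
  have S': "holder_circle m \<alpha> S'"
    unfolding S'_def
    by (intro holder_circle_bilinear[OF bounded_bilinear_rotate_matrix P.al]
        holder_circle_linear[OF bounded_linear_mult_right] holder_circle_cnj P.al HS)
  have pos': "cmod (\<Sum>i\<in>UNIV. \<Sum>j\<in>UNIV. v $ i * S' \<zeta> $ i $ j * v $ j)
                 < Re (\<Sum>i\<in>UNIV. \<Sum>j\<in>UNIV. v $ i * H \<zeta> $ i $ j * cnj (v $ j))"
    if \<zeta>: "\<zeta> \<in> sphere 0 1" and v: "v \<noteq> 0" for \<zeta> v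
  proof -
    have "(\<Sum>i\<in>UNIV. \<Sum>j\<in>UNIV. v $ i * S' \<zeta> $ i $ j * v $ j) =
        (- p * cnj \<zeta>) * (\<Sum>i\<in>UNIV. \<Sum>j\<in>UNIV. v $ i * S \<zeta> $ i $ j * v $ j)"
      unfolding S'_def rotate_matrix_def sum_distrib_left by (intro sum.cong refl) (simp add: mult_ac)
    hence "cmod (\<Sum>i\<in>UNIV. \<Sum>j\<in>UNIV. v $ i * S' \<zeta> $ i $ j * v $ j) =
        cmod (\<Sum>i\<in>UNIV. \<Sum>j\<in>UNIV. v $ i * S \<zeta> $ i $ j * v $ j)"
      using \<zeta> p by (simp add: norm_mult)
    thus ?thesis using pos[OF \<zeta> v] by (simp only:)
  qed
  obtain \<epsilon>' \<Lambda>' where prob': "disc_problem (symbol H S') \<epsilon>' \<Lambda>' m \<alpha>"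
    using disc_problem_symbol[OF P.m P.alpha HS(1) S' pos'] by blast
  interpret Q: disc_problem "symbol H S'" \<epsilon>' \<Lambda>' m \<alpha> by (rule prob')
  \<comment> \<open>After the division the equation holds for \<open>g1\<close> itself, without a
    factor \<open>cnj \<zeta>\<close>, with \<open>(- p) *s F1\<close> as its holomorphic side; the
    second zero of \<open>g\<close> at \<open>p\<close> is a simple zero of \<open>g1\<close>, as
    \<open>boundary_zero\<close> requires.\<close>
  have "g1 z = 0"
  proof (rule Q.boundary_zero[OF g1 _ _ p at_p(1) z])
    show "disc_alg_vec (\<lambda>z. (- p) *s F1 z)" by (intro disc_alg_vec_cmult disc_alg_const F1)
    fix \<zeta> :: complex assume \<zeta>: "\<zeta> \<in> sphere 0 1"
    show "(- p) *s F1 \<zeta> = symbol H S' \<zeta> (g1 \<zeta>)"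
    proof (cases "\<zeta> = p")
      \<comment> \<open>Here the factor \<open>\<zeta> - p\<close> cannot be cancelled, but both
        sides vanish because \<open>g\<close> and \<open>F\<close> each have a double zero at
        \<open>p\<close>.\<close>
      case True
      thus ?thesis by (simp add: at_p blinfun.zero_right)
    next
      case False
      have 1: "\<zeta> * cnj \<zeta> = 1" "p * cnj p = 1" using \<zeta> p by (simp_all add: complex_norm_square[symmetric])
      have "\<zeta> * cnj (\<zeta> - p) * (- p) = - p * (\<zeta> * cnj \<zeta>) + \<zeta> * (p * cnj p)"
        by (simp add: algebra_simps)
      \<comment> \<open>The factor \<open>- p\<close> is chosen so that the conjugated term with
        \<open>H\<close> gets exactly \<open>\<zeta> - p\<close>; the price is the unimodular factor
        on \<open>S\<close>.\<close>
      hence c: "(- p) * cnj (cnj \<zeta> * (\<zeta> - p)) = \<zeta> - p" unfolding 1 by (simp add: mult_ac)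
      have "(\<zeta> - p) *s ((- p) *s F1 \<zeta>) = (- p) *s F \<zeta>"
        by (simp add: Fz vec_eq_iff algebra_simps)
      also have "F \<zeta> = symbol H S \<zeta> ((cnj \<zeta> * (\<zeta> - p)) *s g1 \<zeta>)"
        unfolding F(2)[OF \<zeta>] gz[of \<zeta>] by (simp only: vector_smult_assoc)
      also have "\<dots> = cnj (cnj \<zeta> * (\<zeta> - p)) *s (H \<zeta> *v cnj_vec (g1 \<zeta>)) + (cnj \<zeta> * (\<zeta> - p)) *s (S \<zeta> *v g1 \<zeta>)"
        by (simp only: symbol_apply cnj_vec_smult matrix_vector_smult)
      also have "(- p) *s \<dots> = ((- p) * cnj (cnj \<zeta> * (\<zeta> - p))) *s (H \<zeta> *v cnj_vec (g1 \<zeta>)) +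
          (\<zeta> - p) *s ((- p * cnj \<zeta>) *s (S \<zeta> *v g1 \<zeta>))"
        by (simp add: vec_eq_iff algebra_simps)
      also have "\<dots> = (\<zeta> - p) *s symbol H S' \<zeta> (g1 \<zeta>)"
        unfolding c by (simp add: symbol_apply S'_def rotate_matrix_mult vec_eq_iff algebra_simps)
      finally have "(\<zeta> - p) *s ((- p) *s F1 \<zeta>) = (\<zeta> - p) *s symbol H S' \<zeta> (g1 \<zeta>)" .
      thus ?thesis using False by (simp only: vector_mul_lcancel right_minus_eq simp_thms)
    qed
  qed
  thus ?thesis by (simp add: gz)
qed

theorem theorem2p2:
  fixes m :: nat and \<alpha> :: real
    and H S :: "complex \<Rightarrow> complex ^ 'n ^ 'n"
    and f :: "complex \<Rightarrow> complex ^ 'n"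
    and \<zeta>0 :: complex and z0 v0 :: "complex ^ 'n"
  assumes m: "m \<ge> 1" and alpha: "0 < \<alpha>" "\<alpha> < 1"
    and HS_reg: "holder_circle m \<alpha> H" "holder_circle m \<alpha> S"
    and herm: "\<forall>\<zeta>\<in>sphere 0 1. \<forall>i j. H \<zeta> $ i $ j = cnj (H \<zeta> $ j $ i)"
    and symm: "\<forall>\<zeta>\<in>sphere 0 1. transpose (S \<zeta>) = S \<zeta>"
    and pos: "\<forall>\<zeta>\<in>sphere 0 1. \<forall>v::complex ^ 'n. v \<noteq> 0 \<longrightarrow>
               cmod (\<Sum>i\<in>UNIV. \<Sum>j\<in>UNIV. v $ i * S \<zeta> $ i $ j * v $ j)
                 < Re (\<Sum>i\<in>UNIV. \<Sum>j\<in>UNIV. v $ i * H \<zeta> $ i $ j * cnj (v $ j))"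
    and f_reg: "holder_circle m \<alpha> f"
    and z: "\<zeta>0 \<in> cball 0 1"
  shows "\<exists>g. (hol_disc m \<alpha> g \<and> g \<zeta>0 = z0 \<and> disc_deriv_at g \<zeta>0 v0 \<and>
              in_O m \<alpha> (\<lambda>\<zeta>. H \<zeta> *v (\<chi> i. cnj (g \<zeta> $ i / \<zeta>))
                           + S \<zeta> *v (\<chi> i. g \<zeta> $ i / \<zeta>) + f \<zeta>))
          \<and> (\<forall>g'. hol_disc m \<alpha> g' \<and> g' \<zeta>0 = z0 \<and> disc_deriv_at g' \<zeta>0 v0 \<and>
              in_O m \<alpha> (\<lambda>\<zeta>. H \<zeta> *v (\<chi> i. cnj (g' \<zeta> $ i / \<zeta>))
                           + S \<zeta> *v (\<chi> i. g' \<zeta> $ i / \<zeta>) + f \<zeta>)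
              \<longrightarrow> (\<forall>z\<in>cball 0 1. g' z = g z))"
proof -
  have pos': "\<And>\<zeta> v. \<zeta> \<in> sphere 0 1 \<Longrightarrow> v \<noteq> 0 \<Longrightarrow>
               cmod (\<Sum>i\<in>UNIV. \<Sum>j\<in>UNIV. v $ i * S \<zeta> $ i $ j * v $ j)
                 < Re (\<Sum>i\<in>UNIV. \<Sum>j\<in>UNIV. v $ i * H \<zeta> $ i $ j * cnj (v $ j))"
    using pos by blast
  obtain \<epsilon> \<Lambda> where prob: "disc_problem (symbol H S) \<epsilon> \<Lambda> m \<alpha>"
    using disc_problem_symbol[OF m alpha HS_reg pos'] by blast
  interpret P: disc_problem "symbol H S" \<epsilon> \<Lambda> m \<alpha> by (rule prob)
  have quot: "(\<chi> i. cnj (g \<zeta> $ i / \<zeta>)) = cnj_vec (cnj \<zeta> *s g \<zeta>)" "(\<chi> i. g \<zeta> $ i / \<zeta>) = cnj \<zeta> *s g \<zeta>"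
    if "\<zeta> \<in> sphere 0 1" for \<zeta> and g :: "complex \<Rightarrow> complex ^ 'n"
  proof -
    have "\<zeta> * cnj \<zeta> = 1" "\<zeta> \<noteq> 0" using that by (auto simp: complex_norm_square[symmetric])
    hence "x / \<zeta> = cnj \<zeta> * x" for x by (simp add: field_simps)
    thus "(\<chi> i. cnj (g \<zeta> $ i / \<zeta>)) = cnj_vec (cnj \<zeta> *s g \<zeta>)" "(\<chi> i. g \<zeta> $ i / \<zeta>) = cnj \<zeta> *s g \<zeta>"
      by (simp_all add: vec_eq_iff cnj_vec_def)
  qed
  have sol: "P.sol f g \<longleftrightarrow> hol_disc m \<alpha> g \<and>
      in_O m \<alpha> (\<lambda>\<zeta>. H \<zeta> *v (\<chi> i. cnj (g \<zeta> $ i / \<zeta>)) + S \<zeta> *v (\<chi> i. g \<zeta> $ i / \<zeta>) + f \<zeta>)" for g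
    unfolding P.sol_def in_O_def by (simp only: quot symbol_apply cong: ball_cong)
  have uniq: "g z = 0" if "P.sol (\<lambda>_. 0) g" "g \<zeta>0 = 0" "disc_deriv_at g \<zeta>0 0" "z \<in> cball 0 1" for g z
  proof (cases "\<zeta>0 \<in> ball 0 1")
    case True
    thus ?thesis using P.unique_interior that by blast
  next
    case False
    hence "\<zeta>0 \<in> sphere 0 1" using z by simp
    thus ?thesis using unique_boundary[OF prob HS_reg pos' that(1) _ that(2,3,4)] by blast
  qed
  have "\<forall>g. P.sol (\<lambda>_. 0) g \<and> g \<zeta>0 = 0 \<and> disc_deriv_at g \<zeta>0 0 \<longrightarrow> (\<forall>z\<in>cball 0 1. g z = 0)"
    using uniq by blast
  from P.solution_by_dimension[OF this z f_reg, of z0 v0] show ?thesis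
    unfolding sol by blast
qed

end
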